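(* Let $K$ be an algebraically closed field with a nontrivial non-Archimedean valuation $\operatorname{val}$, $1\le d\le n-1$, $X\le K^n$ a linear subspace of dimension $d+1$ with Plücker coordinates $(q_I)$, and $S\subseteq[n]$ such that there is $C\in\binom{[n]}{d+1}$ with $S\subseteq C$ and $q_C\neq0$. Assume moreover that $L^S(X)$ has trivial valuations (or, more strongly, that $X$ has constant coefficients). Then $\operatorname{trop}(L^S(X))$ is the extended Bergman fan of the linear matroid $\mathcal{M}(L^S(X))$, which is given by $$\mathcal{M}(L^S(X))=\mathcal{M}_S\oplus\mathcal{M}_{S,0}\oplus\bigoplus_{a\in S}\mathcal{M}_{S,a}.$$
   Context: $\mathrm{Gr}(d,n)\subseteq\mathbb{P}^{\binom{n}{d}-1}$ is the Grassmannian in its Plücker embedding; $\mathrm{pr}_S:K^n\to K^n$ kills $e_i$ for $i\in S$ and fixes $e_i$ for $i\notin S$; $L^S(X)=\{Y\in\mathrm{Gr}(d,n):\mathrm{pr}_S(Y)\subseteq X\}$, $L(X)=L^\emptyset(X)$. Under the hypothesis on $S$, $L^S(X)$ is a projective linear subspace of dimension $d$; its linear matroid is the matroid on $\binom{[n]}{d}$ of linear dependencies among the columns of a matrix whose row space is the underlying vector space. In the displayed decomposition, $\mathcal{M}_S$ is the restriction of $\mathcal{M}(L(X))$ to the $d$-sets containing $S$, $\mathcal{M}_{S,0}$ is the rank zero matroid on the $d$-sets missing at least two elements of $S$, and $\mathcal{M}_{S,a}$ is the rank one matroid on the $d$-sets $J$ with $S\setminus J=\{a\}$ in which $J$ is independent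 iff $q_{J\cup a}\neq0$. A linear space has trivial valuations if, up to adding a common constant, all valuations of its Plücker coordinates lie in $\{0,\infty\}$. $X$ has constant coefficients if it is defined over a subfield of $K$ on which the valuation is trivial. $\overline{\mathbb{R}}=\mathbb{R}\cup\{\infty\}$, $\mathbb{TP}^m=(\overline{\mathbb{R}}^{m+1}\setminus\{(\infty,\dots,\infty)\})/\mathbb{R}$. For a projective variety $Z\subseteq\mathbb{P}^m$ with ideal $I$, $\operatorname{trop}(Z)\subseteq\mathbb{TP}^m$ is the set of $w$ such that for all homogeneous $f=\sum c_ux^u\in I$ the minimum $\min_u(\operatorname{val}(c_u)+u\cdot w)$ is $\infty$ or attained at least twice (with $0\cdot\infty=0$). The extended Bergman fan of a matroid $\mathcal{M}$ on a finite set $E$ is the collection (and its support, a subset of the tropical projective space with coordinates indexed by $E$) of cones $$C_{F_\bullet}=\infty\cdot e_{F_0}+\operatorname{cone}(e_{F_1},\dots,e_{F_s})+\mathbb{R}e_E$$ for all chains of flats $F_0\subset F_1\subset\dots\subset F_s\subset E$ of $\mathcal{M}$ (strict inclusions, $F_0$ not necessarily empty), where $e_F=\sum_{j\in F}e_j$. *)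

theory Defs
  imports
    Complex_Main
    "HOL-Library.Extended_Real"
    "HOL-Library.FuncSet"
    "HOL-Library.Function_Algebras"
    "HOL-Library.Indicator_Function"
    "HOL-Library.Poly_Mapping"
    "HOL-Computational_Algebra.Polynomial"
    "Jordan_Normal_Form.Determinant"
begin

section \<open>Coordinate spaces\<close>

text \<open>
  The space \<open>K\<^sup>E\<close> is the set of functions that vanish outside \<open>E\<close>; \<open>K\<^sup>n\<close> is the case
  \<open>E = {1..n}\<close>.
\<close>

definition fscale :: "'k::field \<Rightarrow> ('i \<Rightarrow> 'k) \<Rightarrow> 'i \<Rightarrow> 'k" where
  "fscale c v = (\<lambda>i. c * v i)"

global_interpretation fun_vs: vector_space "fscale :: 'k::field \<Rightarrow> ('i \<Rightarrow> 'k) \<Rightarrow> 'i \<Rightarrow> 'k"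
  by unfold_locales (auto simp: fscale_def fun_eq_iff algebra_simps)

definition coord_space :: "'i set \<Rightarrow> ('i \<Rightarrow> 'k::field) set" where
  "coord_space E = {v. \<forall>i. i \<notin> E \<longrightarrow> v i = 0}"

definition dsets :: "nat \<Rightarrow> nat \<Rightarrow> nat set set" where
  "dsets n d = {J. J \<subseteq> {1..n} \<and> card J = d}"

section \<open>Valuations\<close>

locale nonarch_valuation =
  fixes val :: "'k::field \<Rightarrow> ereal"
  assumes val_not_MInf: "val x \<noteq> -\<infinity>"
    and val_eq_PInf_iff: "val x = \<infinity> \<longleftrightarrow> x = 0"
    and val_mult: "val (x * y) = val x + val y"
    and val_add: "min (val x) (val y) \<le> val (x + y)"

definition is_subfield :: "'k::field set \<Rightarrow> bool" where
  "is_subfield F \<longleftrightarrow> 0 \<in> F \<and> 1 \<in> F \<and> (\<forall>x\<in>F. \<forall>y\<in>F. x + y \<in> F \<and> x * y \<in> F)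
     \<and> (\<forall>x\<in>F. - x \<in> F \<and> inverse x \<in> F)"

definition constant_coefficients :: "('k::field \<Rightarrow> ereal) \<Rightarrow> ('i \<Rightarrow> 'k) set \<Rightarrow> bool" where
  "constant_coefficients val X \<longleftrightarrow>
     (\<exists>F. is_subfield F \<and> (\<forall>x\<in>F. x \<noteq> 0 \<longrightarrow> val x = 0)
        \<and> (\<exists>B. (\<forall>v\<in>B. \<forall>i. v i \<in> F) \<and> X = fun_vs.span B))"

section \<open>Pluecker coordinates and Grassmannians\<close>

definition row_basis :: "nat \<Rightarrow> (nat \<Rightarrow> 'i \<Rightarrow> 'k::field) \<Rightarrow> ('i \<Rightarrow> 'k) set \<Rightarrow> bool" where
  "row_basis r R V \<longleftrightarrow> inj_on R {..<r} \<and> fun_vs.independent (R ` {..<r}) \<and> fun_vs.span (R ` {..<r}) = V"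

text \<open>The minor of the matrix with rows \<open>R 0, R 1, \<dots>\<close> in the columns listed by \<open>js\<close>.\<close>

definition minor :: "(nat \<Rightarrow> 'i \<Rightarrow> 'k::field) \<Rightarrow> 'i list \<Rightarrow> 'k" where
  "minor R js = det (mat (length js) (length js) (\<lambda>(i, j). R i (js ! j)))"

text \<open>
  Pluecker coordinates are determined up to a common nonzero factor, hence a relation:
  \<open>p\<close> is one of the vectors of Pluecker coordinates of the \<open>d\<close>-dimensional subspace \<open>Y\<close> of \<open>K\<^sup>n\<close>.
\<close>

definition plucker_coords ::
    "nat \<Rightarrow> nat \<Rightarrow> (nat \<Rightarrow> 'k::field) set \<Rightarrow> (nat set \<Rightarrow> 'k) \<Rightarrow> bool" where
  "plucker_coords d n Y p \<longleftrightarrow>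
     (\<exists>R. row_basis d R Y
        \<and> p = (\<lambda>J. if J \<in> dsets n d then minor R (sorted_list_of_set J) else 0))"

definition Gr :: "nat \<Rightarrow> nat \<Rightarrow> (nat \<Rightarrow> 'k::field) set set" where
  "Gr d n = {Y. fun_vs.subspace Y \<and> Y \<subseteq> coord_space {1..n} \<and> fun_vs.dim Y = d}"

text \<open>
  A point of projective space is a line through the origin, so that subsets of projective space
  are sets of lines.  This is the image under the Pluecker embedding of a set of points of
  \<open>Gr d n\<close>.
\<close>

definition plucker_image ::
    "nat \<Rightarrow> nat \<Rightarrow> (nat \<Rightarrow> 'k::field) set set \<Rightarrow> (nat set \<Rightarrow> 'k) set set" where
  "plucker_image d n \<Y> = {fun_vs.span {p} |p. \<exists>Y\<in>\<Y>. plucker_coords d n Y p}"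

definition pr :: "nat set \<Rightarrow> (nat \<Rightarrow> 'k::field) \<Rightarrow> nat \<Rightarrow> 'k" where
  "pr S v = (\<lambda>i. if i \<in> S then 0 else v i)"

definition LS :: "nat \<Rightarrow> nat \<Rightarrow> nat set \<Rightarrow> (nat \<Rightarrow> 'k::field) set \<Rightarrow> (nat set \<Rightarrow> 'k) set set" where
  "LS d n S X = plucker_image d n {Y \<in> Gr d n. pr S ` Y \<subseteq> X}"

definition underlying_space :: "('i \<Rightarrow> 'k::field) set set \<Rightarrow> ('i \<Rightarrow> 'k) set" where
  "underlying_space Z = insert 0 (\<Union>Z)"

text \<open>
  Here \<open>V\<close> is a subspace of \<open>K\<^sup>E\<close> for an index set \<open>E\<close> that need not be ordered.  Its Pluecker
  coordinates are taken over all orderings \<open>js\<close> of the index sets, which only changes their sign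
  and not their valuation.
\<close>

definition trivial_valuations ::
    "('k::field \<Rightarrow> ereal) \<Rightarrow> 'i set \<Rightarrow> ('i \<Rightarrow> 'k) set \<Rightarrow> bool" where
  "trivial_valuations val E V \<longleftrightarrow>
     (\<exists>R. row_basis (fun_vs.dim V) R V
        \<and> (\<exists>c::real. \<forall>js. distinct js \<and> set js \<subseteq> E \<and> length js = fun_vs.dim V
             \<longrightarrow> val (minor R js) + ereal c \<in> {0, \<infinity>}))"

section \<open>Tropicalization\<close>

text \<open>Polynomials in the variables \<open>x\<^sub>i\<close>; an exponent vector is a finitely supported map.\<close>

type_synonym ('i, 'k) mpoly = "('i \<Rightarrow>\<^sub>0 nat) \<Rightarrow>\<^sub>0 'k"

definition vars_in :: "'i set \<Rightarrow> ('i, 'k::field) mpoly \<Rightarrow> bool" where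
  "vars_in E f \<longleftrightarrow> (\<forall>u\<in>Poly_Mapping.keys f. Poly_Mapping.keys u \<subseteq> E)"

definition mon_degree :: "('i \<Rightarrow>\<^sub>0 nat) \<Rightarrow> nat" where
  "mon_degree u = (\<Sum>i\<in>Poly_Mapping.keys u. Poly_Mapping.lookup u i)"

definition homogeneous :: "('i, 'k::field) mpoly \<Rightarrow> bool" where
  "homogeneous f \<longleftrightarrow> (\<exists>k. \<forall>u\<in>Poly_Mapping.keys f. mon_degree u = k)"

definition eval_mpoly :: "('i, 'k::field) mpoly \<Rightarrow> ('i \<Rightarrow> 'k) \<Rightarrow> 'k" where
  "eval_mpoly f x = (\<Sum>u\<in>Poly_Mapping.keys f.
      Poly_Mapping.lookup f u * (\<Prod>i\<in>Poly_Mapping.keys u. x i ^ Poly_Mapping.lookup u i))"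

definition vanishing_ideal :: "'i set \<Rightarrow> ('i \<Rightarrow> 'k::field) set set \<Rightarrow> ('i, 'k) mpoly set" where
  "vanishing_ideal E Z = {f. vars_in E f \<and> (\<forall>P\<in>Z. \<forall>x\<in>P. eval_mpoly f x = 0)}"

text \<open>
  Tropical projective space with coordinates indexed by \<open>E\<close>: its points are the classes of
  vectors in \<open>(\<real> \<union> {\<infinity>})\<^sup>E\<close> with a finite entry, modulo addition of real constants.  A subset is
  given in the form \<open>A // trop_rel E\<close>, the image of a set \<open>A\<close> of such vectors.
\<close>

definition trop_vectors :: "'i set \<Rightarrow> ('i \<Rightarrow> ereal) set" where
  "trop_vectors E = {w \<in> E \<rightarrow>\<^sub>E (UNIV - {-\<infinity>}). \<exists>i\<in>E. w i \<noteq> \<infinity>}"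

definition trop_rel :: "'i set \<Rightarrow> (('i \<Rightarrow> ereal) \<times> ('i \<Rightarrow> ereal)) set" where
  "trop_rel E = {(w, w'). w \<in> trop_vectors E \<and> w' \<in> trop_vectors E
     \<and> (\<exists>c::real. \<forall>i\<in>E. w' i = w i + ereal c)}"

definition trop_term ::
    "('k::field \<Rightarrow> ereal) \<Rightarrow> 'i set \<Rightarrow> ('i, 'k) mpoly \<Rightarrow> ('i \<Rightarrow> ereal) \<Rightarrow> ('i \<Rightarrow>\<^sub>0 nat) \<Rightarrow> ereal" where
  "trop_term val E f w u =
     val (Poly_Mapping.lookup f u) + (\<Sum>i\<in>E. ereal (real (Poly_Mapping.lookup u i)) * w i)"

definition trop_vanishes ::
    "('k::field \<Rightarrow> ereal) \<Rightarrow> 'i set \<Rightarrow> ('i, 'k) mpoly \<Rightarrow> ('i \<Rightarrow> ereal) \<Rightarrow> bool" where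
  "trop_vanishes val E f w \<longleftrightarrow>
     (let \<mu> = (INF u\<in>Poly_Mapping.keys f. trop_term val E f w u)
      in \<mu> = \<infinity> \<or> (\<exists>u\<in>Poly_Mapping.keys f. \<exists>v\<in>Poly_Mapping.keys f.
            u \<noteq> v \<and> trop_term val E f w u = \<mu> \<and> trop_term val E f w v = \<mu>))"

definition trop ::
    "('k::field \<Rightarrow> ereal) \<Rightarrow> 'i set \<Rightarrow> ('i \<Rightarrow> 'k) set set \<Rightarrow> ('i \<Rightarrow> ereal) set set" where
  "trop val E Z =
     {w \<in> trop_vectors E. \<forall>f\<in>vanishing_ideal E Z. homogeneous f \<longrightarrow> trop_vanishes val E f w}
       // trop_rel E"

section \<open>Matroids\<close>

record 'i matroid =
  ground :: "'i set"
  indep :: "'i set set"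

definition matroid_restrict :: "'i matroid \<Rightarrow> 'i set \<Rightarrow> 'i matroid" where
  "matroid_restrict M A = \<lparr>ground = A, indep = {I \<in> indep M. I \<subseteq> A}\<rparr>"

text \<open>Both direct sums are meant for matroids on pairwise disjoint ground sets.\<close>

definition direct_sum :: "'i matroid \<Rightarrow> 'i matroid \<Rightarrow> 'i matroid" (infixl "\<oplus>\<^sub>M" 65) where
  "M \<oplus>\<^sub>M N = \<lparr>ground = ground M \<union> ground N,
     indep = {I. I \<subseteq> ground M \<union> ground N \<and> I \<inter> ground M \<in> indep M \<and> I \<inter> ground N \<in> indep N}\<rparr>"

definition direct_sum_family :: "'a set \<Rightarrow> ('a \<Rightarrow> 'i matroid) \<Rightarrow> 'i matroid" where
  "direct_sum_family A M = \<lparr>ground = (\<Union>a\<in>A. ground (M a)),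
     indep = {I. I \<subseteq> (\<Union>a\<in>A. ground (M a)) \<and> (\<forall>a\<in>A. I \<inter> ground (M a) \<in> indep (M a))}\<rparr>"

definition rank :: "'i matroid \<Rightarrow> 'i set \<Rightarrow> nat" where
  "rank M A = Max (card ` {I \<in> indep M. I \<subseteq> A})"

definition flat :: "'i matroid \<Rightarrow> 'i set \<Rightarrow> bool" where
  "flat M F \<longleftrightarrow> F \<subseteq> ground M \<and> (\<forall>x\<in>ground M - F. rank M F < rank M (insert x F))"

text \<open>
  The matroid of linear dependencies among the columns of a matrix with rows
  \<open>R 0, \<dots>, R (m - 1)\<close> whose row space is \<open>V\<close>; it does not depend on the choice of the matrix.
  Injectivity excludes repeated columns.
\<close>

definition column :: "nat \<Rightarrow> (nat \<Rightarrow> 'i \<Rightarrow> 'k::field) \<Rightarrow> 'i \<Rightarrow> nat \<Rightarrow> 'k" where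
  "column m R j = (\<lambda>i. if i < m then R i j else 0)"

definition linear_matroid :: "'i set \<Rightarrow> ('i \<Rightarrow> 'k::field) set \<Rightarrow> 'i matroid" where
  "linear_matroid E V = \<lparr>ground = E,
     indep = {I. I \<subseteq> E \<and> (\<exists>m R. fun_vs.span (R ` {..<m}) = V
        \<and> inj_on (column m R) I \<and> fun_vs.independent (column m R ` I))}\<rparr>"

text \<open>The cone of the chain of flats \<open>F 0 \<subset> \<dots> \<subset> F s\<close>; note that \<open>\<infinity> * 0 = 0\<close> for \<^typ>\<open>ereal\<close>.\<close>

definition bergman_cone :: "'i set \<Rightarrow> nat \<Rightarrow> (nat \<Rightarrow> 'i set) \<Rightarrow> ('i \<Rightarrow> ereal) set" where
  "bergman_cone E s F =
     {\<lambda>j\<in>E. \<infinity> * indicator (F 0) j + (\<Sum>i=1..s. ereal (l i) * indicator (F i) j)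
             + ereal r * indicator E j
       |l r. \<forall>i\<in>{1..s}. 0 \<le> l i}"

definition extended_bergman_fan :: "'i matroid \<Rightarrow> ('i \<Rightarrow> ereal) set set set" where
  "extended_bergman_fan M =
     {bergman_cone (ground M) s F // trop_rel (ground M) |s F.
        (\<forall>i\<le>s. flat M (F i)) \<and> (\<forall>i<s. F i \<subset> F (Suc i)) \<and> F s \<subset> ground M}"

section \<open>The summands of the matroid of \<open>L\<^sup>S(X)\<close>\<close>

definition M_S :: "nat \<Rightarrow> nat \<Rightarrow> nat set \<Rightarrow> (nat \<Rightarrow> 'k::field) set \<Rightarrow> nat set matroid" where
  "M_S d n S X = matroid_restrict
     (linear_matroid (dsets n d) (underlying_space (LS d n {} X))) {J \<in> dsets n d. S \<subseteq> J}"

definition M_S0 :: "nat \<Rightarrow> nat \<Rightarrow> nat set \<Rightarrow> nat set matroid" where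
  "M_S0 d n S = \<lparr>ground = {J \<in> dsets n d. 2 \<le> card (S - J)}, indep = {{}}\<rparr>"

definition M_Sa ::
    "nat \<Rightarrow> nat \<Rightarrow> nat set \<Rightarrow> (nat set \<Rightarrow> 'k::field) \<Rightarrow> nat \<Rightarrow> nat set matroid" where
  "M_Sa d n S q a = \<lparr>ground = {J \<in> dsets n d. S - J = {a}},
     indep = insert {} {{J} |J. J \<in> dsets n d \<and> S - J = {a} \<and> q (insert a J) \<noteq> 0}\<rparr>"

end

theory Submission
  imports Defs
begin

text \<open>
  Let \<open>W\<close> be the space of all vectors of \<open>K\<^sup>n\<close> whose projection \<open>pr S\<close> lies in \<open>X\<close>.  The
  hypothesis on \<open>S\<close> says that some coordinate set \<open>C \<supseteq> S\<close> of \<open>d + 1\<close> elements consists of pivots for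
  \<open>X\<close>.  Then \<open>C\<close> is a set of pivots for \<open>W\<close> as well: in the reduced row echelon form of \<open>X\<close>,
  replace the rows with pivot in \<open>S\<close> by unit vectors.  In particular \<open>dim W = d + 1\<close>, and
  \<open>L\<^sup>S(X)\<close> is the set of all hyperplanes of \<open>W\<close>.  It is a projective space: adding the column of
  the values of a functional to the echelon form turns the Pluecker coordinates of the kernel of the
  functional into minors that are linear in the functional (\<open>underlying_space_hyperplanes\<close>).

  \<^bold>\<open>The matroid.\<close>  The coordinate at \<open>J\<close> is thus a linear form in the values \<open>\<lambda>\<^sub>c\<close>, \<open>c \<in> C\<close>, of the
  functional.  Expanding the minor along the unit rows and columns shows that the form is zero if
  \<open>J\<close> misses two elements of \<open>S\<close>, a multiple of \<open>\<lambda>\<^sub>a\<close> if \<open>S - J = {a}\<close>, with a factor that is up to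
  sign the Pluecker coordinate of \<open>W\<close> at \<open>J \<union> {a}\<close> and hence vanishes iff that of \<open>X\<close> does, and
  the same form as for \<open>X\<close> in the variables \<open>\<lambda>\<^sub>c\<close> with \<open>c \<notin> S\<close> if \<open>S \<subseteq> J\<close>.  Forms in disjoint sets of
  variables are independent of each other, which gives the direct sum
  (\<open>linear_matroid_decomposition\<close>).

  \<^bold>\<open>The tropicalization.\<close>  This part works for every linear space \<open>V \<subseteq> K\<^sup>E\<close> with trivial
  valuations (\<open>trop_eq_Union_extended_bergman_fan\<close>).  By Cramer's rule the vectors dual to a basis
  of the matroid have entries of valuation \<open>0\<close> or \<open>\<infinity>\<close>.  Consequently, the linear relations that
  express an element of the matroid through a basis have coefficients of valuation \<open>0\<close>; as tropical
  linear forms they force all superlevel sets of a point of the tropicalization to be flats, so that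
  the point is in the cone of these flats (\<open>superlevel_set_flat\<close>).  Conversely, every flat \<open>F\<close> is the
  zero set of a vector of \<open>V\<close> whose other entries have valuation \<open>0\<close> (\<open>generic_point_of_flat\<close>).  For
  a chain of flats, combining these vectors with coefficients of different valuations gives points
  of \<open>V\<close> with prescribed valuations, constant on the steps of the chain.  The value group is dense in
  \<open>\<real>\<close>, so every point of the cone is a limit of such valuations, and a tropical polynomial that
  vanishes at these also vanishes at the limit (\<open>trop_vanishes_limit\<close>).

  If \<open>X\<close> has constant coefficients, then so do its echelon form and that of \<open>W\<close>, and all Pluecker
  coordinates of \<open>L\<^sup>S(X)\<close> are elements of the trivially valued subfield.
\<close>

section \<open>Linear combinations and minors\<close>

lemma sum_fun_apply: "(\<Sum>a\<in>A. f a) x = (\<Sum>a\<in>A. f a x)"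
  by (induction A rule: infinite_finite_induct) auto

lemma sum_fscale_eq: "(\<Sum>a\<in>A. fscale (c a) (f a)) = (\<lambda>j. \<Sum>a\<in>A. c a * f a j)"
  by (rule ext) (simp add: sum_fun_apply fscale_def)

lemma subspace_lincomb:
  assumes "fun_vs.subspace V" "\<And>a. a \<in> A \<Longrightarrow> f a \<in> V"
  shows "(\<lambda>j. \<Sum>a\<in>A. c a * f a j) \<in> V"
  unfolding sum_fscale_eq[symmetric]
  by (intro fun_vs.subspace_sum fun_vs.subspace_scale assms)

lemma in_span_rows_iff:
  "v \<in> fun_vs.span (R ` {..<m::nat}) \<longleftrightarrow> (\<exists>c. v = (\<lambda>j. \<Sum>k<m. c k * R k j))"
proof
  let ?U = "{v. \<exists>c. v = (\<lambda>j. \<Sum>k<m. c k * R k j)}"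
  have "fun_vs.subspace ?U"
  proof (rule fun_vs.subspaceI)
    show "0 \<in> ?U" by (auto intro!: exI[of _ "\<lambda>_. 0"])
  next
    fix x y assume "x \<in> ?U" "y \<in> ?U"
    then obtain a b where "x = (\<lambda>j. \<Sum>k<m. a k * R k j)" "y = (\<lambda>j. \<Sum>k<m. b k * R k j)"
      by auto
    then show "x + y \<in> ?U"
      by (auto intro!: exI[of _ "\<lambda>k. a k + b k"] simp: fun_eq_iff sum.distrib algebra_simps)
  next
    fix c x assume "x \<in> ?U"
    then obtain a where "x = (\<lambda>j. \<Sum>k<m. a k * R k j)" by auto
    then show "fscale c x \<in> ?U"
      by (auto intro!: exI[of _ "\<lambda>k. c * a k"] simp: fscale_def fun_eq_iff sum_distrib_left mult.assoc)
  qed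
  moreover have "R ` {..<m} \<subseteq> ?U"
  proof clarify
    fix i assume "i < m"
    then have "R i = (\<lambda>j. \<Sum>k<m. of_bool (k = i) * R k j)"
      by (auto simp: fun_eq_iff of_bool_def if_distrib[where f="\<lambda>x. x * _"] cong: if_cong)
    then show "\<exists>c. R i = (\<lambda>j. \<Sum>k<m. c k * R k j)"
      by (intro exI[of _ "\<lambda>k. of_bool (k = i)"])
  qed
  ultimately have "fun_vs.span (R ` {..<m}) \<subseteq> ?U" by (intro fun_vs.span_minimal)
  then show "v \<in> fun_vs.span (R ` {..<m}) \<Longrightarrow> \<exists>c. v = (\<lambda>j. \<Sum>k<m. c k * R k j)" by auto
next
  assume "\<exists>c. v = (\<lambda>j. \<Sum>k<m. c k * R k j)"
  then obtain c where "v = (\<lambda>j. \<Sum>k<m. c k * R k j)" by blast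
  then show "v \<in> fun_vs.span (R ` {..<m})"
    by (simp only:) (rule subspace_lincomb[OF fun_vs.subspace_span], auto intro: fun_vs.span_base)
qed

text \<open>
  Coefficient families on the index set \<open>A\<close> also detect a repetition \<open>f a = f b\<close>, through the
  relation with coefficients \<open>1\<close> and \<open>-1\<close>.
\<close>

lemma inj_independent_iff:
  assumes "finite A"
  shows "inj_on f A \<and> fun_vs.independent (f ` A) \<longleftrightarrow>
    (\<forall>c. (\<forall>j. (\<Sum>a\<in>A. c a * f a j) = 0) \<longrightarrow> (\<forall>a\<in>A. c a = 0))" (is "?L \<longleftrightarrow> ?R")
proof
  assume L: ?L
  then have inj: "inj_on f A" and ind: "fun_vs.independent (f ` A)" by blast+
  show ?R
  proof (intro allI impI ballI)
    fix c a assume c: "\<forall>j. (\<Sum>a\<in>A. c a * f a j) = 0" and a: "a \<in> A"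
    let ?g = "c \<circ> the_inv_into A f"
    have "(\<Sum>v\<in>f ` A. fscale (?g v) v) = (\<Sum>a\<in>A. fscale (c a) (f a))"
      using inj by (simp add: sum.reindex the_inv_into_f_f)
    also have "\<dots> = 0" using c by (simp add: sum_fscale_eq fun_eq_iff)
    finally have "?g (f a) = 0"
      using ind a assms by (intro fun_vs.independentD[of "f ` A" "f ` A"]) auto
    then show "c a = 0" using inj a by (simp add: the_inv_into_f_f)
  qed
next
  assume R: ?R
  have inj: "inj_on f A"
  proof (rule inj_onI, rule ccontr)
    fix a b assume ab: "a \<in> A" "b \<in> A" "f a = f b" "a \<noteq> b"
    define c :: "_ \<Rightarrow> 'c" where "c = (\<lambda>x. of_bool (x = a) - of_bool (x = b))"
    have "(\<Sum>x\<in>A. c x * f x j) = 0" for j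
    proof -
      have "(\<Sum>x\<in>A. c x * f x j) =
          (\<Sum>x\<in>A. if x = a then f x j else 0) - (\<Sum>x\<in>A. if x = b then f x j else 0)"
        unfolding sum_subtractf[symmetric] by (rule sum.cong) (auto simp: c_def)
      then show ?thesis using ab assms by simp
    qed
    then have "c a = 0" using R ab(1) by blast
    then show False using ab by (simp add: c_def)
  qed
  have ind: "fun_vs.independent (f ` A)"
  proof (rule fun_vs.independent_if_scalars_zero)
    fix g v assume g: "(\<Sum>v\<in>f ` A. fscale (g v) v) = 0" and v: "v \<in> f ` A"
    have "(\<Sum>a\<in>A. fscale (g (f a)) (f a)) = 0"
      using g inj by (simp add: sum.reindex)
    then have "\<forall>j. (\<Sum>a\<in>A. g (f a) * f a j) = 0"
      unfolding sum_fscale_eq by (simp add: fun_eq_iff)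
    then have "\<forall>a\<in>A. g (f a) = 0"
      using R by meson
    then show "g v = 0" using v by auto
  qed (use assms in simp)
  show ?L by (rule conjI[OF inj ind])
qed

lemma row_basis_iff:
  "row_basis m R V \<longleftrightarrow> fun_vs.span (R ` {..<m}) = V \<and>
    (\<forall>c. (\<forall>j. (\<Sum>k<m. c k * R k j) = 0) \<longrightarrow> (\<forall>k<m. c k = 0))"
proof -
  have "inj_on R {..<m} \<and> fun_vs.independent (R ` {..<m}) \<longleftrightarrow>
      (\<forall>c. (\<forall>j. (\<Sum>k<m. c k * R k j) = 0) \<longrightarrow> (\<forall>k\<in>{..<m}. c k = 0))"
    using inj_independent_iff[of "{..<m}" R, OF finite_lessThan] .
  then show ?thesis
    unfolding row_basis_def conj_assoc[symmetric]
    by (simp only: lessThan_iff Ball_def conj_commute)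
qed

lemma row_basis_subspace: "row_basis m R V \<Longrightarrow> fun_vs.subspace V"
  unfolding row_basis_def by (metis fun_vs.subspace_span)

lemma row_basis_mem: "row_basis m R V \<Longrightarrow> k < m \<Longrightarrow> R k \<in> V"
  unfolding row_basis_def by (metis fun_vs.span_base imageI lessThan_iff)

lemma row_basis_lincomb: "row_basis m R V \<Longrightarrow> (\<lambda>j. \<Sum>k<m. c k * R k j) \<in> V"
  by (rule subspace_lincomb) (simp_all add: row_basis_subspace row_basis_mem)

lemma row_basis_expand:
  assumes "row_basis m R V" "v \<in> V"
  obtains c where "v = (\<lambda>j. \<Sum>k<m. c k * R k j)"
  using assms in_span_rows_iff[of v R m] unfolding row_basis_def by auto

lemma row_basis_unique_zero:
  "row_basis m R V \<Longrightarrow> (\<And>j. (\<Sum>k<m. c k * R k j) = 0) \<Longrightarrow> k < m \<Longrightarrow> c k = 0"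
  unfolding row_basis_iff by blast

lemma row_basis_dim: "row_basis m R V \<Longrightarrow> fun_vs.dim V = m"
  unfolding row_basis_def
  by (metis card_image card_lessThan fun_vs.dim_span_eq_card_independent)

lemma row_basis_of_independent:
  assumes "fun_vs.independent B" "fun_vs.span B = V" "finite B"
  obtains R where "row_basis (card B) R V" "R ` {..<card B} = B"
proof -
  obtain R where "bij_betw R {0..<card B} B"
    using ex_bij_betw_nat_finite[OF assms(3)] by blast
  then have "inj_on R {..<card B}" "R ` {..<card B} = B"
    by (auto simp: bij_betw_def atLeast0LessThan)
  then show ?thesis using assms by (intro that[of R]) (auto simp: row_basis_def)
qed

lemma row_basis_exists:
  assumes "fun_vs.dim V = m" "m > 0 \<or> finite B" "V = fun_vs.span B"
  obtains R where "row_basis m R V" "\<And>k. k < m \<Longrightarrow> R k \<in> B"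
proof -
  obtain B' where B': "B' \<subseteq> B" "fun_vs.independent B'" "B \<subseteq> fun_vs.span B'"
    using fun_vs.maximal_independent_subset[of B] by blast
  have sp: "fun_vs.span B' = V"
    using B' assms(3) fun_vs.span_eq by (metis fun_vs.span_superset subset_trans)
  have "card B' = m" using sp B' assms(1) fun_vs.dim_span_eq_card_independent by metis
  have "finite B'"
    using assms(2)
  proof
    assume "m > 0"
    then show ?thesis using \<open>card B' = m\<close> by (intro card_ge_0_finite) simp
  qed (rule finite_subset[OF B'(1)])
  then obtain R where "row_basis (card B') R V" "R ` {..<card B'} = B'"
    using row_basis_of_independent[OF B'(2) sp] by blast
  then show ?thesis using \<open>card B' = m\<close> B'(1) by (intro that[of R]) auto
qed

text \<open>
  A spanning family of \<open>dim V\<close> vectors contains a basis; that has the same number of elements and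
  hence is the whole family.
\<close>

lemma row_basis_of_spanning:
  assumes "fun_vs.span (R ` {..<m}) = V" "fun_vs.dim V = m"
  shows "row_basis m R V"
proof -
  obtain R' where R': "row_basis m R' V" "\<And>k. k < m \<Longrightarrow> R' k \<in> R ` {..<m}"
    by (rule row_basis_exists[of V m "R ` {..<m}"]) (use assms in auto)
  have inj: "inj_on R' {..<m}" using R'(1) by (simp add: row_basis_def)
  have "R' ` {..<m} = R ` {..<m}"
  proof (rule card_subset_eq)
    show "R' ` {..<m} \<subseteq> R ` {..<m}" using R'(2) by auto
    then have "card (R' ` {..<m}) \<le> card (R ` {..<m})" by (intro card_mono) auto
    then show "card (R' ` {..<m}) = card (R ` {..<m})"
      using card_image[OF inj] card_image_le[of "{..<m}" R] by simp
  qed simp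
  then have "card (R ` {..<m}) = m" "fun_vs.independent (R ` {..<m})"
    using card_image[OF inj] R'(1) by (simp_all add: row_basis_def)
  then show ?thesis using assms(1) by (simp add: row_basis_def eq_card_imp_inj_on)
qed

lemma row_basis_extend:
  assumes "row_basis d R Y" "Y \<subseteq> W" "fun_vs.dim W = Suc d" "fun_vs.subspace W"
  obtains v where "row_basis (Suc d) (R(d := v)) W"
proof -
  let ?B = "R ` {..<d}"
  have R: "inj_on R {..<d}" "fun_vs.independent ?B"
    using assms(1) by (simp_all add: row_basis_def)
  have "?B \<subseteq> W" using row_basis_mem[OF assms(1)] assms(2) by blast
  from fun_vs.maximal_independent_subset_extend[OF this R(2)]
  obtain B where B: "?B \<subseteq> B" "B \<subseteq> W" "fun_vs.independent B" "W \<subseteq> fun_vs.span B" by metis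
  have cB: "card B = Suc d" using fun_vs.basis_card_eq_dim[OF B(2,4,3)] assms(3) by simp
  then have "card (B - ?B) = 1"
    using card_Diff_subset[OF _ B(1)] card_image[OF R(1)] by simp
  then obtain v where v: "B - ?B = {v}" by (metis card_1_singletonE)
  have im: "(R(d := v)) ` {..<Suc d} = B" using v B(1) by (auto simp: lessThan_Suc)
  have "fun_vs.span B = W" using B(2,4) assms(4) by (metis fun_vs.span_minimal subset_antisym)
  then have "row_basis (Suc d) (R(d := v)) W"
    using im cB B(3) by (simp add: row_basis_def eq_card_imp_inj_on)
  then show ?thesis by (rule that)
qed

lemma minor_base_change:
  fixes R R' :: "nat \<Rightarrow> 'i \<Rightarrow> 'k::field"
  assumes "\<And>i j. i < length js \<Longrightarrow> j \<in> set js \<Longrightarrow> R i j = (\<Sum>k<length js. T i k * R' k j)"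
  shows "minor R js = det (mat (length js) (length js) (\<lambda>(i, k). T i k)) * minor R' js"
proof -
  let ?m = "length js"
  have "mat ?m ?m (\<lambda>(i, j). R i (js ! j))
      = mat ?m ?m (\<lambda>(i, k). T i k) * mat ?m ?m (\<lambda>(i, j). R' i (js ! j))"
    by (rule eq_matI) (auto simp: scalar_prod_def assms lessThan_atLeast0)
  then show ?thesis
    unfolding minor_def by (simp add: det_mult[of _ ?m])
qed

text \<open>
  A maximal minor is the determinant of the projection of \<open>V\<close> to the coordinates \<open>js\<close>, so that it
  vanishes iff this projection has a kernel.  In this form the vanishing of Pluecker coordinates can
  be compared for different spaces without computing determinants.
\<close>

lemma minor_eq_0_iff:
  fixes R :: "nat \<Rightarrow> 'i \<Rightarrow> 'k::field"
  assumes "row_basis (length js) R V"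
  shows "minor R js = 0 \<longleftrightarrow> (\<exists>v\<in>V. v \<noteq> 0 \<and> (\<forall>j\<in>set js. v j = 0))"
proof -
  let ?m = "length js"
  define A where "A = mat ?m ?m (\<lambda>(j, i). R i (js ! j))"
  have A: "A \<in> carrier_mat ?m ?m" by (simp add: A_def)
  have "transpose_mat A = mat ?m ?m (\<lambda>(i, j). R i (js ! j))"
    by (rule eq_matI) (auto simp: A_def)
  then have "minor R js = det A"
    unfolding minor_def using det_transpose[OF A] by simp
  also have "\<dots> = 0 \<longleftrightarrow> (\<exists>c. c \<in> carrier_vec ?m \<and> c \<noteq> 0\<^sub>v ?m \<and> A *\<^sub>v c = 0\<^sub>v ?m)"
    by (rule det_0_iff_vec_prod_zero_field[OF A])
  also have "\<dots> \<longleftrightarrow> (\<exists>v\<in>V. v \<noteq> 0 \<and> (\<forall>j\<in>set js. v j = 0))"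
  proof
    assume "\<exists>c. c \<in> carrier_vec ?m \<and> c \<noteq> 0\<^sub>v ?m \<and> A *\<^sub>v c = 0\<^sub>v ?m"
    then obtain c where c: "c \<in> carrier_vec ?m" "c \<noteq> 0\<^sub>v ?m" "A *\<^sub>v c = 0\<^sub>v ?m" by blast
    define v where "v = (\<lambda>j. \<Sum>k<?m. c $ k * R k j)"
    have "v \<in> V" unfolding v_def by (rule row_basis_lincomb[OF assms])
    moreover have "v \<noteq> 0"
    proof
      assume "v = 0"
      then have "(\<Sum>k<?m. c $ k * R k j) = 0" for j by (simp add: v_def fun_eq_iff)
      then have "\<forall>k<?m. c $ k = 0" using row_basis_unique_zero[OF assms] by blast
      then have "c = 0\<^sub>v ?m" using c(1) by (intro eq_vecI) auto
      then show False using c(2) by simp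
    qed
    moreover have "v j = 0" if "j \<in> set js" for j
    proof -
      from that obtain l where l: "l < ?m" "j = js ! l" by (metis in_set_conv_nth)
      have "(A *\<^sub>v c) $ l = v j"
        using l c(1) by (auto simp: A_def v_def scalar_prod_def lessThan_atLeast0 mult.commute)
      then show ?thesis using c(3) l by simp
    qed
    ultimately show "\<exists>v\<in>V. v \<noteq> 0 \<and> (\<forall>j\<in>set js. v j = 0)" by blast
  next
    assume "\<exists>v\<in>V. v \<noteq> 0 \<and> (\<forall>j\<in>set js. v j = 0)"
    then obtain v where v: "v \<in> V" "v \<noteq> 0" "\<forall>j\<in>set js. v j = 0" by blast
    obtain c where c: "v = (\<lambda>j. \<Sum>k<?m. c k * R k j)"
      by (rule row_basis_expand[OF assms v(1)])
    have "vec ?m c \<noteq> 0\<^sub>v ?m"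
    proof
      assume "vec ?m c = 0\<^sub>v ?m"
      then have "\<forall>k<?m. c k = 0" by (metis index_vec index_zero_vec(1))
      then show False using v(2) c by (simp add: fun_eq_iff)
    qed
    moreover have "A *\<^sub>v vec ?m c = 0\<^sub>v ?m"
    proof (rule eq_vecI)
      fix l assume "l < dim_vec (0\<^sub>v ?m :: 'k vec)"
      then have l: "l < ?m" by simp
      then have "(A *\<^sub>v vec ?m c) $ l = v (js ! l)"
        by (auto simp: A_def c scalar_prod_def lessThan_atLeast0 mult.commute)
      then show "(A *\<^sub>v vec ?m c) $ l = 0\<^sub>v ?m $ l" using v(3) l by simp
    qed (simp add: A_def)
    ultimately show "\<exists>c. c \<in> carrier_vec ?m \<and> c \<noteq> 0\<^sub>v ?m \<and> A *\<^sub>v c = 0\<^sub>v ?m"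
      by (intro exI[of _ "vec ?m c"]) simp
  qed
  finally show ?thesis .
qed

lemma sum_delta_mult:
  "finite A \<Longrightarrow> (\<Sum>k\<in>A. of_bool (k = i) * g k) = (if i \<in> A then g i else (0::'k::field))"
  by (simp add: of_bool_def if_distrib[where f="\<lambda>x. x * _"] cong: if_cong)

lemma sum_delta_mult':
  "finite A \<Longrightarrow> (\<Sum>k\<in>A. g k * of_bool (k = i)) = (if i \<in> A then g i else (0::'k::field))"
  by (simp add: of_bool_def if_distrib[where f="\<lambda>x. _ * x"] cong: if_cong)

lemma dual_rows_exist:
  fixes R :: "nat \<Rightarrow> 'i \<Rightarrow> 'k::field"
  assumes "fun_vs.span (R ` {..<length js}) = V" "minor R js \<noteq> 0"
  obtains w where "\<And>k. k < length js \<Longrightarrow> w k \<in> V"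
    "\<And>k l. k < length js \<Longrightarrow> l < length js \<Longrightarrow> w k (js ! l) = of_bool (k = l)"
proof -
  let ?m = "length js"
  define A where "A = mat ?m ?m (\<lambda>(i, j). R i (js ! j))"
  have A: "A \<in> carrier_mat ?m ?m" by (simp add: A_def)
  define B where "B = adj_mat A"
  have B: "B \<in> carrier_mat ?m ?m" "B * A = det A \<cdot>\<^sub>m 1\<^sub>m ?m"
    using adj_mat[OF A] by (simp_all add: B_def)
  have d: "det A \<noteq> 0" using assms(2) by (simp add: minor_def A_def)
  define w where "w = (\<lambda>k j. \<Sum>i<?m. (B $$ (k, i) / det A) * R i j)"
  show ?thesis
  proof (rule that)
    show "w k \<in> V" for k
      unfolding assms(1)[symmetric] in_span_rows_iff
      by (rule exI[of _ "\<lambda>i. B $$ (k, i) / det A"]) (simp add: w_def)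
    show "w k (js ! l) = of_bool (k = l)" if "k < ?m" "l < ?m" for k l
    proof -
      have "w k (js ! l) = (\<Sum>i<?m. B $$ (k, i) * A $$ (i, l)) / det A"
        using that by (simp add: A_def w_def sum_divide_distrib)
      also have "(\<Sum>i<?m. B $$ (k, i) * A $$ (i, l)) = (B * A) $$ (k, l)"
        using that B(1) A by (simp add: scalar_prod_def lessThan_atLeast0)
      finally show ?thesis using that d by (simp add: B(2))
    qed
  qed
qed

text \<open>
  Cramer's rule: the entries of a row dual to the columns \<open>js\<close> are quotients of maximal minors.
  This turns information on Pluecker coordinates, such as their valuations or the subfield that
  they lie in, into information on vectors of the space.
\<close>

lemma minor_replace_column:
  fixes R :: "nat \<Rightarrow> 'i \<Rightarrow> 'k::field"
  assumes "v \<in> fun_vs.span (R ` {..<length js})" "k < length js"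
    and dual: "\<And>l. l < length js \<Longrightarrow> v (js ! l) = of_bool (l = k)"
  shows "minor R (js[k := j]) = v j * minor R js"
proof -
  let ?m = "length js"
  define A where "A = mat ?m ?m (\<lambda>(i, l). R i (js ! l))"
  define A' where "A' = mat ?m ?m (\<lambda>(i, l). R i (js[k := j] ! l))"
  have A: "A \<in> carrier_mat ?m ?m" and A': "A' \<in> carrier_mat ?m ?m"
    by (simp_all add: A_def A'_def)
  obtain c where c: "v = (\<lambda>j. \<Sum>i<?m. c i * R i j)"
    using assms(1) unfolding in_span_rows_iff by blast
  have adj: "(\<Sum>l<?m. A $$ (i, l) * cofactor A i' l) = of_bool (i = i') * det A"
    if "i < ?m" "i' < ?m" for i i'
  proof -
    have "(A * adj_mat A) $$ (i, i') = (\<Sum>l<?m. A $$ (i, l) * cofactor A i' l)"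
      using that A by (auto simp: adj_mat_def scalar_prod_def lessThan_atLeast0)
    then show ?thesis using that by (cases "i = i'") (simp_all add: adj_mat(2)[OF A])
  qed
  have cof: "cofactor A i' k = c i' * det A" if i': "i' < ?m" for i'
  proof -
    have "c i' * det A = (\<Sum>i<?m. c i * (of_bool (i = i') * det A))"
      using i' sum_delta_mult[of "{..<?m}" i' "\<lambda>i. c i * det A"] by (simp add: algebra_simps)
    also have "\<dots> = (\<Sum>i<?m. \<Sum>l<?m. c i * A $$ (i, l) * cofactor A i' l)"
      using i' by (intro sum.cong) (auto simp: adj[symmetric] sum_distrib_left mult.assoc)
    also have "\<dots> = (\<Sum>l<?m. (\<Sum>i<?m. c i * A $$ (i, l)) * cofactor A i' l)"
      by (subst sum.swap) (simp add: sum_distrib_right)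
    also have "\<dots> = (\<Sum>l<?m. of_bool (l = k) * cofactor A i' l)"
    proof (rule sum.cong[OF refl])
      fix l assume "l \<in> {..<?m}"
      then have "(\<Sum>i<?m. c i * A $$ (i, l)) = v (js ! l)" by (simp add: c A_def)
      then show "(\<Sum>i<?m. c i * A $$ (i, l)) * cofactor A i' l = of_bool (l = k) * cofactor A i' l"
        using dual \<open>l \<in> _\<close> by simp
    qed
    also have "\<dots> = cofactor A i' k" using assms(2) by (subst sum_delta_mult) auto
    finally show ?thesis by simp
  qed
  have "minor R (js[k := j]) = det A'" by (simp add: minor_def A'_def)
  also have "\<dots> = (\<Sum>i<?m. A' $$ (i, k) * cofactor A' i k)"
    by (rule laplace_expansion_column[OF A' assms(2)])
  also have "\<dots> = (\<Sum>i<?m. R i j * (c i * det A))"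
  proof (rule sum.cong[OF refl])
    fix i assume i: "i \<in> {..<?m}"
    have "mat_delete A' i k = mat_delete A i k"
      using assms(2) i by (intro eq_matI) (auto simp: mat_delete_def A_def A'_def)
    then show "A' $$ (i, k) * cofactor A' i k = R i j * (c i * det A)"
      using i assms(2) cof[of i] by (simp add: cofactor_def A'_def)
  qed
  also have "\<dots> = v j * minor R js"
    by (simp add: c sum_distrib_right minor_def A_def mult_ac)
  finally show ?thesis .
qed

lemma dual_rows_basis:
  fixes V :: "('i \<Rightarrow> 'k::field) set"
  assumes "fun_vs.subspace V" "\<And>k. k < length js \<Longrightarrow> w k \<in> V"
    and dual: "\<And>k l. k < length js \<Longrightarrow> l < length js \<Longrightarrow> w k (js ! l) = of_bool (k = l)"
    and zero: "\<And>v. v \<in> V \<Longrightarrow> \<forall>j\<in>set js. v j = 0 \<Longrightarrow> v = 0"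
  shows "row_basis (length js) w V"
proof -
  have *: "v = (\<lambda>j. \<Sum>k<length js. v (js ! k) * w k j)" if v: "v \<in> V" for v
  proof -
    let ?u = "\<lambda>j. \<Sum>k<length js. v (js ! k) * w k j"
    have "v - ?u = 0"
    proof (rule zero)
      show "v - ?u \<in> V" by (intro fun_vs.subspace_diff subspace_lincomb assms v) auto
      show "\<forall>j\<in>set js. (v - ?u) j = 0"
      proof
        fix j assume "j \<in> set js"
        then obtain l where l: "l < length js" "j = js ! l" by (metis in_set_conv_nth)
        then have "?u j = (\<Sum>k<length js. v (js ! k) * of_bool (k = l))"
          by (intro sum.cong) (auto simp: dual)
        then show "(v - ?u) j = 0" using l by (simp add: sum_delta_mult' del: sum_mult_of_bool_eq)
      qed
    qed
    then show ?thesis by simp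
  qed
  show "row_basis (length js) w V"
    unfolding row_basis_iff
  proof (intro conjI allI impI)
    show "fun_vs.span (w ` {..<length js}) = V"
    proof
      show "fun_vs.span (w ` {..<length js}) \<subseteq> V"
        using assms(1,2) by (intro fun_vs.span_minimal) auto
      show "V \<subseteq> fun_vs.span (w ` {..<length js})"
      proof
        fix v assume "v \<in> V"
        then show "v \<in> fun_vs.span (w ` {..<length js})"
          unfolding in_span_rows_iff by (intro exI[of _ "\<lambda>k. v (js ! k)"] *)
      qed
    qed
    fix c k assume c: "\<forall>j. (\<Sum>k<length js. c k * w k j) = 0" and k: "k < length js"
    have "(\<Sum>i<length js. c i * of_bool (i = k)) = (\<Sum>i<length js. c i * w i (js ! k))"
      using k by (intro sum.cong) (auto simp: dual)
    also have "\<dots> = 0" using c by simp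
    finally have "(\<Sum>i<length js. c i * of_bool (i = k)) = 0" .
    then show "c k = 0" using k by (simp add: sum_delta_mult' del: sum_mult_of_bool_eq)
  qed
qed

section \<open>Valuations on algebraically closed fields\<close>

context nonarch_valuation
begin

lemma val_0 [simp]: "val 0 = \<infinity>"
  by (simp add: val_eq_PInf_iff)

lemma val_eq_ereal: "x \<noteq> 0 \<Longrightarrow> \<exists>r. val x = ereal r"
  by (metis val_eq_PInf_iff val_not_MInf ereal_cases)

lemma val_1 [simp]: "val 1 = 0"
proof -
  obtain r where "val 1 = ereal r" using val_eq_ereal[of 1] by auto
  then show ?thesis using val_mult[of 1 1] by (simp add: zero_ereal_def)
qed

lemma val_minus [simp]: "val (- x) = val x"
proof -
  obtain r where r: "val (-1) = ereal r" using val_eq_ereal[of "-1"] by auto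
  then have "r + r = 0" using val_mult[of "-1" "-1"] by (simp add: zero_ereal_def)
  then have "val (-1) = 0" using r by (simp add: zero_ereal_def)
  then show ?thesis using val_mult[of "-1" x] by simp
qed

lemma val_power: "val (x ^ n) = ereal (real n) * val x"
proof (induction n)
  case (Suc n)
  show ?case
    using Suc val_mult[of x "x ^ n"] ereal_left_distrib[of 1 "ereal (real n)" "val x"]
    by (simp add: one_ereal_def)
qed (simp add: zero_ereal_def[symmetric])

lemma val_prod: "val (\<Prod>a\<in>A. f a) = (\<Sum>a\<in>A. val (f a))"
  by (induction A rule: infinite_finite_induct) (simp_all add: val_mult)

lemma val_sum_ge: "(\<And>a. a \<in> A \<Longrightarrow> t \<le> val (f a)) \<Longrightarrow> t \<le> val (\<Sum>a\<in>A. f a)"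
proof (induction A rule: infinite_finite_induct)
  case (insert a A)
  then have "t \<le> min (val (f a)) (val (\<Sum>a\<in>A. f a))" by simp
  also have "\<dots> \<le> val (f a + (\<Sum>a\<in>A. f a))" by (rule val_add)
  finally show ?case using insert.hyps by simp
qed simp_all

lemma val_add_eq:
  assumes "val x < val y"
  shows "val (x + y) = val x"
proof (rule antisym)
  show "val x \<le> val (x + y)" using val_add[of x y] assms by simp
  have "min (val (x + y)) (val (- y)) \<le> val x" using val_add[of "x + y" "- y"] by simp
  then show "val (x + y) \<le> val x" using assms by (auto simp: min_le_iff_disj)
qed

lemma val_sum_gt:
  assumes "finite A" "t < \<infinity>" "\<And>a. a \<in> A \<Longrightarrow> t < val (f a)"
  shows "t < val (\<Sum>a\<in>A. f a)"
  using assms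
proof (induction A rule: finite_induct)
  case (insert a A)
  then have "t < min (val (f a)) (val (\<Sum>a\<in>A. f a))" by simp
  also have "\<dots> \<le> val (f a + (\<Sum>a\<in>A. f a))" by (rule val_add)
  finally show ?case using insert.hyps by simp
qed simp

lemma val_sum_eq:
  assumes "finite A" "a \<in> A" "f a \<noteq> 0" "\<And>b. b \<in> A \<Longrightarrow> b \<noteq> a \<Longrightarrow> val (f a) < val (f b)"
  shows "val (\<Sum>b\<in>A. f b) = val (f a)"
proof -
  have "val (f a) < val (\<Sum>b\<in>A - {a}. f b)"
    using assms val_eq_ereal[OF assms(3)] by (intro val_sum_gt) auto
  then show ?thesis using val_add_eq assms(1,2) by (simp add: sum.remove)
qed

lemma val_divide:
  assumes "y \<noteq> 0"
  shows "val (x / y) + val y = val x"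
  using val_mult[of "x / y" y] assms by simp

end

locale alg_closed_valuation = nonarch_valuation val
  for val :: "'k::alg_closed_field \<Rightarrow> ereal"
begin

text \<open>
  Over the infinite residue field one would choose \<open>x\<close> outside the zeros of the reductions of the
  \<open>P j\<close>.  A shorter way is to take a root of \<open>x * (\<Prod>j. P j) - 1\<close>: if \<open>x\<close> is integral, then so
  are all factors, and their valuations have sum \<open>0\<close>; otherwise each \<open>P j\<close> has a dominating leading
  term at \<open>x\<close>, all valuations are at most \<open>0\<close> and that of \<open>x\<close> is negative, which is impossible.
  The extra factor \<open>x\<close> makes the polynomial non-constant.
\<close>

lemma common_unit_value:
  assumes "finite J" "\<And>j. j \<in> J \<Longrightarrow> P j \<noteq> 0"
    and coeffs: "\<And>j i. j \<in> J \<Longrightarrow> val (coeff (P j) i) \<in> {0, \<infinity>}"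
  obtains x where "\<And>j. j \<in> J \<Longrightarrow> val (poly (P j) x) = 0"
proof -
  define Q where "Q = [:0, 1:] * (\<Prod>j\<in>J. P j)"
  have "(\<Prod>j\<in>J. P j) \<noteq> 0" using assms(1,2) by simp
  then have "degree Q = Suc (degree (\<Prod>j\<in>J. P j))"
    unfolding Q_def by (subst degree_mult_eq) auto
  then have "degree (Q - 1) > 0"
    using degree_add_eq_left[of "- 1" Q] by simp
  then obtain x where "poly (Q - 1) x = 0" using alg_closed_imp_poly_has_root by blast
  then have x: "x * (\<Prod>j\<in>J. poly (P j) x) = 1" by (simp add: Q_def poly_prod)
  then have x0: "x \<noteq> 0" by auto
  have vx: "val x + (\<Sum>j\<in>J. val (poly (P j) x)) = 0"
    using arg_cong[OF x, of val] by (simp add: val_mult val_prod)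
  have val_poly: "poly (P j) x = (\<Sum>i\<le>degree (P j). coeff (P j) i * x ^ i)" for j
    by (rule poly_altdef)
  show ?thesis
  proof (cases "0 \<le> val x")
    case True
    have nonneg: "0 \<le> val (poly (P j) x)" if "j \<in> J" for j
      unfolding val_poly
    proof (rule val_sum_ge)
      fix i
      have "0 \<le> val (coeff (P j) i)" using coeffs[OF that, of i] by auto
      then show "0 \<le> val (coeff (P j) i * x ^ i)"
        using True by (simp add: val_mult val_power)
    qed
    have "(\<Sum>j\<in>J. val (poly (P j) x)) \<le> val x + (\<Sum>j\<in>J. val (poly (P j) x))"
      by (rule add_increasing[OF True order_refl])
    then have "(\<Sum>j\<in>J. val (poly (P j) x)) = 0"
      using vx sum_nonneg[of J "\<lambda>j. val (poly (P j) x)", OF nonneg] by simp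
    then show ?thesis
      using that sum_nonneg_eq_0_iff[OF assms(1), of "\<lambda>j. val (poly (P j) x)", OF nonneg] by auto
  next
    case False
    obtain r where r: "val x = ereal r" "r < 0" using False val_eq_ereal[OF x0] by auto
    have "val (poly (P j) x) \<le> 0" if j: "j \<in> J" for j
    proof -
      let ?d = "degree (P j)"
      have top: "val (coeff (P j) ?d * x ^ ?d) = ereal (real ?d * r)"
        using coeffs[OF j, of ?d] assms(2)[OF j] val_eq_PInf_iff
        by (auto simp: val_mult val_power r)
      have "val (poly (P j) x) = ereal (real ?d * r)"
        unfolding top[symmetric] val_poly
      proof (rule val_sum_eq)
        show "coeff (P j) ?d * x ^ ?d \<noteq> 0" using assms(2)[OF j] x0 by simp
        fix i assume i: "i \<in> {..?d}" "i \<noteq> ?d"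
        then have "real ?d * r < real i * r" using r(2) by simp
        then show "val (coeff (P j) ?d * x ^ ?d) < val (coeff (P j) i * x ^ i)"
          unfolding top using coeffs[OF j, of i] by (auto simp: val_mult val_power r)
      qed simp_all
      then show ?thesis using r(2) by (simp add: zero_ereal_def mult_nonneg_nonpos)
    qed
    then have "(\<Sum>j\<in>J. val (poly (P j) x)) \<le> 0" by (rule sum_nonpos)
    then have "val x + (\<Sum>j\<in>J. val (poly (P j) x)) \<le> val x + 0" by (rule add_left_mono)
    then show ?thesis using vx False by simp
  qed
qed

text \<open>
  The value group is nonzero, and it is divisible because \<open>K\<close> contains all roots of its elements.
  Hence it contains the rational multiples of some nonzero real number.
\<close>

lemma val_dense:
  assumes "\<exists>x. x \<noteq> 0 \<and> val x \<noteq> 0" "a < b"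
  obtains x where "x \<noteq> 0" "ereal a < val x" "val x < ereal b"
proof -
  obtain y g where y: "y \<noteq> 0" "val y = ereal g" "g \<noteq> 0"
    using assms(1) val_eq_ereal by (metis zero_ereal_def)
  obtain z h where z: "z \<noteq> 0" "val z = ereal h" "h > 0"
  proof (cases "g > 0")
    case True
    then show ?thesis using y that by blast
  next
    case False
    have "val (1 / y) + val y = 0" using val_divide[OF y(1), of 1] by simp
    moreover obtain h where "val (1 / y) = ereal h" using val_eq_ereal[of "1 / y"] y(1) by auto
    ultimately show ?thesis using that[of "1 / y" h] y False by (auto simp: zero_ereal_def)
  qed
  have "a / h < b / h" using assms(2) z(3) by (simp add: divide_strict_right_mono)
  then obtain q where qr: "q \<in> \<rat>" and q: "a / h < q" "q < b / h" using Rats_dense_in_real by blast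
  from qr obtain m :: int and n :: nat where mn: "n \<noteq> 0" "q = of_int m / of_nat n"
    unfolding Rats_eq_int_div_nat by auto
  obtain t where t: "t ^ n = z" using nth_root_exists[of n z] mn(1) by auto
  then have t0: "t \<noteq> 0" using z(1) mn(1) by (auto simp: power_0_left)
  obtain s where s: "val t = ereal s" using val_eq_ereal[OF t0] by blast
  have ns: "real n * s = h" using val_power[of t n] s t z(2) by simp
  have "\<exists>x. x \<noteq> 0 \<and> val x = ereal (of_int m * s)"
  proof (cases "m \<ge> 0")
    case True
    then show ?thesis using t0 s
      by (intro exI[of _ "t ^ nat m"]) (simp add: val_power)
  next
    case False
    have "val (1 / t ^ nat (- m)) + val (t ^ nat (- m)) = 0"
      using val_divide[of "t ^ nat (- m)" 1] t0 by simp
    moreover obtain h where "val (1 / t ^ nat (- m)) = ereal h"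
      using val_eq_ereal[of "1 / t ^ nat (- m)"] t0 by auto
    ultimately show ?thesis using t0 s False
      by (intro exI[of _ "1 / t ^ nat (- m)"]) (auto simp: val_power zero_ereal_def)
  qed
  then obtain x where x: "x \<noteq> 0" "val x = ereal (of_int m * s)" by blast
  have "of_int m * s = q * h" using ns[symmetric] mn by (simp add: field_simps)
  then show ?thesis using that[of x] x q z(3) by (simp add: field_simps)
qed

end

section \<open>The matroid of a linear space\<close>

definition vanishing :: "('i \<Rightarrow> 'k::field) set \<Rightarrow> 'i set \<Rightarrow> ('i \<Rightarrow> 'k) set" where
  "vanishing V A = {v \<in> V. \<forall>j\<in>A. v j = 0}"

text \<open>
  For a subspace \<open>V\<close> and a finite set \<open>I\<close> this says that the projection \<open>V \<rightarrow> K\<^sup>I\<close> is surjective,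
  which is dual to the linear independence of the columns indexed by \<open>I\<close>.
\<close>

definition separates :: "('i \<Rightarrow> 'k::field) set \<Rightarrow> 'i set \<Rightarrow> bool" where
  "separates V I \<longleftrightarrow> (\<forall>j\<in>I. \<exists>v\<in>V. v j = 1 \<and> (\<forall>i\<in>I - {j}. v i = 0))"

lemma separates_subset: "separates V I \<Longrightarrow> I' \<subseteq> I \<Longrightarrow> separates V I'"
  unfolding separates_def
proof
  fix j assume *: "\<forall>j\<in>I. \<exists>v\<in>V. v j = 1 \<and> (\<forall>i\<in>I - {j}. v i = 0)" "I' \<subseteq> I" "j \<in> I'"
  then obtain v where "v \<in> V" "v j = 1 \<and> (\<forall>i\<in>I - {j}. v i = 0)" by fast
  then show "\<exists>v\<in>V. v j = 1 \<and> (\<forall>i\<in>I' - {j}. v i = 0)"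
    using *(2) by (intro bexI[of _ v]) auto
qed

lemma separates_empty [simp]: "separates V {}"
  by (simp add: separates_def)

lemma separatesE:
  assumes "separates V I"
  obtains w where "\<And>j. j \<in> I \<Longrightarrow> w j \<in> V"
    "\<And>i j. i \<in> I \<Longrightarrow> j \<in> I \<Longrightarrow> w j i = of_bool (j = i)"
proof -
  have "\<forall>j\<in>I. \<exists>v. v \<in> V \<and> v j = 1 \<and> (\<forall>i\<in>I - {j}. v i = 0)"
    using assms unfolding separates_def by blast
  then obtain w where "\<forall>j\<in>I. w j \<in> V \<and> w j j = 1 \<and> (\<forall>i\<in>I - {j}. w j i = 0)"
    unfolding bchoice_iff by blast
  then show ?thesis by (intro that[of w]) auto
qed

lemma separates_insert:
  assumes V: "fun_vs.subspace V" and I: "separates V I"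
    and v: "v \<in> V" "\<And>i. i \<in> I \<Longrightarrow> v i = 0" "v x \<noteq> 0"
  shows "separates V (insert x I)"
  unfolding separates_def
proof
  have xI: "x \<notin> I" using v by blast
  obtain w where w: "\<And>j. j \<in> I \<Longrightarrow> w j \<in> V"
    "\<And>i j. i \<in> I \<Longrightarrow> j \<in> I \<Longrightarrow> w j i = of_bool (j = i)"
    using separatesE[OF I] by blast
  fix j assume j: "j \<in> insert x I"
  show "\<exists>u\<in>V. u j = 1 \<and> (\<forall>i\<in>insert x I - {j}. u i = 0)"
  proof (cases "j = x")
    case True
    have "fscale (1 / v x) v \<in> V" by (rule fun_vs.subspace_scale[OF V v(1)])
    then show ?thesis
      using v xI True by (intro bexI[of _ "fscale (1 / v x) v"]) (auto simp: fscale_def)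
  next
    case False
    then have "j \<in> I" using j by simp
    let ?u = "w j - fscale (w j x / v x) v"
    have "?u \<in> V"
      using w(1)[OF \<open>j \<in> I\<close>] v(1) by (intro fun_vs.subspace_diff fun_vs.subspace_scale V)
    moreover have "?u j = 1 \<and> (\<forall>i\<in>insert x I - {j}. ?u i = 0)"
      using w(2) v \<open>j \<in> I\<close> by (auto simp: fscale_def)
    ultimately show ?thesis by (intro bexI[of _ ?u])
  qed
qed

text \<open>
  For the nontrivial direction the separating vectors are constructed one index at a time: if the
  values at \<open>x\<close> were determined by those on \<open>I\<close> through the vectors that separate \<open>I\<close>, this would
  be a linear relation between the coordinates in \<open>insert x I\<close>.
\<close>

lemma separates_iff_no_relation:
  assumes V: "fun_vs.subspace V" and "finite I"
  shows "separates V I \<longleftrightarrow>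
    (\<forall>c. (\<forall>v\<in>V. (\<Sum>j\<in>I. c j * v j) = 0) \<longrightarrow> (\<forall>j\<in>I. c j = 0))"
proof
  assume I: "separates V I"
  show "\<forall>c. (\<forall>v\<in>V. (\<Sum>j\<in>I. c j * v j) = 0) \<longrightarrow> (\<forall>j\<in>I. c j = 0)"
  proof (intro allI impI ballI)
    fix c j assume c: "\<forall>v\<in>V. (\<Sum>j\<in>I. c j * v j) = 0" and j: "j \<in> I"
    obtain v where v: "v \<in> V" "v j = 1" "\<forall>i\<in>I - {j}. v i = 0"
      using I j unfolding separates_def by blast
    have "(\<Sum>i\<in>I. c i * v i) = c j * v j + (\<Sum>i\<in>I - {j}. c i * v i)"
      using assms(2) j by (rule sum.remove)
    also have "\<dots> = c j" using v by simp
    finally show "c j = 0" using c v(1) by simp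
  qed
next
  assume "\<forall>c. (\<forall>v\<in>V. (\<Sum>j\<in>I. c j * v j) = 0) \<longrightarrow> (\<forall>j\<in>I. c j = 0)"
  with assms(2) show "separates V I"
  proof (induction I rule: finite_induct)
    case (insert x I)
    have "separates V I"
    proof (rule insert.IH, intro allI impI)
      fix c assume c: "\<forall>v\<in>V. (\<Sum>j\<in>I. c j * v j) = 0"
      have "\<forall>v\<in>V. (\<Sum>j\<in>insert x I. (c(x := 0)) j * v j) = 0"
      proof
        fix v assume "v \<in> V"
        have "(\<Sum>j\<in>I. (c(x := 0)) j * v j) = (\<Sum>j\<in>I. c j * v j)"
          using insert.hyps(2) by (intro sum.cong) auto
        then show "(\<Sum>j\<in>insert x I. (c(x := 0)) j * v j) = 0"
          using insert.hyps c \<open>v \<in> V\<close> by simp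
      qed
      then have "\<forall>j\<in>insert x I. (c(x := 0)) j = 0" using insert.prems by blast
      then show "\<forall>j\<in>I. c j = 0" using insert.hyps(2) by (metis fun_upd_other insertCI)
    qed
    then obtain w where w: "\<And>j. j \<in> I \<Longrightarrow> w j \<in> V"
      "\<And>i j. i \<in> I \<Longrightarrow> j \<in> I \<Longrightarrow> w j i = of_bool (j = i)"
      using separatesE by blast
    define c where "c = (\<lambda>j. if j = x then - 1 else w j x)"
    have "c x \<noteq> 0" by (simp add: c_def)
    then obtain v where v: "v \<in> V" "(\<Sum>j\<in>insert x I. c j * v j) \<noteq> 0"
      using insert.prems by blast
    have "(\<Sum>j\<in>I. c j * v j) = (\<Sum>j\<in>I. v j * w j x)"
      using insert.hyps(2) by (intro sum.cong) (auto simp: c_def)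
    then have ne: "(\<Sum>j\<in>I. v j * w j x) \<noteq> v x"
      using v(2) insert.hyps by (simp add: c_def)
    let ?u = "v - (\<lambda>i. \<Sum>j\<in>I. v j * w j i)"
    show ?case
    proof (rule separates_insert[OF V \<open>separates V I\<close>])
      show "?u \<in> V" using v(1) w(1) by (intro fun_vs.subspace_diff subspace_lincomb V)
      show "?u x \<noteq> 0" using ne by auto
      fix i assume i: "i \<in> I"
      have "(\<Sum>j\<in>I. v j * w j i) = (\<Sum>j\<in>I. v j * of_bool (j = i))"
        using i w(2) by (intro sum.cong) auto
      also have "\<dots> = v i" using i insert.hyps(1) by (subst sum_delta_mult') auto
      finally show "?u i = 0" by simp
    qed
  qed simp
qed

locale finite_coord_subspace =
  fixes E :: "'i set" and V :: "('i \<Rightarrow> 'k::field) set"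
  assumes finite_E: "finite E"
    and subspace_V: "fun_vs.subspace V"
    and supported: "V \<subseteq> coord_space E"
    and finitely_spanned: "\<exists>m R. fun_vs.span (R ` {..<m::nat}) = V"
begin

abbreviation "M \<equiv> linear_matroid E V"

lemma eq_zero_if_vanishes: "v \<in> V \<Longrightarrow> \<forall>j\<in>E. v j = 0 \<Longrightarrow> v = 0"
  using supported by (fastforce simp: coord_space_def fun_eq_iff)

lemma indep_iff_no_relation:
  "I \<in> indep M \<longleftrightarrow> I \<subseteq> E \<and>
    (\<forall>c. (\<forall>v\<in>V. (\<Sum>j\<in>I. c j * v j) = 0) \<longrightarrow> (\<forall>j\<in>I. c j = 0))"
proof -
  have *: "(inj_on (column m R) I \<and> fun_vs.independent (column m R ` I)) \<longleftrightarrow>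
      (\<forall>c. (\<forall>v\<in>V. (\<Sum>j\<in>I. c j * v j) = 0) \<longrightarrow> (\<forall>j\<in>I. c j = 0))"
    if "I \<subseteq> E" and R: "fun_vs.span (R ` {..<m}) = V" for m R
  proof -
    have fin: "finite I" using that finite_E finite_subset by blast
    have "(\<forall>i. (\<Sum>j\<in>I. c j * column m R j i) = 0) \<longleftrightarrow> (\<forall>v\<in>V. (\<Sum>j\<in>I. c j * v j) = 0)" for c
    proof
      assume c: "\<forall>i. (\<Sum>j\<in>I. c j * column m R j i) = 0"
      show "\<forall>v\<in>V. (\<Sum>j\<in>I. c j * v j) = 0"
      proof
        fix v assume "v \<in> V"
        then obtain a where a: "v = (\<lambda>j. \<Sum>i<m. a i * R i j)"
          unfolding R[symmetric] in_span_rows_iff by blast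
        have "(\<Sum>j\<in>I. c j * v j) = (\<Sum>j\<in>I. \<Sum>i<m. a i * (c j * R i j))"
          by (simp add: a sum_distrib_left mult_ac)
        also have "\<dots> = (\<Sum>i<m. a i * (\<Sum>j\<in>I. c j * R i j))"
          by (subst sum.swap) (simp add: sum_distrib_left)
        also have "\<dots> = (\<Sum>i<m. 0)"
        proof (rule sum.cong[OF refl])
          fix i assume "i \<in> {..<m}"
          then show "a i * (\<Sum>j\<in>I. c j * R i j) = 0" using c[THEN spec, of i] by (simp add: column_def)
        qed
        finally show "(\<Sum>j\<in>I. c j * v j) = 0" by simp
      qed
    next
      assume c: "\<forall>v\<in>V. (\<Sum>j\<in>I. c j * v j) = 0"
      show "\<forall>i. (\<Sum>j\<in>I. c j * column m R j i) = 0"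
      proof
        fix i
        have "R i \<in> V" if "i < m" unfolding R[symmetric] using that by (intro fun_vs.span_base) simp
        then show "(\<Sum>j\<in>I. c j * column m R j i) = 0" using c by (cases "i < m") (simp_all add: column_def)
      qed
    qed
    then show ?thesis unfolding inj_independent_iff[OF fin] by presburger
  qed
  obtain m0 R0 where R0: "fun_vs.span (R0 ` {..<m0::nat}) = V" using finitely_spanned by metis
  show ?thesis
    unfolding linear_matroid_def using * R0 by (auto simp del: not_all)
qed

lemma indep_iff: "I \<in> indep M \<longleftrightarrow> I \<subseteq> E \<and> separates V I"
  unfolding indep_iff_no_relation
  using separates_iff_no_relation[OF subspace_V, of I] finite_subset[OF _ finite_E, of I] by blast

text \<open>
  A vector of \<open>V\<close> that vanishes on a separated set \<open>B\<close> and not at \<open>j \<in> A\<close> would enlarge \<open>B\<close> to the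
  separated set \<open>insert j B\<close>, so that it suffices to take \<open>B\<close> of maximal cardinality.
\<close>

lemma maximal_separates:
  assumes "B0 \<subseteq> A" "A \<subseteq> E" "separates V B0"
  obtains B where "B0 \<subseteq> B" "B \<subseteq> A" "separates V B" "vanishing V B \<subseteq> vanishing V A"
proof -
  let ?P = "\<lambda>B. B0 \<subseteq> B \<and> B \<subseteq> A \<and> separates V B"
  have "finite A" by (rule finite_subset[OF assms(2) finite_E])
  then have bound: "\<forall>B. ?P B \<longrightarrow> card B < Suc (card A)"
    by (auto intro: card_mono simp: less_Suc_eq_le)
  have "?P B0" using assms(1,3) by simp
  from ex_has_greatest_nat[of ?P, OF this bound]
  obtain B where B: "?P B" "\<forall>B'. ?P B' \<longrightarrow> card B' \<le> card B" by auto
  have "vanishing V B \<subseteq> vanishing V A"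
  proof
    fix v assume v: "v \<in> vanishing V B"
    have "v j = 0" if "j \<in> A" for j
    proof (rule ccontr)
      assume "v j \<noteq> 0"
      then have "?P (insert j B)" and "j \<notin> B"
        using that v B(1) separates_insert[OF subspace_V, of B v j] by (auto simp: vanishing_def)
      moreover have "finite B" using B(1) \<open>finite A\<close> finite_subset by blast
      ultimately show False using B(2)[THEN spec, of "insert j B"] by simp
    qed
    then show "v \<in> vanishing V A" using v by (simp add: vanishing_def)
  qed
  then show ?thesis using B(1) that[of B] by simp
qed

lemma card_le_rank:
  assumes "A \<subseteq> E" "I \<subseteq> A" "separates V I"
  shows "card I \<le> rank M A"
  unfolding rank_def
proof (rule Max_ge)
  have "{I \<in> indep M. I \<subseteq> A} \<subseteq> Pow E" using assms(1) by auto
  then show "finite (card ` {I \<in> indep M. I \<subseteq> A})"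
    using finite_E by (meson finite_Pow_iff finite_imageI finite_subset)
  show "card I \<in> card ` {I \<in> indep M. I \<subseteq> A}" using assms by (auto simp: indep_iff)
qed

lemma rank_attained:
  assumes "A \<subseteq> E"
  obtains I where "I \<subseteq> A" "separates V I" "card I = rank M A"
proof -
  have "{I \<in> indep M. I \<subseteq> A} \<subseteq> Pow E" using assms by auto
  then have "finite (card ` {I \<in> indep M. I \<subseteq> A})"
    using finite_E by (meson finite_Pow_iff finite_imageI finite_subset)
  moreover have "{} \<in> {I \<in> indep M. I \<subseteq> A}" by (simp add: indep_iff)
  ultimately have "rank M A \<in> card ` {I \<in> indep M. I \<subseteq> A}"
    unfolding rank_def by (intro Max_in) auto
  then show ?thesis using that by (auto simp: indep_iff)
qed

text \<open>
  A basis of \<open>F\<close> remains separated after adding \<open>x\<close> iff some vector of \<open>V\<close> vanishes on the basis,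
  hence on \<open>F\<close>, but not at \<open>x\<close>.
\<close>

lemma flat_iff:
  "flat M F \<longleftrightarrow> F \<subseteq> E \<and> (\<forall>x\<in>E - F. \<exists>v\<in>vanishing V F. v x \<noteq> 0)"
proof -
  have gr: "ground M = E" by (simp add: linear_matroid_def)
  have "rank M F < rank M (insert x F) \<longleftrightarrow> (\<exists>v\<in>vanishing V F. v x \<noteq> 0)"
    if F: "F \<subseteq> E" and x: "x \<in> E - F" for x
  proof
    assume less: "rank M F < rank M (insert x F)"
    obtain I where I: "I \<subseteq> insert x F" "separates V I" "card I = rank M (insert x F)"
      using rank_attained[of "insert x F"] F x by blast
    have "x \<in> I" using I less card_le_rank[OF F, of I] by (metis leD subset_insert)
    have finI: "finite I" using I(1) F x finite_E by (meson finite_subset insert_subset DiffD1)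
    have I': "I - {x} \<subseteq> F" "separates V (I - {x})"
      using I(1) separates_subset[OF I(2)] by auto
    obtain B where B: "I - {x} \<subseteq> B" "B \<subseteq> F" "separates V B"
        "vanishing V B \<subseteq> vanishing V F"
      by (rule maximal_separates[OF I'(1) F I'(2)])
    have "finite B" by (rule finite_subset[OF order_trans[OF B(2) F] finite_E])
    moreover have "card B \<le> card (I - {x})"
      using card_le_rank[OF F B(2,3)] less I(3) \<open>x \<in> I\<close> finI by simp
    ultimately have "B = I - {x}" using B(1) by (metis card_seteq)
    obtain v where v: "v \<in> V" "v x = 1" "\<forall>i\<in>I - {x}. v i = 0"
      using I(2) \<open>x \<in> I\<close> unfolding separates_def by blast
    then have "v \<in> vanishing V F"
      using B(4) \<open>B = I - {x}\<close> by (auto simp: vanishing_def)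
    then show "\<exists>v\<in>vanishing V F. v x \<noteq> 0" using v by (intro bexI[of _ v]) auto
  next
    assume "\<exists>v\<in>vanishing V F. v x \<noteq> 0"
    then obtain v where v: "v \<in> V" "\<forall>j\<in>F. v j = 0" "v x \<noteq> 0" by (auto simp: vanishing_def)
    obtain I where I: "I \<subseteq> F" "separates V I" "card I = rank M F"
      by (rule rank_attained[OF F])
    have "separates V (insert x I)"
      using I(1) v by (intro separates_insert[OF subspace_V I(2) v(1)]) auto
    then have "card (insert x I) \<le> rank M (insert x F)"
      using I(1) F x by (intro card_le_rank) auto
    moreover have "card (insert x I) = Suc (card I)"
      using I(1) F x finite_E by (intro card_insert_disjoint) (auto intro: finite_subset)
    ultimately show "rank M F < rank M (insert x F)" using I(3) by simp
  qed
  then show ?thesis unfolding flat_def gr by blast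
qed

text \<open>
  The inclusions of the vanishing spaces say that \<open>B0\<close> is a basis of \<open>A\<close> in the matroid and that \<open>B\<close>
  is a basis of the whole matroid.
\<close>

lemma adapted_basis:
  assumes "A \<subseteq> E"
  obtains B0 B w where "B0 \<subseteq> A" "B0 \<subseteq> B" "B \<subseteq> E"
    "\<And>b. b \<in> B \<Longrightarrow> w b \<in> V"
    "\<And>b b'. b' \<in> B \<Longrightarrow> b \<in> B \<Longrightarrow> w b b' = of_bool (b = b')"
    "vanishing V B0 \<subseteq> vanishing V A" "vanishing V B \<subseteq> {0}"
proof -
  obtain B0 where B0: "B0 \<subseteq> A" "separates V B0" "vanishing V B0 \<subseteq> vanishing V A"
    using maximal_separates[of "{}" A] assms by auto
  then have "B0 \<subseteq> E" using assms by simp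
  from maximal_separates[OF this order_refl B0(2)]
  obtain B where B: "B0 \<subseteq> B" "B \<subseteq> E" "separates V B" "vanishing V B \<subseteq> vanishing V E"
    by blast
  have "vanishing V B \<subseteq> {0}"
    using B(4) eq_zero_if_vanishes by (auto simp: vanishing_def)
  obtain w where w: "\<And>b. b \<in> B \<Longrightarrow> w b \<in> V"
      "\<And>b b'. b' \<in> B \<Longrightarrow> b \<in> B \<Longrightarrow> w b b' = of_bool (b = b')"
    by (rule separatesE[OF B(3)]) (rule that; assumption)
  show ?thesis
    by (rule that[OF B0(1) B(1,2) w B0(3) \<open>vanishing V B \<subseteq> {0}\<close>])
qed

lemma expand_in_dual_basis:
  assumes "B \<subseteq> E" "v \<in> V"
    and w: "\<And>b. b \<in> B \<Longrightarrow> w b \<in> V"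
    "\<And>b b'. b' \<in> B \<Longrightarrow> b \<in> B \<Longrightarrow> w b b' = of_bool (b = b')"
    and zero: "vanishing V B \<subseteq> {0}"
  shows "v = (\<lambda>j. \<Sum>b\<in>B. v b * w b j)"
proof -
  let ?u = "v - (\<lambda>j. \<Sum>b\<in>B. v b * w b j)"
  have "finite B" by (rule finite_subset[OF assms(1) finite_E])
  have "?u b = 0" if b: "b \<in> B" for b
  proof -
    have "(\<Sum>b'\<in>B. v b' * w b' b) = (\<Sum>b'\<in>B. v b' * of_bool (b' = b))"
      using b w(2) by (intro sum.cong) auto
    also have "\<dots> = v b" using b \<open>finite B\<close> by (subst sum_delta_mult') auto
    finally show ?thesis by simp
  qed
  moreover have "?u \<in> V"
    using assms(2) w(1) by (intro fun_vs.subspace_diff subspace_lincomb subspace_V)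
  ultimately have "?u \<in> vanishing V B" unfolding vanishing_def by blast
  then have "?u = 0" using zero by blast
  then show ?thesis by simp
qed

end

section \<open>Linear spaces with trivial valuations\<close>

locale trivially_valued_space =
  finite_coord_subspace E V + alg_closed_valuation val
  for E :: "'i set" and V :: "('i \<Rightarrow> 'k::alg_closed_field) set" and val :: "'k \<Rightarrow> ereal" +
  assumes trivial: "trivial_valuations val E V"
begin

text \<open>
  By Cramer's rule the entries of a dual basis are quotients of Pluecker coordinates, in which the
  common constant of the valuations cancels.
\<close>

lemma dual_entry_val:
  assumes B: "B \<subseteq> E" and w: "\<And>b. b \<in> B \<Longrightarrow> w b \<in> V"
    "\<And>b b'. b' \<in> B \<Longrightarrow> b \<in> B \<Longrightarrow> w b b' = of_bool (b = b')"
    and zero: "vanishing V B \<subseteq> {0}"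
    and bj: "b \<in> B" "j \<in> E"
  shows "val (w b j) \<in> {0, \<infinity>}"
proof (cases "j \<in> B")
  case True
  then show ?thesis using w(2)[of j b] bj(1) by simp
next
  case False
  have "finite B" by (rule finite_subset[OF B finite_E])
  then obtain bs where bs: "set bs = B" "distinct bs" using finite_distinct_list by metis
  obtain k where k: "k < length bs" "bs ! k = b" using bj(1) bs(1) by (metis in_set_conv_nth)
  have "row_basis (length bs) (\<lambda>k. w (bs ! k)) V"
  proof (rule dual_rows_basis[OF subspace_V])
    fix k l assume "k < length bs" "l < length bs"
    then show "w (bs ! k) (bs ! l) = of_bool (k = l)"
      using bs nth_mem[of k bs] nth_mem[of l bs] by (simp add: w(2) nth_eq_iff_index_eq)
  next
    fix v assume "v \<in> V" "\<forall>j\<in>set bs. v j = 0"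
    then have "v \<in> vanishing V B" using bs(1) by (simp add: vanishing_def)
    then show "v = 0" using zero by auto
  qed (use bs w(1) in auto)
  then have dim: "fun_vs.dim V = length bs" by (rule row_basis_dim)
  from trivial obtain R c where R: "row_basis (length bs) R V"
    and c: "\<And>js. distinct js \<Longrightarrow> set js \<subseteq> E \<Longrightarrow> length js = length bs \<Longrightarrow>
      val (minor R js) + ereal c \<in> {0, \<infinity>}"
    unfolding trivial_valuations_def dim by auto
  have "minor R bs \<noteq> 0"
    unfolding minor_eq_0_iff[OF R]
    using zero bs(1) by (auto simp: vanishing_def)
  then obtain r where r: "val (minor R bs) = ereal r" using val_eq_ereal by metis
  then have "r + c = 0" using c[of bs] bs B by (simp add: zero_ereal_def)
  have "minor R (bs[k := j]) = w b j * minor R bs"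
  proof (rule minor_replace_column)
    show "w b \<in> fun_vs.span (R ` {..<length bs})" using w(1) bj(1) R by (simp add: row_basis_def)
    fix l assume "l < length bs"
    then show "w b (bs ! l) = of_bool (l = k)"
      using bs k w(2)[of "bs ! l" b] bj(1) nth_mem[of l bs] by (auto simp: nth_eq_iff_index_eq)
  qed (use k in simp)
  moreover have "distinct (bs[k := j])" using bs False by (intro distinct_list_update) auto
  moreover have "set (bs[k := j]) \<subseteq> E"
    using set_update_subset_insert[of bs k j] B bs(1) bj(2) by blast
  ultimately have "val (w b j) + (ereal r + ereal c) \<in> {0, \<infinity>}"
    using c[of "bs[k := j]"] by (simp add: val_mult r add.assoc)
  then show ?thesis using \<open>r + c = 0\<close> by simp
qed

text \<open>
  Extend a basis \<open>B0\<close> of \<open>F\<close> to a basis \<open>B\<close>.  The dual vectors \<open>w b\<close> with \<open>b \<in> B - B0\<close> vanish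
  on \<open>F\<close> and do not have a common zero outside of \<open>F\<close>.  Combining them with the coefficients
  \<open>1, x, x\<^sup>2, \<dots>\<close> gives coordinates that are nonzero polynomials in \<open>x\<close> with coefficients of
  valuation \<open>0\<close> or \<open>\<infinity>\<close>, and a single \<open>x\<close> gives all of them valuation \<open>0\<close>.
\<close>

lemma generic_point_of_flat:
  assumes "flat M F"
  obtains v where "v \<in> vanishing V F" "\<And>j. j \<in> E - F \<Longrightarrow> val (v j) = 0"
proof -
  from assms have F: "F \<subseteq> E" and sep: "\<And>x. x \<in> E - F \<Longrightarrow> \<exists>v\<in>vanishing V F. v x \<noteq> 0"
    unfolding flat_iff by auto
  obtain B0 B w where B: "B0 \<subseteq> F" "B0 \<subseteq> B" "B \<subseteq> E"
    and w: "\<And>b. b \<in> B \<Longrightarrow> w b \<in> V"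
    "\<And>b b'. b' \<in> B \<Longrightarrow> b \<in> B \<Longrightarrow> w b b' = of_bool (b = b')"
    and zero: "vanishing V B0 \<subseteq> vanishing V F" "vanishing V B \<subseteq> {0}"
    by (rule adapted_basis[OF F]) (rule that; assumption)
  have finB: "finite B" by (rule finite_subset[OF B(3) finite_E])
  then obtain ts where ts: "set ts = B - B0" "distinct ts"
    using finite_distinct_list[of "B - B0"] by auto
  have wF: "w b \<in> vanishing V F" if "b \<in> B - B0" for b
  proof -
    have "w b b' = 0" if "b' \<in> B0" for b'
      using \<open>b \<in> B - B0\<close> that B(2) w(2)[of b' b] by auto
    then have "w b \<in> vanishing V B0" using that w(1) by (simp add: vanishing_def)
    then show ?thesis using zero(1) by blast
  qed
  define P where "P = (\<lambda>j. \<Sum>k<length ts. monom (w (ts ! k) j) k)"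
  have coeff_P: "coeff (P j) i = (if i < length ts then w (ts ! i) j else 0)" for i j
    by (simp add: P_def coeff_sum)
  obtain x where x: "\<And>j. j \<in> E - F \<Longrightarrow> val (poly (P j) x) = 0"
  proof (rule common_unit_value[of "E - F" P])
    show "finite (E - F)" using finite_E by simp
    fix j assume j: "j \<in> E - F"
    show "P j \<noteq> 0"
    proof
      assume "P j = 0"
      then have all0: "w (ts ! i) j = 0" if "i < length ts" for i using coeff_P[of j i] that by simp
      have w0: "w b j = 0" if "b \<in> B - B0" for b
      proof -
        from that obtain i where "i < length ts" "b = ts ! i" using ts(1) by (metis in_set_conv_nth)
        then show ?thesis using all0 by simp
      qed
      obtain v where v: "v \<in> vanishing V F" "v j \<noteq> 0" using sep[OF j] by blast
      then have "v = (\<lambda>j. \<Sum>b\<in>B. v b * w b j)"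
        by (intro expand_in_dual_basis[OF B(3) _ w zero(2)]) (simp_all add: vanishing_def)
      then have "v j = (\<Sum>b\<in>B. v b * w b j)" by (rule fun_cong)
      also have "\<dots> = 0"
      proof (rule sum.neutral, rule ballI)
        fix b assume "b \<in> B"
        then show "v b * w b j = 0"
          using w0[of b] v(1) B(1) by (cases "b \<in> B0") (auto simp: vanishing_def)
      qed
      finally show False using v(2) by simp
    qed
    show "val (coeff (P j) i) \<in> {0, \<infinity>}" for i
    proof (cases "i < length ts")
      case True
      then have "ts ! i \<in> B" using ts(1) nth_mem[OF True] by auto
      then show ?thesis
        using dual_entry_val[OF B(3) w zero(2)] j True by (simp add: coeff_P)
    qed (simp add: coeff_P)
  qed (rule that)
  let ?v = "\<lambda>j. \<Sum>k<length ts. x ^ k * w (ts ! k) j"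
  have mem: "w (ts ! k) \<in> vanishing V F" if "k < length ts" for k
    using that ts(1) nth_mem[OF that] by (intro wF) simp
  show ?thesis
  proof (rule that)
    have "?v \<in> V"
      using mem by (intro subspace_lincomb subspace_V) (auto simp: vanishing_def)
    then show "?v \<in> vanishing V F" using mem by (simp add: vanishing_def)
    fix j assume "j \<in> E - F"
    then show "val (?v j) = 0"
      using x[of j] by (simp add: P_def poly_sum poly_monom mult.commute)
  qed
qed

text \<open>
  Scaling the generic points of a chain of flats by elements of strictly decreasing valuation
  makes the nonzero summands of their sum have different valuations in each coordinate.
\<close>

lemma point_with_given_valuations:
  fixes s :: nat
  assumes flats: "\<And>k. k \<le> s \<Longrightarrow> flat M (F k)"
    and chain: "\<And>k. k < s \<Longrightarrow> F k \<subseteq> F (Suc k)"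
    and a: "\<And>k. k \<le> s \<Longrightarrow> a k \<noteq> 0" "\<And>i k. i < k \<Longrightarrow> k \<le> s \<Longrightarrow> val (a k) < val (a i)"
  shows "\<exists>v\<in>vanishing V (F 0). \<forall>j\<in>E. \<forall>k\<le>s.
    j \<notin> F k \<longrightarrow> (\<forall>i. k < i \<longrightarrow> i \<le> s \<longrightarrow> j \<in> F i) \<longrightarrow> val (v j) = val (a k)"
proof -
  have mono: "F i \<subseteq> F k" if "i \<le> k" "k \<le> s" for i k
    using that
  proof (induction k rule: dec_induct)
    case (step n)
    then show ?case using chain[of n] by auto
  qed simp
  have "\<forall>k. \<exists>v. k \<le> s \<longrightarrow> v \<in> vanishing V (F k) \<and> (\<forall>j\<in>E - F k. val (v j) = 0)"
  proof
    fix k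
    show "\<exists>v. k \<le> s \<longrightarrow> v \<in> vanishing V (F k) \<and> (\<forall>j\<in>E - F k. val (v j) = 0)"
    proof (cases "k \<le> s")
      case True
      obtain v where "v \<in> vanishing V (F k)" "\<And>j. j \<in> E - F k \<Longrightarrow> val (v j) = 0"
        by (rule generic_point_of_flat[OF flats[OF True]]) (rule that; assumption)
      then show ?thesis by (intro exI[of _ v]) simp
    qed simp
  qed
  then obtain g where g: "\<forall>k. k \<le> s \<longrightarrow> g k \<in> vanishing V (F k) \<and> (\<forall>j\<in>E - F k. val (g k j) = 0)"
    unfolding choice_iff by (rule exE)
  let ?v = "\<lambda>j. \<Sum>k\<le>s. a k * g k j"
  have g0: "g k j = 0" if "k \<le> s" "j \<in> F k" for k j
    using g that by (simp add: vanishing_def)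
  show ?thesis
  proof (rule bexI[of _ ?v], intro ballI allI impI)
    fix j k
    assume j: "j \<in> E" and k: "k \<le> s" "j \<notin> F k" and above: "\<forall>i. k < i \<longrightarrow> i \<le> s \<longrightarrow> j \<in> F i"
    have out: "j \<notin> F i" if "i \<le> k" for i using mono[OF that k(1)] k(2) by blast
    have vt: "val (a i * g i j) = val (a i)" if "i \<le> k" for i
      using g out[OF that] that j k(1) by (simp add: val_mult)
    have "val (?v j) = val (a k * g k j)"
    proof (rule val_sum_eq)
      show "a k * g k j \<noteq> 0"
        using vt[of k] a(1)[OF k(1)] val_eq_PInf_iff by (metis order_refl)
      fix i assume i: "i \<in> {..s}" "i \<noteq> k"
      show "val (a k * g k j) < val (a i * g i j)"
      proof (cases "i < k")
        case True
        then show ?thesis using vt a(2)[OF True k(1)] by simp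
      next
        case False
        then have "g i j = 0" using i above g0[of i j] by simp
        then show ?thesis using vt[of k] a(1)[OF k(1)] by (simp add: val_eq_PInf_iff)
      qed
    qed (use k in auto)
    then show "val (?v j) = val (a k)" using vt by simp
  next
    have "?v \<in> V"
      using g by (intro subspace_lincomb subspace_V) (auto simp: vanishing_def)
    moreover have "?v j = 0" if "j \<in> F 0" for j
    proof (rule sum.neutral, rule ballI)
      fix k assume "k \<in> {..s}"
      then show "a k * g k j = 0" using g0[of k j] mono[of 0 k] that by auto
    qed
    ultimately show "?v \<in> vanishing V (F 0)" by (simp add: vanishing_def)
  qed
qed

end

section \<open>Tropicalizing linear spaces with trivial valuations\<close>

definition linear_form :: "'i set \<Rightarrow> ('i \<Rightarrow> 'k::field) \<Rightarrow> ('i, 'k) mpoly" where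
  "linear_form A c = (\<Sum>i\<in>A. Poly_Mapping.single (Poly_Mapping.single i 1) (c i))"

lemma single_eq_iff_index:
  "n \<noteq> 0 \<Longrightarrow> Poly_Mapping.single i n = Poly_Mapping.single j n \<longleftrightarrow> i = j"
  by (metis lookup_single_eq lookup_single_not_eq)

lemma lookup_linear_form:
  assumes "finite A" "i \<in> A"
  shows "Poly_Mapping.lookup (linear_form A c) (Poly_Mapping.single i 1) = c i"
proof -
  have "Poly_Mapping.lookup (linear_form A c) (Poly_Mapping.single i 1) =
      (\<Sum>j\<in>A. if j = i then c j else 0)"
    unfolding linear_form_def lookup_sum
    by (intro sum.cong) (auto simp: lookup_single when_def single_eq_iff_index)
  then show ?thesis using assms by simp
qed

lemma keys_linear_form:
  assumes "finite A"
  shows "Poly_Mapping.keys (linear_form A c) =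
    (\<lambda>i. Poly_Mapping.single i 1) ` {i \<in> A. c i \<noteq> 0}" (is "?L = ?R")
proof
  show "?L \<subseteq> ?R"
  proof
    fix u assume "u \<in> ?L"
    then have "u \<in> (\<Union>i\<in>A. Poly_Mapping.keys (Poly_Mapping.single (Poly_Mapping.single i (1::nat)) (c i)))"
      unfolding linear_form_def using keys_sum[of "\<lambda>i. Poly_Mapping.single (Poly_Mapping.single i 1) (c i)" A]
      by (rule subsetD[rotated])
    then show "u \<in> ?R" by (auto split: if_splits)
  qed
  show "?R \<subseteq> ?L"
    using lookup_linear_form[OF assms, of _ c] by (auto simp: in_keys_iff)
qed

lemma eval_linear_form:
  assumes "finite A"
  shows "eval_mpoly (linear_form A c) x = (\<Sum>i\<in>A. c i * x i)"
proof -
  have "eval_mpoly (linear_form A c) x = (\<Sum>i\<in>{i \<in> A. c i \<noteq> 0}. c i * x i)"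
    unfolding eval_mpoly_def keys_linear_form[OF assms]
    by (subst sum.reindex) (auto simp: inj_on_def single_eq_iff_index lookup_linear_form[OF assms] simp del: One_nat_def)
  also have "\<dots> = (\<Sum>i\<in>A. c i * x i)"
    using assms by (intro sum.mono_neutral_left) auto
  finally show ?thesis .
qed

lemma homogeneous_linear_form: "finite A \<Longrightarrow> homogeneous (linear_form A c)"
  unfolding homogeneous_def by (auto simp: keys_linear_form mon_degree_def intro!: exI[of _ 1])

lemma trop_term_linear_form:
  assumes "finite E" "A \<subseteq> E" "i \<in> A"
  shows "trop_term val E (linear_form A c) w (Poly_Mapping.single i 1) = val (c i) + w i"
proof -
  have "(\<Sum>j\<in>E. ereal (real (Poly_Mapping.lookup (Poly_Mapping.single i 1) j)) * w j) =
      (\<Sum>j\<in>E. if j = i then w j else 0)"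
    by (intro sum.cong) (auto simp: lookup_single when_def zero_ereal_def[symmetric] one_ereal_def[symmetric])
  also have "\<dots> = w i" using assms by auto
  finally show ?thesis
    using lookup_linear_form[of A i c] assms finite_subset[OF assms(2,1)]
    by (simp add: trop_term_def)
qed

text \<open>
  The term of \<open>x\<close> is the only one below \<open>t\<close>, so the minimum is attained once.
\<close>

lemma trop_vanishes_linear_formD:
  assumes "finite E" "A \<subseteq> E" "x \<in> A" "c x \<noteq> 0" "val (c x) = 0" "w x < t"
    and others: "\<And>i. i \<in> A - {x} \<Longrightarrow> t \<le> val (c i) + w i"
  shows "\<not> trop_vanishes val E (linear_form A c) w"
proof
  let ?f = "linear_form A c" and ?e = "\<lambda>i. Poly_Mapping.single i (1::nat)"
  have finA: "finite A" by (rule finite_subset[OF assms(2,1)])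
  assume tv: "trop_vanishes val E ?f w"
  have x: "?e x \<in> Poly_Mapping.keys ?f" "trop_term val E ?f w (?e x) = w x"
    using assms finA by (auto simp: keys_linear_form trop_term_linear_form simp del: One_nat_def)
  have only_x: "u = ?e x" if u: "u \<in> Poly_Mapping.keys ?f" "trop_term val E ?f w u < t" for u
  proof -
    obtain i where i: "i \<in> A" "u = ?e i" using u(1) unfolding keys_linear_form[OF finA] by blast
    have "trop_term val E ?f w u = val (c i) + w i"
      unfolding i(2) by (rule trop_term_linear_form[OF assms(1,2) i(1)])
    then show ?thesis using others[of i] u(2) i by (cases "i = x") auto
  qed
  let ?\<mu> = "INF u\<in>Poly_Mapping.keys ?f. trop_term val E ?f w u"
  have "?\<mu> \<le> w x" using x by (metis INF_lower)
  then have lt: "?\<mu> < t" using assms(6) by simp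
  then have "?\<mu> \<noteq> \<infinity>" by auto
  with tv obtain u v where uv: "u \<in> Poly_Mapping.keys ?f" "v \<in> Poly_Mapping.keys ?f" "u \<noteq> v"
    "trop_term val E ?f w u = ?\<mu>" "trop_term val E ?f w v = ?\<mu>"
    unfolding trop_vanishes_def Let_def by auto
  have "u = ?e x" by (rule only_x[OF uv(1)]) (simp only: uv(4) lt)
  moreover have "v = ?e x" by (rule only_x[OF uv(2)]) (simp only: uv(5) lt)
  ultimately show False using uv(3) by simp
qed

lemma sum_successive_differences:
  fixes f :: "nat \<Rightarrow> real"
  assumes "k \<le> s"
  shows "(\<Sum>i\<in>{Suc k..s}. f (i - 1) - f i) = f k - f s"
  using assms by (induction s rule: dec_induct) auto

locale tropical_linear_space = trivially_valued_space E V val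
  for E :: "'i set" and V :: "('i \<Rightarrow> 'k::alg_closed_field) set" and val :: "'k \<Rightarrow> ereal" +
  fixes Z :: "('i \<Rightarrow> 'k) set set"
  assumes val_nontrivial: "\<exists>x. x \<noteq> 0 \<and> val x \<noteq> 0"
    and underlying: "underlying_space Z = V"
begin

definition trop_points :: "('i \<Rightarrow> ereal) set" where
  "trop_points = {w \<in> trop_vectors E.
     \<forall>f\<in>vanishing_ideal E Z. homogeneous f \<longrightarrow> trop_vanishes val E f w}"

definition flat_chain :: "nat \<Rightarrow> (nat \<Rightarrow> 'i set) \<Rightarrow> bool" where
  "flat_chain s F \<longleftrightarrow> (\<forall>i\<le>s. flat M (F i)) \<and> (\<forall>i<s. F i \<subset> F (Suc i)) \<and> F s \<subset> E"

text \<open>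
  Let \<open>B0\<close> be a basis of the superlevel set.  If an index \<open>x\<close> outside of it were in its closure, then
  \<open>x\<close> would be a linear combination of \<open>B0\<close>, with coefficients of valuation \<open>0\<close> or \<open>\<infinity>\<close>.  This
  is a linear form in the ideal at which the minimum is attained only at \<open>x\<close>.
\<close>

lemma superlevel_set_flat:
  assumes w: "w \<in> trop_points"
  shows "flat M {j \<in> E. t \<le> w j}"
proof -
  let ?F = "{j \<in> E. t \<le> w j}"
  have "\<exists>v\<in>vanishing V ?F. v x \<noteq> 0" if x: "x \<in> E - ?F" for x
  proof (rule ccontr)
    assume "\<not> ?thesis"
    then have x0: "\<And>v. v \<in> vanishing V ?F \<Longrightarrow> v x = 0" by blast
    have "?F \<subseteq> E" by blast
    then obtain B0 B u where B: "B0 \<subseteq> ?F" "B0 \<subseteq> B" "B \<subseteq> E"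
      and u: "\<And>b. b \<in> B \<Longrightarrow> u b \<in> V"
      "\<And>b b'. b' \<in> B \<Longrightarrow> b \<in> B \<Longrightarrow> u b b' = of_bool (b = b')"
      and zero: "vanishing V B0 \<subseteq> vanishing V ?F" "vanishing V B \<subseteq> {0}"
      by (rule adapted_basis) (rule that; assumption)
    let ?A = "insert x B0"
    define c where "c = (\<lambda>i. if i = x then - 1 else u i x)"
    have xB: "x \<notin> B0" using x B(1) by blast
    have A: "?A \<subseteq> E" using x B by blast
    have finA: "finite ?A" by (rule finite_subset[OF A finite_E])
    have rel: "(\<Sum>b\<in>B0. v b * u b x) = v x" if v: "v \<in> V" for v
    proof -
      let ?y = "v - (\<lambda>j. \<Sum>b\<in>B0. v b * u b j)"
      have "?y b = 0" if b: "b \<in> B0" for b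
      proof -
        have "(\<Sum>b'\<in>B0. v b' * u b' b) = (\<Sum>b'\<in>B0. v b' * of_bool (b' = b))"
          using u(2)[OF subsetD[OF B(2) b] subsetD[OF B(2)]] by (intro sum.cong) auto
        also have "\<dots> = v b" using b finA by (subst sum_delta_mult') auto
        finally show ?thesis by simp
      qed
      moreover have "?y \<in> V"
        using v u(1) B(2) by (intro fun_vs.subspace_diff subspace_lincomb subspace_V) auto
      ultimately have "?y \<in> vanishing V B0" unfolding vanishing_def by blast
      then have "?y x = 0" using zero(1) x0 by blast
      then show ?thesis by simp
    qed
    have "linear_form ?A c \<in> vanishing_ideal E Z"
      unfolding vanishing_ideal_def mem_Collect_eq
    proof (intro conjI ballI)
      show "vars_in E (linear_form ?A c)"
        using A by (auto simp: vars_in_def keys_linear_form[OF finA])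
      fix P v assume "P \<in> Z" "v \<in> P"
      then have v: "v \<in> V" using underlying by (auto simp: underlying_space_def)
      have "(\<Sum>i\<in>B0. c i * v i) = (\<Sum>b\<in>B0. v b * u b x)"
        using xB by (intro sum.cong) (auto simp: c_def)
      then show "eval_mpoly (linear_form ?A c) v = 0"
        using rel[OF v] finA xB by (simp add: eval_linear_form[OF finA] c_def)
    qed
    then have "trop_vanishes val E (linear_form ?A c) w"
      using w homogeneous_linear_form[OF finA, of c] by (simp add: trop_points_def)
    moreover have "\<not> trop_vanishes val E (linear_form ?A c) w"
    proof (rule trop_vanishes_linear_formD[OF finite_E A])
      show "x \<in> ?A" "c x \<noteq> 0" "val (c x) = 0" by (simp_all add: c_def)
      show "w x < t" using x by auto
      fix i assume i: "i \<in> ?A - {x}"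
      then have "val (u i x) \<in> {0, \<infinity>}"
        using B(2) x by (intro dual_entry_val[OF B(3) u zero(2)]) auto
      moreover have "t \<le> w i" using i B(1) by blast
      moreover have "c i = u i x" using i by (simp add: c_def)
      ultimately show "t \<le> val (c i) + w i" by auto
    qed
    ultimately show False by blast
  qed
  then show ?thesis unfolding flat_iff by blast
qed

text \<open>
  The flats of the cone are the superlevel sets of \<open>w\<close>, and the coefficients are the differences of
  its successive finite values.
\<close>

lemma trop_points_subset_cones:
  assumes w: "w \<in> trop_points"
  obtains s F where "flat_chain s F" "w \<in> bergman_cone E s F"
proof -
  have wv: "w \<in> trop_vectors E" using w by (simp add: trop_points_def)
  have notM: "w j \<noteq> - \<infinity>" if "j \<in> E" for j
    using wv that by (auto simp: trop_vectors_def)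
  define T where "T = real_of_ereal ` (w ` {j \<in> E. w j \<noteq> \<infinity>})"
  have finT: "finite T" using finite_E by (simp add: T_def)
  have "T \<noteq> {}" using wv by (auto simp: T_def trop_vectors_def)
  \<comment> \<open>the finite values of \<open>w\<close> in decreasing order\<close>
  define us where "us = rev (sorted_list_of_set T)"
  define s where "s = length us - 1"
  have setus: "set us = T" using finT by (simp add: us_def)
  have len: "length us = Suc s" using \<open>T \<noteq> {}\<close> setus by (cases us) (auto simp: s_def)
  have dec: "us ! k < us ! i" if "i < k" "k \<le> s" for i k
  proof -
    have "sorted_wrt (>) us" unfolding us_def sorted_wrt_rev by simp
    then show ?thesis using that len by (simp add: sorted_wrt_iff_nth_less)
  qed
  have level: "\<exists>k\<le>s. w j = ereal (us ! k)" if "j \<in> E" "w j \<noteq> \<infinity>" for j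
  proof -
    have "real_of_ereal (w j) \<in> set us" using that setus by (auto simp: T_def)
    then obtain k where "k < length us" "us ! k = real_of_ereal (w j)" by (metis in_set_conv_nth)
    then show ?thesis using len notM[OF that(1)] that(2) by (intro exI[of _ k]) (auto simp: ereal_real)
  qed
  have attained: "\<exists>j\<in>E. w j = ereal (us ! k)" if "k \<le> s" for k
  proof -
    have "us ! k \<in> T" using that len setus nth_mem[of k us] by simp
    then obtain j where "j \<in> E" "w j \<noteq> \<infinity>" "us ! k = real_of_ereal (w j)" by (auto simp: T_def)
    then show ?thesis using notM by (intro bexI[of _ j]) (auto simp: ereal_real)
  qed
  \<comment> \<open>The smallest finite value \<open>us ! s\<close> is left out, since its superlevel set is all of \<open>E\<close>.\<close>
  define F where "F = (\<lambda>i. {j \<in> E. (if i = 0 then \<infinity> else ereal (us ! (i - 1))) \<le> w j})"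
  have F0: "F 0 = {j \<in> E. w j = \<infinity>}" by (auto simp: F_def)
  have in_F: "j \<in> F i \<longleftrightarrow> Suc k \<le> i" if "j \<in> E" "k \<le> s" "w j = ereal (us ! k)" "i \<le> s" for i j k
  proof (cases i)
    case (Suc i')
    have "us ! i' \<le> us ! k \<longleftrightarrow> k \<le> i'"
      using dec[of i' k] dec[of k i'] that Suc by (cases i' k rule: linorder_cases) auto
    then show ?thesis using that Suc by (simp add: F_def)
  qed (use that in \<open>simp add: F0\<close>)
  have "flat_chain s F"
    unfolding flat_chain_def
  proof (intro conjI allI impI)
    show "flat M (F i)" for i unfolding F_def by (rule superlevel_set_flat[OF w])
  next
    fix i assume i: "i < s"
    obtain j where j: "j \<in> E" "w j = ereal (us ! i)" using attained[of i] i by auto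
    have "j \<in> F (Suc i)" "j \<notin> F i" using in_F[OF j(1) _ j(2)] i by auto
    moreover have "F i \<subseteq> F (Suc i)"
    proof
      fix j' assume j': "j' \<in> F i"
      then have "j' \<in> E" by (simp add: F_def)
      show "j' \<in> F (Suc i)"
      proof (cases "w j' = \<infinity>")
        case False
        then obtain k where "k \<le> s" "w j' = ereal (us ! k)" using level \<open>j' \<in> E\<close> by blast
        then show ?thesis using in_F[OF \<open>j' \<in> E\<close>, of k] j' i by auto
      qed (use \<open>j' \<in> E\<close> in \<open>simp add: F_def\<close>)
    qed
    ultimately show "F i \<subset> F (Suc i)" by blast
  next
    obtain j where j: "j \<in> E" "w j = ereal (us ! s)" using attained[of s] by auto
    have "j \<notin> F s" using in_F[OF j(1) _ j(2)] by simp
    moreover have "F s \<subseteq> E" by (auto simp: F_def)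
    ultimately show "F s \<subset> E" using j(1) by blast
  qed
  moreover have "w \<in> bergman_cone E s F"
    unfolding bergman_cone_def mem_Collect_eq
  proof (intro exI conjI)
    let ?l = "\<lambda>i. us ! (i - 1) - us ! i" and ?r = "us ! s"
    show "\<forall>i\<in>{1..s}. 0 \<le> ?l i"
    proof
      fix i assume "i \<in> {1..s}"
      then show "0 \<le> ?l i" using dec[of "i - 1" i] by auto
    qed
    show "w = (\<lambda>j\<in>E. \<infinity> * indicator (F 0) j + (\<Sum>i=1..s. ereal (?l i) * indicator (F i) j)
        + ereal ?r * indicator E j)"
    proof
      fix j
      show "w j = (\<lambda>j\<in>E. \<infinity> * indicator (F 0) j + (\<Sum>i=1..s. ereal (?l i) * indicator (F i) j)
        + ereal ?r * indicator E j) j"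
      proof (cases "j \<in> E")
        case False
        then show ?thesis using wv by (auto simp: trop_vectors_def PiE_def extensional_def)
      next
        case jE: True
        have fin: "(\<Sum>i=1..s. ereal (?l i) * indicator (F i) j) =
            ereal (\<Sum>i=1..s. ?l i * indicator (F i) j)"
          unfolding sum_ereal[symmetric] by (intro sum.cong) (auto simp: indicator_def zero_ereal_def)
        show ?thesis
        proof (cases "w j = \<infinity>")
          case True
          then have "j \<in> F 0" using jE by (simp add: F0)
          then show ?thesis using jE True fin by simp
        next
          case False
          then obtain k where k: "k \<le> s" "w j = ereal (us ! k)" using level jE by blast
          have "j \<notin> F 0" using False by (simp add: F0)
          have "(\<Sum>i=1..s. ?l i * indicator (F i) j) = (\<Sum>i\<in>{Suc k..s}. ?l i)"
            using in_F[OF jE k] by (intro sum.mono_neutral_cong_right) (auto simp: indicator_def)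
          also have "\<dots> = us ! k - us ! s" by (rule sum_successive_differences[OF k(1)])
          finally show ?thesis using jE \<open>j \<notin> F 0\<close> k(2) fin by simp
        qed
      qed
    qed
  qed
  ultimately show ?thesis by (rule that)
qed

end

context nonarch_valuation
begin

lemma val_monomial:
  assumes "finite E" "Poly_Mapping.keys u \<subseteq> E"
  shows "val (Poly_Mapping.lookup f u * (\<Prod>i\<in>Poly_Mapping.keys u. x i ^ Poly_Mapping.lookup u i)) =
    trop_term val E f (\<lambda>j. val (x j)) u"
proof -
  have "(\<Sum>i\<in>Poly_Mapping.keys u. ereal (real (Poly_Mapping.lookup u i)) * val (x i)) =
      (\<Sum>i\<in>E. ereal (real (Poly_Mapping.lookup u i)) * val (x i))"
    using assms by (intro sum.mono_neutral_left) (auto simp: in_keys_iff zero_ereal_def[symmetric])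
  then show ?thesis by (simp add: trop_term_def val_mult val_prod val_power)
qed

lemma trop_term_tendsto:
  assumes w: "\<And>j. j \<in> E \<Longrightarrow> w j \<noteq> - \<infinity>"
    and y: "\<And>j. j \<in> E \<Longrightarrow> (\<lambda>N. y N j) \<longlonglongrightarrow> w j"
  shows "(\<lambda>N. trop_term val E f (y N) u) \<longlonglongrightarrow> trop_term val E f w u"
proof -
  let ?t = "\<lambda>w j. ereal (real (Poly_Mapping.lookup u j)) * w j"
  have fin: "?t w j \<noteq> - \<infinity>" if "j \<in> E" for j
    using w[OF that] by (cases "w j") auto
  have "(\<lambda>N. \<Sum>j\<in>A. ?t (y N) j) \<longlonglongrightarrow> (\<Sum>j\<in>A. ?t w j) \<and> (\<Sum>j\<in>A. ?t w j) \<noteq> - \<infinity>"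
    if "A \<subseteq> E" for A
    using that
  proof (induction A rule: infinite_finite_induct)
    case (insert j A)
    have "(\<lambda>N. ?t (y N) j) \<longlonglongrightarrow> ?t w j"
      using y insert.prems by (intro tendsto_cmult_ereal) auto
    then have "(\<lambda>N. ?t (y N) j + (\<Sum>j\<in>A. ?t (y N) j)) \<longlonglongrightarrow> ?t w j + (\<Sum>j\<in>A. ?t w j)"
      using insert fin by (intro tendsto_add_ereal_nonneg) auto
    then show ?case using insert fin by auto
  qed auto
  then show ?thesis
    unfolding trop_term_def using val_not_MInf by (intro tendsto_add_ereal_nonneg) auto
qed

text \<open>
  A limit of valuations of zeros of \<open>f\<close> is a tropical zero of \<open>f\<close>: a strict minimum persists at
  nearby points, where it would be the valuation of the value of \<open>f\<close>.
\<close>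

lemma trop_vanishes_limit:
  assumes E: "finite E" "vars_in E f"
    and w: "\<And>j. j \<in> E \<Longrightarrow> w j \<noteq> - \<infinity>"
    and zeros: "\<And>N. eval_mpoly f (x N) = 0"
    and lim: "\<And>j. j \<in> E \<Longrightarrow> (\<lambda>N. val (x N j)) \<longlonglongrightarrow> w j"
  shows "trop_vanishes val E f w"
proof (rule ccontr)
  let ?K = "Poly_Mapping.keys f" and ?T = "trop_term val E f w"
  let ?\<mu> = "INF u\<in>?K. ?T u"
  let ?TN = "\<lambda>N. trop_term val E f (\<lambda>j. val (x N j))"
  assume "\<not> trop_vanishes val E f w"
  then have fin: "?\<mu> \<noteq> \<infinity>"
    and unique: "\<And>u v. u \<in> ?K \<Longrightarrow> v \<in> ?K \<Longrightarrow> ?T u = ?\<mu> \<Longrightarrow> ?T v = ?\<mu> \<Longrightarrow> u = v"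
    unfolding trop_vanishes_def Let_def by auto
  have "?K \<noteq> {}"
  proof
    assume "?K = {}"
    then have "?\<mu> = \<infinity>" by (simp add: top_ereal_def)
    then show False using fin by blast
  qed
  then have "Min (?T ` ?K) \<in> ?T ` ?K" by (intro Min_in) auto
  moreover have "?\<mu> = Min (?T ` ?K)" using \<open>?K \<noteq> {}\<close> by (subst Min_Inf) auto
  ultimately obtain u where u: "u \<in> ?K" "?T u = ?\<mu>" by auto
  have less: "?T u < ?T v" if "v \<in> ?K - {u}" for v
  proof -
    have "?\<mu> \<le> ?T v" using that by (intro INF_lower) simp
    moreover have "?T v \<noteq> ?\<mu>" using unique[OF u(1) _ u(2)] that by blast
    ultimately show ?thesis using u(2) by simp
  qed
  have TN: "(\<lambda>N. ?TN N v) \<longlonglongrightarrow> ?T v" for v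
    by (rule trop_term_tendsto[OF w lim])
  have "\<forall>\<^sub>F N in sequentially. ?TN N u < ?TN N v" if v: "v \<in> ?K - {u}" for v
  proof -
    obtain t where t: "?T u < t" "t < ?T v" using dense[OF less[OF v]] by blast
    show ?thesis
      using order_tendstoD(2)[OF TN t(1)] order_tendstoD(1)[OF TN t(2)]
      by eventually_elim (rule less_trans)
  qed
  then have "\<forall>\<^sub>F N in sequentially. \<forall>v\<in>?K - {u}. ?TN N u < ?TN N v"
    by (intro eventually_ball_finite) auto
  moreover have "\<forall>\<^sub>F N in sequentially. ?TN N u < \<infinity>"
    using order_tendstoD(2)[OF TN] u(2) fin by (metis ereal_infty_less(1))
  ultimately have "\<forall>\<^sub>F N in sequentially. (\<forall>v\<in>?K - {u}. ?TN N u < ?TN N v) \<and> ?TN N u < \<infinity>"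
    by eventually_elim blast
  from eventually_happens'[OF sequentially_bot this]
  obtain N where N: "\<forall>v\<in>?K - {u}. ?TN N u < ?TN N v" "?TN N u < \<infinity>"
    by (elim exE conjE) (rule that; assumption)
  let ?m = "\<lambda>v. Poly_Mapping.lookup f v * (\<Prod>i\<in>Poly_Mapping.keys v. x N i ^ Poly_Mapping.lookup v i)"
  have m: "val (?m v) = ?TN N v" if "v \<in> ?K" for v
    using E that by (intro val_monomial) (auto simp: vars_in_def)
  have "val (eval_mpoly f (x N)) = val (?m u)"
    unfolding eval_mpoly_def
  proof (rule val_sum_eq)
    show "?m u \<noteq> 0" using m[OF u(1)] N(2) by (metis val_0 less_irrefl)
    show "val (?m u) < val (?m v)" if "v \<in> ?K" "v \<noteq> u" for v using m u(1) N(1) that by auto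
  qed (use u(1) in auto)
  then show False using m[OF u(1)] N(2) zeros[of N] by simp
qed

end

context tropical_linear_space
begin

lemma flat_chain_mono:
  assumes "flat_chain s F" "i \<le> k" "k \<le> s"
  shows "F i \<subseteq> F k"
  using assms(2,3)
proof (induction k rule: dec_induct)
  case (step n)
  then show ?case using assms(1) unfolding flat_chain_def by (auto dest!: spec[of _ n])
qed simp

text \<open>
  A point of the cone has a constant value \<open>h k\<close> on \<open>F (k + 1) - F k\<close>, and \<open>h\<close> decreases weakly.
  The value group being dense, \<open>h\<close> can be approximated by strictly decreasing sequences of values, and
  these are realized by points of \<open>V\<close>.
\<close>

lemma cone_point_approximable:
  assumes chain: "flat_chain s F" and w: "w \<in> bergman_cone E s F"
  obtains x where "\<And>N. x N \<in> V - {0}" "\<And>j. j \<in> E \<Longrightarrow> (\<lambda>N. val (x N j)) \<longlonglongrightarrow> w j"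
    "\<And>j. j \<in> E \<Longrightarrow> w j \<noteq> - \<infinity>" "\<exists>j\<in>E. w j \<noteq> \<infinity>"
proof -
  from w obtain l r where w_def: "w = (\<lambda>j\<in>E. \<infinity> * indicator (F 0) j
      + (\<Sum>i=1..s. ereal (l i) * indicator (F i) j) + ereal r * indicator E j)"
    and l: "\<forall>i\<in>{1..s}. 0 \<le> l i"
    unfolding bergman_cone_def by blast
  \<comment> \<open>for \<open>j \<notin> F 0\<close>, this is the \<open>k\<close> with \<open>j \<in> F (k + 1) - F k\<close>, where \<open>F (s + 1) = E\<close>\<close>
  define lev where "lev = (\<lambda>j. Max {k. k \<le> s \<and> j \<notin> F k})"
  define h where "h = (\<lambda>k. r + (\<Sum>i\<in>{Suc k..s}. l i))"
  have lev: "lev j \<le> s" "j \<notin> F (lev j)" "\<And>i. lev j < i \<Longrightarrow> i \<le> s \<Longrightarrow> j \<in> F i" if "j \<notin> F 0" for j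
  proof -
    let ?L = "{k. k \<le> s \<and> j \<notin> F k}"
    have fin: "finite ?L" by simp
    moreover have "0 \<in> ?L" using that by simp
    ultimately have "lev j \<in> ?L" unfolding lev_def by (intro Max_in) auto
    then show "lev j \<le> s" "j \<notin> F (lev j)" by auto
    show "j \<in> F i" if "lev j < i" "i \<le> s" for i
    proof (rule ccontr)
      assume "j \<notin> F i"
      then have "i \<le> lev j" unfolding lev_def using that(2) by (intro Max_ge[OF fin]) simp
      then show False using that(1) by simp
    qed
  qed
  have fin: "(\<Sum>i=1..s. ereal (l i) * indicator (F i) j) = ereal (\<Sum>i=1..s. l i * indicator (F i) j)" for j
    unfolding sum_ereal[symmetric] by (intro sum.cong) (auto simp: indicator_def zero_ereal_def)
  have w0: "w j = \<infinity>" if "j \<in> E" "j \<in> F 0" for j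
    using that fin by (simp add: w_def)
  have w1: "w j = ereal (h (lev j))" if "j \<in> E" "j \<notin> F 0" for j
  proof -
    have below: "j \<notin> F i" if "i \<le> lev j" for i
      using flat_chain_mono[OF chain that lev(1)] lev(2) \<open>j \<notin> F 0\<close> by blast
    have "(\<Sum>i=1..s. l i * indicator (F i) j) = (\<Sum>i\<in>{Suc (lev j)..s}. l i)"
      using lev(3)[OF that(2)] below
      by (intro sum.mono_neutral_cong_right) (auto simp: indicator_def not_less_eq_eq[symmetric])
    then show ?thesis using that fin by (simp add: w_def h_def add.commute)
  qed
  have h_anti: "h k \<le> h i" if "i \<le> k" for i k
    unfolding h_def using l that by (intro add_left_mono sum_mono2) auto
  define e where "e = (\<lambda>N. inverse (real (Suc N)))"
  have e_pos: "e N > 0" for N by (simp add: e_def)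
  have e_lim: "e \<longlonglongrightarrow> 0" unfolding e_def by (rule LIMSEQ_inverse_real_of_nat)
  \<comment> \<open>The intervals for \<open>k = s, s - 1, \<dots>\<close> are shifted by successive multiples of \<open>e N\<close>, so that they
    are disjoint even if \<open>h\<close> takes the same value twice.\<close>
  have "\<forall>N k. \<exists>a. a \<noteq> 0 \<and> ereal (h k + real (s - k) * e N) < val a
      \<and> val a < ereal (h k + (real (s - k) + 1) * e N)"
  proof (intro allI)
    fix N k
    have "h k + real (s - k) * e N < h k + (real (s - k) + 1) * e N"
      using e_pos[of N] by (simp add: algebra_simps)
    from val_dense[OF val_nontrivial this]
    obtain a where "a \<noteq> 0" "ereal (h k + real (s - k) * e N) < val a"
      "val a < ereal (h k + (real (s - k) + 1) * e N)" by blast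
    then show "\<exists>a. a \<noteq> 0 \<and> ereal (h k + real (s - k) * e N) < val a
      \<and> val a < ereal (h k + (real (s - k) + 1) * e N)" by blast
  qed
  then obtain a where a: "\<And>N k. a N k \<noteq> 0"
      "\<And>N k. ereal (h k + real (s - k) * e N) < val (a N k)"
      "\<And>N k. val (a N k) < ereal (h k + (real (s - k) + 1) * e N)"
    unfolding choice_iff by auto
  have a_dec: "val (a N k) < val (a N i)" if "i < k" "k \<le> s" for N i k
  proof -
    have "real (s - k) + 1 \<le> real (s - i)" using that by linarith
    then have "(real (s - k) + 1) * e N \<le> real (s - i) * e N"
      using e_pos[of N] by (intro mult_right_mono) auto
    then have "ereal (h k + (real (s - k) + 1) * e N) \<le> ereal (h i + real (s - i) * e N)"
      using h_anti[of i k] that by simp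
    then show ?thesis using a(2)[of i N] a(3)[of N k] by (meson le_less_trans less_le_trans less_imp_le)
  qed
  have a_lim: "(\<lambda>N. val (a N k)) \<longlonglongrightarrow> ereal (h k)" for k
  proof (rule tendsto_sandwich)
    have lim: "(\<lambda>N. ereal (h k + c * e N)) \<longlonglongrightarrow> ereal (h k)" for c
    proof -
      have "(\<lambda>N. h k + c * e N) \<longlonglongrightarrow> h k + c * 0"
        by (intro tendsto_add tendsto_mult tendsto_const e_lim)
      then show ?thesis by simp
    qed
    show "(\<lambda>N. ereal (h k + real (s - k) * e N)) \<longlonglongrightarrow> ereal (h k)"
      "(\<lambda>N. ereal (h k + (real (s - k) + 1) * e N)) \<longlonglongrightarrow> ereal (h k)" by (rule lim)+
    show "\<forall>\<^sub>F N in sequentially. ereal (h k + real (s - k) * e N) \<le> val (a N k)"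
      using a(2) by (intro always_eventually allI less_imp_le)
    show "\<forall>\<^sub>F N in sequentially. val (a N k) \<le> ereal (h k + (real (s - k) + 1) * e N)"
      using a(3) by (intro always_eventually allI less_imp_le)
  qed
  have flats: "\<And>k. k \<le> s \<Longrightarrow> flat M (F k)" and steps: "\<And>k. k < s \<Longrightarrow> F k \<subseteq> F (Suc k)"
    using chain unfolding flat_chain_def by auto
  have "\<forall>N. \<exists>x. x \<in> vanishing V (F 0) \<and> (\<forall>j\<in>E - F 0. val (x j) = val (a N (lev j)))"
  proof
    fix N
    obtain x where x: "x \<in> vanishing V (F 0)"
      "\<forall>j\<in>E. \<forall>k\<le>s. j \<notin> F k \<longrightarrow> (\<forall>i. k < i \<longrightarrow> i \<le> s \<longrightarrow> j \<in> F i)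
        \<longrightarrow> val (x j) = val (a N k)"
      using point_with_given_valuations[of s F "a N"] flats steps a(1) a_dec by auto
    then show "\<exists>x. x \<in> vanishing V (F 0) \<and> (\<forall>j\<in>E - F 0. val (x j) = val (a N (lev j)))"
      using lev by (intro exI[of _ x]) auto
  qed
  then obtain x where x: "\<And>N. x N \<in> vanishing V (F 0)"
    "\<And>N j. j \<in> E \<Longrightarrow> j \<notin> F 0 \<Longrightarrow> val (x N j) = val (a N (lev j))"
    unfolding choice_iff by auto
  obtain j0 where j0: "j0 \<in> E" "j0 \<notin> F 0"
    using chain flat_chain_mono[OF chain, of 0 s] unfolding flat_chain_def by blast
  show ?thesis
  proof (rule that)
    fix N
    have "x N j0 \<noteq> 0" using x(2)[OF j0, of N] a(1)[of N "lev j0"] val_eq_PInf_iff by metis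
    then show "x N \<in> V - {0}" using x(1)[of N] by (auto simp: vanishing_def)
  next
    fix j assume j: "j \<in> E"
    show "(\<lambda>N. val (x N j)) \<longlonglongrightarrow> w j"
    proof (cases "j \<in> F 0")
      case True
      then show ?thesis using x(1) w0[OF j] by (simp add: vanishing_def)
    next
      case False
      then show ?thesis using x(2)[OF j] w1[OF j] a_lim by simp
    qed
    show "w j \<noteq> - \<infinity>" using w0[OF j] w1[OF j] by (cases "j \<in> F 0") auto
  next
    show "\<exists>j\<in>E. w j \<noteq> \<infinity>" using j0 w1 by (intro bexI[of _ j0]) auto
  qed
qed

lemma cone_subset_trop_points:
  assumes "flat_chain s F" "w \<in> bergman_cone E s F"
  shows "w \<in> trop_points"
proof -
  obtain x where x: "\<And>N. x N \<in> V - {0}" "\<And>j. j \<in> E \<Longrightarrow> (\<lambda>N. val (x N j)) \<longlonglongrightarrow> w j"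
    and w: "\<And>j. j \<in> E \<Longrightarrow> w j \<noteq> - \<infinity>" "\<exists>j\<in>E. w j \<noteq> \<infinity>"
    by (rule cone_point_approximable[OF assms]) (rule that; assumption)
  have "w \<in> extensional E" using assms(2) by (auto simp: bergman_cone_def)
  then have "w \<in> trop_vectors E" using w by (auto simp: trop_vectors_def PiE_def)
  moreover have "trop_vanishes val E f w" if "f \<in> vanishing_ideal E Z" for f
  proof (rule trop_vanishes_limit[OF finite_E _ w(1) _ x(2)])
    show "vars_in E f" using that by (simp add: vanishing_ideal_def)
    fix N
    have "x N \<in> \<Union>Z" using x(1)[of N] underlying by (auto simp: underlying_space_def)
    then show "eval_mpoly f (x N) = 0" using that by (auto simp: vanishing_ideal_def)
  qed
  ultimately show ?thesis by (simp add: trop_points_def)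
qed

theorem trop_eq_Union_extended_bergman_fan:
  "trop val E Z = \<Union> (extended_bergman_fan M)"
proof -
  have gr: "ground M = E" by (simp add: linear_matroid_def)
  have fan: "extended_bergman_fan M = {bergman_cone E s F // trop_rel E |s F. flat_chain s F}"
    unfolding extended_bergman_fan_def flat_chain_def gr by simp
  have pts: "trop_points = \<Union> {bergman_cone E s F |s F. flat_chain s F}"
  proof
    show "trop_points \<subseteq> \<Union> {bergman_cone E s F |s F. flat_chain s F}"
    proof
      fix w assume "w \<in> trop_points"
      then obtain s F where "flat_chain s F" "w \<in> bergman_cone E s F"
        by (rule trop_points_subset_cones)
      then show "w \<in> \<Union> {bergman_cone E s F |s F. flat_chain s F}" by blast
    qed
    show "\<Union> {bergman_cone E s F |s F. flat_chain s F} \<subseteq> trop_points"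
      using cone_subset_trop_points by auto
  qed
  have "trop val E Z = trop_points // trop_rel E"
    unfolding trop_def trop_points_def ..
  also have "\<dots> = \<Union> (extended_bergman_fan M)"
    unfolding pts fan quotient_def by blast
  finally show ?thesis .
qed

end

section \<open>Minors with an additional column\<close>

abbreviation with_column_0 :: "(nat \<Rightarrow> nat \<Rightarrow> 'k) \<Rightarrow> (nat \<Rightarrow> 'k) \<Rightarrow> nat \<Rightarrow> nat \<Rightarrow> 'k" where
  "with_column_0 w lam \<equiv> (\<lambda>i. (w i)(0 := lam i))"

text \<open>
  The index \<open>0\<close> is not in \<open>{1..n}\<close> and serves as the name of an additional column.  The three parts
  are Laplace expansions: along the new column, along the new column when it is the last unit vector,
  and along a row that is zero in all old columns.
\<close>

lemma minor_with_column_0: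
  fixes w :: "nat \<Rightarrow> nat \<Rightarrow> 'k::field"
  assumes "0 \<notin> set js"
  shows "minor (with_column_0 w lam) (js @ [0]) =
      (\<Sum>i\<le>length js. lam i * minor (with_column_0 w (\<lambda>l. of_bool (l = i))) (js @ [0]))"
    and "minor (with_column_0 w (\<lambda>l. of_bool (l = length js))) (js @ [0]) = minor w js"
    and "k \<le> length js \<Longrightarrow> (\<And>j. j \<in> set js \<Longrightarrow> w k j = 0) \<Longrightarrow>
      minor (with_column_0 w lam) (js @ [0]) =
        lam k * minor (with_column_0 w (\<lambda>l. of_bool (l = k))) (js @ [0])"
proof -
  let ?r = "length js" and ?m = "Suc (length js)"
  define A where "A = (\<lambda>lam. mat ?m ?m (\<lambda>(i, l). with_column_0 w lam i ((js @ [0]) ! l)))"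
  have A: "A lam \<in> carrier_mat ?m ?m" for lam by (simp add: A_def)
  have minor_A: "minor (with_column_0 w lam) (js @ [0]) = det (A lam)" for lam
    by (simp add: minor_def A_def)
  define D where "D = (\<lambda>i. cofactor (A (\<lambda>_. 0)) i ?r)"
  have nz: "(js ! l = 0) = False" if "l < ?r" for l using assms nth_mem[OF that] by metis
  have entry: "A lam $$ (i, l) = (if l = ?r then lam i else w i (js ! l))"
    if "i < ?m" "l < ?m" for lam i l
    using that by (auto simp: A_def nz nth_append less_Suc_eq)
  have cof: "cofactor (A lam) i ?r = D i" if "i < ?m" for lam i
  proof -
    have "mat_delete (A lam) i ?r = mat_delete (A (\<lambda>_. 0)) i ?r"
    proof (rule eq_matI)
      fix a b assume "a < dim_row (mat_delete (A (\<lambda>_. 0)) i ?r)" "b < dim_col (mat_delete (A (\<lambda>_. 0)) i ?r)"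
      then have "a < ?r" "b < ?r" using A by (simp_all add: mat_delete_def A_def)
      then show "mat_delete (A lam) i ?r $$ (a, b) = mat_delete (A (\<lambda>_. 0)) i ?r $$ (a, b)"
        using that nz[of b] by (simp add: mat_delete_def A_def nth_append)
    qed (simp_all add: mat_delete_def A_def)
    then show ?thesis by (simp add: D_def cofactor_def)
  qed
  have expand: "det (A lam) = (\<Sum>i\<le>?r. lam i * D i)" for lam
    using laplace_expansion_column[OF A, of ?r lam]
    by (simp add: entry cof lessThan_Suc_atMost cong: sum.cong_simp)
  have unit: "det (A (\<lambda>l. of_bool (l = i))) = D i" if "i \<le> ?r" for i
    unfolding expand using that by (subst sum_delta_mult) auto
  show "minor (with_column_0 w lam) (js @ [0]) =
      (\<Sum>i\<le>?r. lam i * minor (with_column_0 w (\<lambda>l. of_bool (l = i))) (js @ [0]))"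
    unfolding minor_A by (subst expand) (intro sum.cong refl, simp add: unit)
  have "mat_delete (A (\<lambda>_. 0)) ?r ?r = mat ?r ?r (\<lambda>(i, l). w i (js ! l))"
    by (intro eq_matI) (auto simp: mat_delete_def A_def nz nth_append)
  then have "D ?r = minor w js"
    by (simp add: D_def cofactor_def minor_def)
  then show "minor (with_column_0 w (\<lambda>l. of_bool (l = ?r))) (js @ [0]) = minor w js"
    by (simp add: minor_A unit)
  assume k: "k \<le> ?r" and row: "\<And>j. j \<in> set js \<Longrightarrow> w k j = 0"
  have "det (A lam) = (\<Sum>l<?m. A lam $$ (k, l) * cofactor (A lam) k l)"
    using k by (intro laplace_expansion_row[OF A]) simp
  also have "\<dots> = (\<Sum>l<?m. of_bool (l = ?r) * (lam k * D k))"
  proof (rule sum.cong[OF refl])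
    fix l assume "l \<in> {..<?m}"
    then show "A lam $$ (k, l) * cofactor (A lam) k l = of_bool (l = ?r) * (lam k * D k)"
      using k row[of "js ! l"] entry[of k l lam] cof[of k] by (cases "l = ?r") auto
  qed
  also have "\<dots> = lam k * D k" by (subst sum_delta_mult) auto
  finally show "minor (with_column_0 w lam) (js @ [0]) =
      lam k * minor (with_column_0 w (\<lambda>l. of_bool (l = k))) (js @ [0])"
    using k by (simp add: minor_A unit)
qed

lemma minor_with_copied_column:
  fixes w :: "nat \<Rightarrow> nat \<Rightarrow> 'k::field"
  assumes "0 \<notin> set js"
  shows "minor (with_column_0 w (\<lambda>i. w i a)) (js @ [0]) = minor w (js @ [a])"
proof -
  have nz: "(js ! l = 0) = False" if "l < length js" for l using assms nth_mem[OF that] by metis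
  have "mat (Suc (length js)) (Suc (length js)) (\<lambda>(i, l). with_column_0 w (\<lambda>i. w i a) i ((js @ [0]) ! l))
      = mat (Suc (length js)) (Suc (length js)) (\<lambda>(i, l). w i ((js @ [a]) ! l))"
    by (intro eq_matI) (auto simp: nz nth_append less_Suc_eq)
  then show ?thesis by (simp add: minor_def)
qed

lemma minor_repeated_column:
  fixes w :: "nat \<Rightarrow> nat \<Rightarrow> 'k::field"
  assumes "a \<in> set js"
  shows "minor w (js @ [a]) = 0"
proof -
  let ?m = "Suc (length js)"
  obtain l where l: "l < length js" "js ! l = a" using assms by (metis in_set_conv_nth)
  let ?A = "mat ?m ?m (\<lambda>(i, l). w i ((js @ [a]) ! l))"
  have "det ?A = 0"
  proof (rule det_identical_columns[of ?A ?m l "length js"])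
    show "col ?A l = col ?A (length js)"
      using l by (intro eq_vecI) (auto simp: nth_append)
  qed (use l in auto)
  then show ?thesis by (simp add: minor_def)
qed

text \<open>
  Expanding along a column that is a unit vector \<open>e\<^sub>k\<close> eliminates row \<open>k\<close>, so that the other
  entries of that row are irrelevant.
\<close>

lemma minor_cong_pivot_rows:
  fixes R R' :: "nat \<Rightarrow> 'i \<Rightarrow> 'k::field"
  assumes "finite K"
    and "\<And>k. k \<in> K \<Longrightarrow> k < length js \<and> (\<exists>j\<in>set js. \<forall>i<length js.
      R i j = of_bool (i = k) \<and> R' i j = of_bool (i = k))"
    and "\<And>i j. i < length js \<Longrightarrow> i \<notin> K \<Longrightarrow> j \<in> set js \<Longrightarrow> R i j = R' i j"
  shows "minor R js = minor R' js"
  using assms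
proof (induction K arbitrary: R rule: finite_induct)
  case empty
  have "mat (length js) (length js) (\<lambda>(i, j). R i (js ! j))
      = mat (length js) (length js) (\<lambda>(i, j). R' i (js ! j))"
    using empty(2) by (intro eq_matI) auto
  then show ?case by (simp add: minor_def)
next
  case (insert k K)
  let ?m = "length js"
  define Q where "Q = R(k := R' k)"
  obtain j where k: "k < ?m" and "j \<in> set js"
    and piv: "\<And>i. i < ?m \<Longrightarrow> R i j = of_bool (i = k) \<and> R' i j = of_bool (i = k)"
    using insert.prems(1)[of k] by auto
  then obtain b where b: "b < ?m" "js ! b = j" by (metis in_set_conv_nth)
  let ?A = "mat ?m ?m (\<lambda>(i, l). R i (js ! l))" and ?B = "mat ?m ?m (\<lambda>(i, l). Q i (js ! l))"
  have "det ?A = (\<Sum>i<?m. ?A $$ (i, b) * cofactor ?A i b)"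
    using b by (intro laplace_expansion_column) auto
  also have "\<dots> = (\<Sum>i<?m. ?B $$ (i, b) * cofactor ?B i b)"
  proof (rule sum.cong[OF refl])
    fix i assume "i \<in> {..<?m}"
    then have i: "i < ?m" by simp
    show "?A $$ (i, b) * cofactor ?A i b = ?B $$ (i, b) * cofactor ?B i b"
    proof (cases "i = k")
      case True
      have "mat_delete ?A k b = mat_delete ?B k b"
        using b k by (intro eq_matI) (auto simp: mat_delete_def Q_def)
      then have "cofactor ?A k b = cofactor ?B k b" by (simp add: cofactor_def)
      then show ?thesis using i b piv[OF i] True by (simp add: Q_def)
    next
      case False
      then show ?thesis using i b piv[OF i] by (simp add: Q_def)
    qed
  qed
  also have "\<dots> = det ?B"
    using b by (intro laplace_expansion_column[symmetric]) auto
  finally have "minor R js = minor Q js" by (simp add: minor_def)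
  also have "minor Q js = minor R' js"
  proof (rule insert.IH)
    fix k' assume k': "k' \<in> K"
    then obtain j' where "k' < ?m" "j' \<in> set js"
      "\<forall>i<?m. R i j' = of_bool (i = k') \<and> R' i j' = of_bool (i = k')"
      using insert.prems(1)[of k'] by auto
    then show "k' < ?m \<and> (\<exists>j\<in>set js. \<forall>i<?m. Q i j = of_bool (i = k') \<and> R' i j = of_bool (i = k'))"
      by (intro conjI bexI[of _ j']) (auto simp: Q_def)
  next
    fix i j assume "i < ?m" "i \<notin> K" "j \<in> set js"
    then show "Q i j = R' i j" using insert.prems(2)[of i j] by (simp add: Q_def)
  qed
  finally show ?case .
qed

section \<open>The Grassmannian of hyperplanes of a linear space\<close>

text \<open>
  For a hyperplane of the row space, given as the kernel of the functional with the values \<open>lam i\<close> on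
  the rows \<open>x i\<close>, these are its Pluecker coordinates up to a common factor.
\<close>

definition hyperplane_coords ::
    "nat \<Rightarrow> nat \<Rightarrow> (nat \<Rightarrow> nat \<Rightarrow> 'k::field) \<Rightarrow> (nat \<Rightarrow> 'k) \<Rightarrow> nat set \<Rightarrow> 'k" where
  "hyperplane_coords d n x lam =
     (\<lambda>J. if J \<in> dsets n d then minor (with_column_0 x lam) (sorted_list_of_set J @ [0]) else 0)"

lemma dsetsD:
  assumes "J \<in> dsets n d"
  shows "finite J" "set (sorted_list_of_set J) = J" "length (sorted_list_of_set J) = d" "0 \<notin> J"
    "J \<subseteq> {1..n}"
  using assms finite_subset[of J "{1..n}"] by (auto simp: dsets_def)

lemma finite_dsets: "finite (dsets n d)"
  by (rule finite_subset[of _ "Pow {1..n}"]) (auto simp: dsets_def)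

lemma hyperplane_coords_linear:
  "hyperplane_coords d n x lam =
    (\<lambda>J. \<Sum>k<Suc d. lam k * hyperplane_coords d n x (\<lambda>i. of_bool (i = k)) J)"
proof
  fix J
  show "hyperplane_coords d n x lam J =
    (\<Sum>k<Suc d. lam k * hyperplane_coords d n x (\<lambda>i. of_bool (i = k)) J)"
  proof (cases "J \<in> dsets n d")
    case True
    note J = dsetsD[OF True]
    have "0 \<notin> set (sorted_list_of_set J)" using J by simp
    from minor_with_column_0(1)[OF this, of x lam] show ?thesis
      using True J(3) by (simp add: hyperplane_coords_def lessThan_Suc_atMost)
  qed (simp add: hyperplane_coords_def)
qed

text \<open>
  The rows \<open>x 0, \<dots>, x d\<close> form the basis of \<open>X\<close> that is dual to the coordinates \<open>cs\<close>, i.e. the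
  reduced row echelon form of \<open>X\<close> with respect to these pivots.
\<close>

locale coordinate_chart =
  fixes d n :: nat and X :: "(nat \<Rightarrow> 'k::field) set" and cs :: "nat list"
    and x :: "nat \<Rightarrow> nat \<Rightarrow> 'k"
  assumes subspace_X: "fun_vs.subspace X" and X_coords: "X \<subseteq> coord_space {1..n}"
    and length_cs: "length cs = Suc d" and distinct_cs: "distinct cs" and cs_range: "set cs \<subseteq> {1..n}"
    and x_in: "\<And>k. k \<le> d \<Longrightarrow> x k \<in> X"
    and x_dual: "\<And>k l. k \<le> d \<Longrightarrow> l \<le> d \<Longrightarrow> x k (cs ! l) = of_bool (k = l)"
    and vanishing_cs: "vanishing X (set cs) \<subseteq> {0}"
begin

lemma row_basis_x: "row_basis (Suc d) x X"
proof -
  have zero: "v = 0" if "v \<in> X" "\<forall>j\<in>set cs. v j = 0" for v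
    using that vanishing_cs by (auto simp: vanishing_def)
  have mem: "x k \<in> X" if "k < length cs" for k using that x_in length_cs by simp
  have dual: "x k (cs ! l) = of_bool (k = l)" if "k < length cs" "l < length cs" for k l
    using that x_dual length_cs by simp
  show "row_basis (Suc d) x X"
    using dual_rows_basis[where V = X and js = cs and w = x, OF subspace_X mem dual zero]
    unfolding length_cs .
qed

lemma dim_X: "fun_vs.dim X = Suc d"
  using row_basis_dim[OF row_basis_x] .

lemma minor_x_cs: "minor x cs = 1"
proof -
  have "mat (Suc d) (Suc d) (\<lambda>(i, l). x i (cs ! l)) = 1\<^sub>m (Suc d)"
    by (rule eq_matI) (auto simp: x_dual)
  then show ?thesis by (simp add: minor_def length_cs)
qed

definition hyperplane_space :: "(nat set \<Rightarrow> 'k) set" where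
  "hyperplane_space =
     fun_vs.span ((\<lambda>k. hyperplane_coords d n x (\<lambda>i. of_bool (i = k))) ` {..<Suc d})"

lemma hyperplane_space_eq: "hyperplane_space = range (hyperplane_coords d n x)"
proof
  show "hyperplane_space \<subseteq> range (hyperplane_coords d n x)"
  proof
    fix p assume "p \<in> hyperplane_space"
    then obtain c where
      "p = (\<lambda>J. \<Sum>k<Suc d. c k * hyperplane_coords d n x (\<lambda>i. of_bool (i = k)) J)"
      unfolding hyperplane_space_def in_span_rows_iff by (rule exE)
    then show "p \<in> range (hyperplane_coords d n x)"
      unfolding hyperplane_coords_linear[symmetric] by simp
  qed
  show "range (hyperplane_coords d n x) \<subseteq> hyperplane_space"
  proof
    fix p assume "p \<in> range (hyperplane_coords d n x)"
    then obtain lam where "p = hyperplane_coords d n x lam" by (rule imageE)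
    then have "p = (\<lambda>J. \<Sum>k<Suc d. lam k * hyperplane_coords d n x (\<lambda>i. of_bool (i = k)) J)"
      by (simp only: hyperplane_coords_linear[of d n x lam])
    then show "p \<in> hyperplane_space"
      unfolding hyperplane_space_def in_span_rows_iff by (intro exI[of _ lam])
  qed
qed

sublocale hyperplanes: finite_coord_subspace "dsets n d" hyperplane_space
proof
  show "finite (dsets n d)" by (rule finite_dsets)
  show "fun_vs.subspace hyperplane_space" unfolding hyperplane_space_def by (rule fun_vs.subspace_span)
  show "hyperplane_space \<subseteq> coord_space (dsets n d)"
    unfolding hyperplane_space_eq by (auto simp: coord_space_def hyperplane_coords_def)
  show "\<exists>m R. fun_vs.span (R ` {..<m::nat}) = hyperplane_space"
    unfolding hyperplane_space_def by (intro exI) (rule refl)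
qed

text \<open>
  With respect to a second basis \<open>R\<close> of \<open>X\<close>, the last coordinate is the functional with the value
  \<open>T i d\<close> at \<open>x i\<close>, and \<open>R 0, \<dots>, R (d - 1)\<close> is a basis of its kernel.  In the basis \<open>R\<close> the
  additional column is a unit vector, which leaves the minors of these \<open>d\<close> rows.
\<close>

lemma hyperplane_coords_base_change:
  assumes T: "\<And>i j. i \<le> d \<Longrightarrow> x i j = (\<Sum>k<Suc d. T i k * R k j)"
  shows "\<exists>c. c \<noteq> 0 \<and> hyperplane_coords d n x (\<lambda>i. T i d) =
      fscale c (\<lambda>J. if J \<in> dsets n d then minor R (sorted_list_of_set J) else 0)"
proof -
  define c where "c = det (mat (Suc d) (Suc d) (\<lambda>(i, k). T i k))"
  have "minor x cs = c * minor R cs"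
    unfolding c_def length_cs[symmetric] using T length_cs by (intro minor_base_change) auto
  then have c: "c \<noteq> 0" using minor_x_cs by auto
  have "minor (with_column_0 x (\<lambda>i. T i d)) (sorted_list_of_set J @ [0]) =
      c * minor R (sorted_list_of_set J)" if "J \<in> dsets n d" for J
  proof -
    let ?js = "sorted_list_of_set J" and ?R = "with_column_0 R (\<lambda>l. of_bool (l = d))"
    note J = dsetsD[OF that]
    have len: "length (?js @ [0]) = Suc d" using J(3) by simp
    have "minor (with_column_0 x (\<lambda>i. T i d)) (?js @ [0])
        = det (mat (length (?js @ [0])) (length (?js @ [0])) (\<lambda>(i, k). T i k)) * minor ?R (?js @ [0])"
    proof (rule minor_base_change)
      fix i j assume "i < length (?js @ [0])" "j \<in> set (?js @ [0])"
      then have i: "i \<le> d" using J(3) by simp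
      have "(\<Sum>k<Suc d. T i k * of_bool (k = d)) = T i d"
        by (subst sum_delta_mult') auto
      then show "with_column_0 x (\<lambda>i. T i d) i j = (\<Sum>k<length (?js @ [0]). T i k * ?R k j)"
        using J(3) T[OF i, of j] by (cases "j = 0") simp_all
    qed
    also have "minor ?R (?js @ [0]) = minor R ?js"
      using minor_with_column_0(2)[of ?js R] J by simp
    finally show ?thesis unfolding len c_def .
  qed
  then have "hyperplane_coords d n x (\<lambda>i. T i d) =
      fscale c (\<lambda>J. if J \<in> dsets n d then minor R (sorted_list_of_set J) else 0)"
    by (auto simp: hyperplane_coords_def fscale_def)
  then show ?thesis using c by blast
qed

text \<open>
  A basis of \<open>Y\<close> extends by one vector to a basis of \<open>X\<close>; the functional that takes the last
  coordinate in this basis has the kernel \<open>Y\<close>.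
\<close>

lemma plucker_coords_in_hyperplane_space:
  assumes "Y \<subseteq> X" "plucker_coords d n Y p"
  shows "p \<in> hyperplane_space"
proof -
  obtain R where R: "row_basis d R Y"
    "p = (\<lambda>J. if J \<in> dsets n d then minor R (sorted_list_of_set J) else 0)"
    using assms(2) unfolding plucker_coords_def by auto
  obtain v where v: "row_basis (Suc d) (R(d := v)) X"
    by (rule row_basis_extend[OF R(1) assms(1) dim_X subspace_X])
  let ?R = "R(d := v)"
  have "\<forall>i. \<exists>t. i \<le> d \<longrightarrow> x i = (\<lambda>j. \<Sum>k<Suc d. t k * ?R k j)"
  proof
    fix i
    show "\<exists>t. i \<le> d \<longrightarrow> x i = (\<lambda>j. \<Sum>k<Suc d. t k * ?R k j)"
    proof (cases "i \<le> d")
      case True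
      obtain t where "x i = (\<lambda>j. \<Sum>k<Suc d. t k * ?R k j)"
        by (rule row_basis_expand[OF v x_in[OF True]])
      then show ?thesis by (intro exI[of _ t] impI)
    qed simp
  qed
  then obtain T where T: "\<forall>i. i \<le> d \<longrightarrow> x i = (\<lambda>j. \<Sum>k<Suc d. T i k * ?R k j)"
    unfolding choice_iff by (rule exE)
  then have "x i j = (\<Sum>k<Suc d. T i k * ?R k j)" if "i \<le> d" for i j
    using that by (metis (no_types))
  from hyperplane_coords_base_change[OF this]
  obtain c where c: "c \<noteq> 0" "hyperplane_coords d n x (\<lambda>i. T i d) =
      fscale c (\<lambda>J. if J \<in> dsets n d then minor ?R (sorted_list_of_set J) else 0)"
    by auto
  have "minor ?R (sorted_list_of_set J) = minor R (sorted_list_of_set J)" if "J \<in> dsets n d" for J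
  proof -
    have "mat d d (\<lambda>(i, l). ?R i (sorted_list_of_set J ! l)) = mat d d (\<lambda>(i, l). R i (sorted_list_of_set J ! l))"
      by (rule eq_matI) auto
    then show ?thesis using dsetsD(3)[OF that] by (simp add: minor_def)
  qed
  then have "fscale c p \<in> hyperplane_space"
    unfolding hyperplane_space_eq R(2) using c(2)
    by (intro image_eqI[of _ _ "\<lambda>i. T i d"]) (auto simp: fscale_def)
  then have "fscale (1 / c) (fscale c p) \<in> hyperplane_space"
    by (rule fun_vs.subspace_scale[OF hyperplanes.subspace_V])
  then show ?thesis using c(1) by (simp add: fscale_def)
qed

lemma hyperplane_coords_in_plucker_image:
  assumes k0: "k0 \<le> d" "lam k0 \<noteq> 0"
  shows "hyperplane_coords d n x lam \<in> \<Union> (plucker_image d n {Y \<in> Gr d n. Y \<subseteq> X})"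
proof -
  \<comment> \<open>\<open>\<sigma>\<close> enumerates the indices other than \<open>k0\<close>; the first \<open>d\<close> rows of \<open>R\<close> are the projections of
    the corresponding rows of \<open>x\<close> to the kernel of the functional along \<open>x k0\<close>.\<close>
  define \<sigma> where "\<sigma> = (\<lambda>i. if i = k0 then d else i)"
  define R where "R = (\<lambda>i. if i = d then fscale (1 / lam k0) (x k0)
    else x (\<sigma> i) - fscale (lam (\<sigma> i) / lam k0) (x k0))"
  define T where "T = (\<lambda>i k. if k = d then lam i else of_bool (i \<noteq> k0 \<and> \<sigma> k = i))"
  have RX: "R i \<in> X" if "i \<le> d" for i
    using that k0 unfolding R_def \<sigma>_def
    by (auto intro!: fun_vs.subspace_scale fun_vs.subspace_diff subspace_X x_in)
  have T: "x i j = (\<Sum>k<Suc d. T i k * R k j)" if i: "i \<le> d" for i j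
  proof (cases "i = k0")
    case True
    have "(\<Sum>k<d. T i k * R k j) = 0"
      using True by (intro sum.neutral) (simp add: T_def)
    then show ?thesis using True k0(2) by (simp add: T_def R_def fscale_def)
  next
    case False
    define m where "m = (if i = d then k0 else i)"
    have m: "m < d" "\<sigma> m = i" using False i k0(1) by (auto simp: m_def \<sigma>_def)
    have "(\<Sum>k<d. T i k * R k j) = (\<Sum>k<d. of_bool (k = m) * R k j)"
      using False i by (intro sum.cong) (auto simp: T_def \<sigma>_def m_def)
    also have "\<dots> = R m j" using m(1) by (subst sum_delta_mult) auto
    finally have "(\<Sum>k<Suc d. T i k * R k j) = R m j + lam i * R d j"
      unfolding sum.lessThan_Suc by (simp add: T_def)
    then show ?thesis using m k0(2) by (simp add: R_def fscale_def)
  qed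
  have Td: "T i d = lam i" for i by (simp add: T_def)
  obtain c where c: "c \<noteq> 0" "hyperplane_coords d n x lam =
      fscale c (\<lambda>J. if J \<in> dsets n d then minor R (sorted_list_of_set J) else 0)"
    using hyperplane_coords_base_change[of T R, OF T] unfolding Td by auto
  have "fun_vs.span (R ` {..<Suc d}) = X"
  proof
    show "fun_vs.span (R ` {..<Suc d}) \<subseteq> X"
      using RX subspace_X by (intro fun_vs.span_minimal) auto
    have "x i \<in> fun_vs.span (R ` {..<Suc d})" if "i \<le> d" for i
      unfolding in_span_rows_iff using T[OF that] by (intro exI[of _ "T i"] ext)
    then have "fun_vs.span (x ` {..<Suc d}) \<subseteq> fun_vs.span (R ` {..<Suc d})"
      by (intro fun_vs.span_minimal fun_vs.subspace_span) auto
    then show "X \<subseteq> fun_vs.span (R ` {..<Suc d})"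
      using row_basis_x by (simp add: row_basis_def)
  qed
  then have "row_basis (Suc d) R X" using dim_X by (rule row_basis_of_spanning)
  then have inj: "inj_on R {..<Suc d}" and ind: "fun_vs.independent (R ` {..<Suc d})"
    by (simp_all add: row_basis_def)
  define Y where "Y = fun_vs.span (R ` {..<d})"
  have "R ` {..<d} \<subseteq> R ` {..<Suc d}" by (intro image_mono) auto
  then have "row_basis d R Y"
    unfolding row_basis_def Y_def
    using inj_on_subset[OF inj, of "{..<d}"] fun_vs.independent_mono[OF ind, of "R ` {..<d}"] by auto
  have "Y \<subseteq> X" unfolding Y_def using RX subspace_X by (intro fun_vs.span_minimal) auto
  have "Y \<in> Gr d n"
    using \<open>row_basis d R Y\<close> row_basis_subspace row_basis_dim \<open>Y \<subseteq> X\<close> X_coords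
    by (auto simp: Gr_def)
  define p where "p = (\<lambda>J. if J \<in> dsets n d then minor R (sorted_list_of_set J) else 0)"
  have "plucker_coords d n Y p"
    unfolding plucker_coords_def p_def using \<open>row_basis d R Y\<close> by blast
  then have "fun_vs.span {p} \<in> plucker_image d n {Y \<in> Gr d n. Y \<subseteq> X}"
    unfolding plucker_image_def using \<open>Y \<in> Gr d n\<close> \<open>Y \<subseteq> X\<close> by blast
  moreover have "hyperplane_coords d n x lam \<in> fun_vs.span {p}"
    unfolding c(2) p_def by (intro fun_vs.span_scale fun_vs.span_base) simp
  ultimately show ?thesis by (rule UnionI)
qed

theorem underlying_space_hyperplanes:
  "underlying_space (plucker_image d n {Y \<in> Gr d n. Y \<subseteq> X}) = hyperplane_space" (is "?U = _")
proof
  show "?U \<subseteq> hyperplane_space"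
  proof
    fix y assume "y \<in> ?U"
    then consider "y = 0" | Y p where "Y \<subseteq> X" "plucker_coords d n Y p" "y \<in> fun_vs.span {p}"
      unfolding underlying_space_def plucker_image_def by auto
    then show "y \<in> hyperplane_space"
    proof cases
      case 1
      then show ?thesis using fun_vs.subspace_0[OF hyperplanes.subspace_V] by simp
    next
      case 2
      have "fun_vs.span {p} \<subseteq> hyperplane_space"
        using plucker_coords_in_hyperplane_space[OF 2(1,2)] hyperplanes.subspace_V
        by (intro fun_vs.span_minimal) auto
      then show ?thesis using 2(3) by (rule subsetD)
    qed
  qed
  show "hyperplane_space \<subseteq> ?U"
  proof
    fix y assume "y \<in> hyperplane_space"
    then obtain lam where y: "y = hyperplane_coords d n x lam" unfolding hyperplane_space_eq by (rule imageE)
    show "y \<in> ?U"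
    proof (cases "\<exists>k\<le>d. lam k \<noteq> 0")
      case True
      then show ?thesis
        using hyperplane_coords_in_plucker_image unfolding underlying_space_def y by auto
    next
      case False
      then have "y = 0" unfolding y hyperplane_coords_linear[of d n x lam] by (simp add: fun_eq_iff)
      then show ?thesis by (simp add: underlying_space_def)
    qed
  qed
qed

end

section \<open>The projected space and the decomposition of its matroid\<close>

lemma matroid_eqI: "ground M = ground N \<Longrightarrow> indep M = indep N \<Longrightarrow> M = (N :: 'a matroid)"
  by (rule matroid.equality) simp_all

lemma (in coordinate_chart) LS_empty: "LS d n {} X = plucker_image d n {Y \<in> Gr d n. Y \<subseteq> X}"
proof -
  have "pr {} = (\<lambda>v :: nat \<Rightarrow> 'k. v)" by (simp add: pr_def fun_eq_iff)
  then show ?thesis by (simp add: LS_def)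
qed

lemma (in coordinate_chart) hyperplane_coords_cong:
  "(\<And>i. i \<le> d \<Longrightarrow> lam i = lam' i) \<Longrightarrow> hyperplane_coords d n x lam = hyperplane_coords d n x lam'"
  unfolding hyperplane_coords_linear[of d n x lam] hyperplane_coords_linear[of d n x lam']
  by (intro ext sum.cong) auto

lemma (in coordinate_chart) indep_hyperplanes_iff:
  "I \<in> indep (linear_matroid (dsets n d) hyperplane_space) \<longleftrightarrow> I \<subseteq> dsets n d \<and>
    (\<forall>c. (\<forall>lam. (\<Sum>J\<in>I. c J * hyperplane_coords d n x lam J) = 0) \<longrightarrow> (\<forall>J\<in>I. c J = 0))"
  unfolding hyperplanes.indep_iff_no_relation unfolding hyperplane_space_eq by simp

lemma (in coordinate_chart) no_relation:
  assumes "I \<in> indep (linear_matroid (dsets n d) hyperplane_space)"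
    and "\<And>lam. (\<Sum>J\<in>I. c J * hyperplane_coords d n x lam J) = 0" and "J \<in> I"
  shows "c J = 0"
  using assms(1)[unfolded indep_hyperplanes_iff, THEN conjunct2, THEN spec, of c] assms(2,3) by simp

lemma (in coordinate_chart) indep_hyperplanes_subset:
  assumes "I \<in> indep (linear_matroid (dsets n d) hyperplane_space)" "I' \<subseteq> I"
  shows "I' \<in> indep (linear_matroid (dsets n d) hyperplane_space)"
  using assms separates_subset[of hyperplane_space I I'] unfolding hyperplanes.indep_iff by auto

locale projected_chart = coordinate_chart d n X cs x
  for d n :: nat and X :: "(nat \<Rightarrow> 'k::field) set" and cs :: "nat list"
    and x :: "nat \<Rightarrow> nat \<Rightarrow> 'k" +
  fixes S :: "nat set"
  assumes S_subset: "S \<subseteq> set cs"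
begin

text \<open>
  A space \<open>Y \<subseteq> K\<^sup>n\<close> satisfies \<open>pr S ` Y \<subseteq> X\<close> iff \<open>Y \<subseteq> W\<close>.  As the coordinates in \<open>S\<close> are
  independent on \<open>X\<close>, the space \<open>W\<close> is the direct sum of \<open>K\<^sup>S\<close> and the subspace of \<open>X\<close> where these
  coordinates vanish, and it has the same dimension as \<open>X\<close>.
\<close>

definition W :: "(nat \<Rightarrow> 'k) set" where
  "W = {v \<in> coord_space {1..n}. pr S v \<in> X}"

definition w :: "nat \<Rightarrow> nat \<Rightarrow> 'k" where
  "w k = (if cs ! k \<in> S then (\<lambda>j. of_bool (j = cs ! k)) else x k)"

lemma pivot_of:
  assumes "a \<in> S"
  obtains k where "k \<le> d" "cs ! k = a"
  using assms S_subset length_cs by (metis in_set_conv_nth less_Suc_eq_le subsetD)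

lemma S_range: "S \<subseteq> {1..n}" and finite_S: "finite S"
  using S_subset cs_range finite_subset by auto

lemma pr_eq_self: "(\<And>a. a \<in> S \<Longrightarrow> v a = 0) \<Longrightarrow> pr S v = v"
  by (auto simp: pr_def)

lemma w_dual: "k \<le> d \<Longrightarrow> l \<le> d \<Longrightarrow> w k (cs ! l) = of_bool (k = l)"
  using x_dual distinct_cs length_cs by (auto simp: w_def nth_eq_iff_index_eq)

sublocale W: coordinate_chart d n W cs w
proof
  show "fun_vs.subspace W"
  proof (rule fun_vs.subspaceI)
    have "pr S 0 = (0 :: nat \<Rightarrow> 'k)" by (simp add: pr_def fun_eq_iff)
    then show "0 \<in> W" using fun_vs.subspace_0[OF subspace_X] by (simp add: W_def coord_space_def)
  next
    fix u v assume "u \<in> W" "v \<in> W"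
    moreover have "pr S (u + v) = pr S u + pr S v" by (simp add: pr_def fun_eq_iff)
    ultimately show "u + v \<in> W"
      using fun_vs.subspace_add[OF subspace_X, of "pr S u" "pr S v"] by (simp add: W_def coord_space_def)
  next
    fix c v assume "v \<in> W"
    moreover have "pr S (fscale c v) = fscale c (pr S v)" by (simp add: pr_def fscale_def fun_eq_iff)
    ultimately show "fscale c v \<in> W"
      using fun_vs.subspace_scale[OF subspace_X, of "pr S v" c] by (simp add: W_def coord_space_def fscale_def)
  qed
  show "W \<subseteq> coord_space {1..n}" by (auto simp: W_def)
  show "length cs = Suc d" "distinct cs" "set cs \<subseteq> {1..n}"
    by (rule length_cs distinct_cs cs_range)+
  show "w k \<in> W" if "k \<le> d" for k
  proof (cases "cs ! k \<in> S")
    case True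
    then have "pr S (w k) = 0" by (auto simp: pr_def w_def fun_eq_iff)
    then have "pr S (w k) \<in> X" using fun_vs.subspace_0[OF subspace_X] by simp
    moreover have "w k \<in> coord_space {1..n}"
      using True S_range by (auto simp: w_def coord_space_def)
    ultimately show ?thesis by (simp add: W_def)
  next
    case False
    have "pr S (x k) = x k"
    proof (rule pr_eq_self)
      fix a assume a: "a \<in> S"
      then obtain l where "l \<le> d" "cs ! l = a" by (rule pivot_of)
      then show "x k a = 0" using x_dual[OF that, of l] a False by auto
    qed
    then show ?thesis using False x_in[OF that] X_coords by (auto simp: w_def W_def)
  qed
  show "w k (cs ! l) = of_bool (k = l)" if "k \<le> d" "l \<le> d" for k l
    by (rule w_dual[OF that])
  show "vanishing W (set cs) \<subseteq> {0}"
  proof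
    fix v assume v: "v \<in> vanishing W (set cs)"
    then have "pr S v = v" using S_subset by (intro pr_eq_self) (auto simp: vanishing_def)
    then have "v \<in> vanishing X (set cs)" using v by (simp add: vanishing_def W_def)
    then show "v \<in> {0}" using vanishing_cs by blast
  qed
qed

lemma LS_eq: "LS d n S X = plucker_image d n {Y \<in> Gr d n. Y \<subseteq> W}"
proof -
  have "pr S ` Y \<subseteq> X \<longleftrightarrow> Y \<subseteq> W" if "Y \<in> Gr d n" for Y
    using that by (auto simp: Gr_def W_def)
  then have "{Y \<in> Gr d n. pr S ` Y \<subseteq> X} = {Y \<in> Gr d n. Y \<subseteq> W}" by blast
  then show ?thesis by (simp add: LS_def)
qed

abbreviation "hw \<equiv> hyperplane_coords d n w"
abbreviation "hx \<equiv> hyperplane_coords d n x"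
abbreviation unit :: "nat \<Rightarrow> nat \<Rightarrow> 'k" where "unit k \<equiv> (\<lambda>i. of_bool (i = k))"

text \<open>
  The row of the pivot \<open>cs ! k \<in> S\<close> is a unit vector.  If \<open>J\<close> does not contain the pivot, this row has
  its only entry \<open>lam k\<close> in the additional column.
\<close>

lemma hw_missing:
  assumes J: "J \<in> dsets n d" and k: "k \<le> d" "cs ! k \<in> S - J"
  shows "hw lam J = lam k * hw (unit k) J"
proof -
  note J' = dsetsD[OF J]
  have "w k j = 0" if "j \<in> J" for j using that k by (auto simp: w_def)
  then show ?thesis
    using minor_with_column_0(3)[of "sorted_list_of_set J" k w lam] J J' k
    by (simp add: hyperplane_coords_def)
qed

lemma hw_unit:
  assumes J: "J \<in> dsets n d" and k: "k \<le> d" "cs ! k \<in> S"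
  shows "hw (unit k) J = minor w (sorted_list_of_set J @ [cs ! k])"
proof -
  have "hw (unit k) = hw (\<lambda>i. w i (cs ! k))"
    using w_dual k by (intro W.hyperplane_coords_cong) auto
  then show ?thesis
    using minor_with_copied_column[of "sorted_list_of_set J" w "cs ! k"] J dsetsD[OF J]
    by (simp add: hyperplane_coords_def)
qed

text \<open>
  If \<open>J\<close> contains the pivot, then the minor has two equal columns.  Otherwise \<open>J\<close> misses a second
  element of \<open>S\<close>, whose row is zero.
\<close>

lemma hw_unit_eq_0:
  assumes J: "J \<in> dsets n d" and k: "k \<le> d" "cs ! k \<in> S" and SJ: "S - J \<noteq> {cs ! k}"
  shows "hw (unit k) J = 0"
proof (cases "cs ! k \<in> J")
  case True
  then show ?thesis
    unfolding hw_unit[OF J k] using dsetsD(2)[OF J] by (intro minor_repeated_column) simp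
next
  case False
  then obtain a where a: "a \<in> S - J" "a \<noteq> cs ! k" using SJ k(2) by blast
  then have "a \<in> S" by blast
  then obtain l where l: "l \<le> d" "cs ! l = a" by (rule pivot_of)
  have "hw (unit k) J = unit k l * hw (unit l) J"
    using hw_missing[OF J l(1)] l(2) a(1) by blast
  moreover have "l \<noteq> k" using l(2) a(2) by blast
  ultimately show ?thesis by simp
qed

text \<open>
  The rows of \<open>w\<close> and \<open>x\<close> differ only in the rows of the pivots in \<open>S\<close>, and the columns of these
  pivots are unit vectors.
\<close>

lemma hw_eq_hx:
  assumes J: "J \<in> dsets n d" and SJ: "S \<subseteq> J"
  shows "hw lam J = hx lam J"
proof -
  note J' = dsetsD[OF J]
  have "minor (with_column_0 w lam) (sorted_list_of_set J @ [0]) =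
      minor (with_column_0 x lam) (sorted_list_of_set J @ [0])"
  proof (rule minor_cong_pivot_rows[of "{k. k \<le> d \<and> cs ! k \<in> S}"])
    fix k assume k: "k \<in> {k. k \<le> d \<and> cs ! k \<in> S}"
    then have "cs ! k \<in> J" using SJ by auto
    moreover from this have "cs ! k \<noteq> 0" using J'(4) by metis
    ultimately have "cs ! k \<in> J" "cs ! k \<noteq> 0" by blast+
    then show "k < length (sorted_list_of_set J @ [0]) \<and>
      (\<exists>j\<in>set (sorted_list_of_set J @ [0]). \<forall>i<length (sorted_list_of_set J @ [0]).
        with_column_0 w lam i j = of_bool (i = k) \<and> with_column_0 x lam i j = of_bool (i = k))"
      using k J' w_dual x_dual by (intro conjI bexI[of _ "cs ! k"]) auto
  next
    fix i j assume "i < length (sorted_list_of_set J @ [0])" "i \<notin> {k. k \<le> d \<and> cs ! k \<in> S}"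
    then have "cs ! i \<notin> S" using J' by auto
    then show "with_column_0 w lam i j = with_column_0 x lam i j" by (simp add: w_def)
  qed simp
  then show ?thesis using J by (simp add: hyperplane_coords_def)
qed

text \<open>
  The column of the pivot \<open>a = cs ! k\<close> is the unit vector \<open>e\<^sub>k\<close>, so that the left hand side is a
  Pluecker coordinate of \<open>W\<close> at \<open>J \<union> {a} \<supseteq> S\<close>.  The vectors of \<open>X\<close> and of \<open>W\<close> that vanish on this
  set agree, because both vanish on \<open>S\<close>.
\<close>

lemma hw_unit_ne_0_iff:
  assumes q: "plucker_coords (Suc d) n X q"
    and J: "J \<in> dsets n d" and k: "k \<le> d" and SJ: "S - J = {cs ! k}"
  shows "hw (unit k) J \<noteq> 0 \<longleftrightarrow> q (insert (cs ! k) J) \<noteq> 0"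
proof -
  let ?a = "cs ! k" and ?js = "sorted_list_of_set J @ [cs ! k]" and ?C = "insert (cs ! k) J"
  note J' = dsetsD[OF J]
  have a: "?a \<in> S" "?a \<notin> J" using SJ by auto
  have "card ?C = Suc d" using J' a(2) J by (simp add: dsets_def)
  then have C: "?C \<in> dsets n (Suc d)" using J' a(1) S_range by (auto simp: dsets_def)
  obtain R where R: "row_basis (Suc d) R X"
    "q = (\<lambda>J. if J \<in> dsets n (Suc d) then minor R (sorted_list_of_set J) else 0)"
    using q unfolding plucker_coords_def by auto
  have len: "length ?js = Suc d" "length (sorted_list_of_set ?C) = Suc d"
    using J'(3) dsetsD(3)[OF C] by simp_all
  have "hw (unit k) J = 0 \<longleftrightarrow> (\<exists>v\<in>W. v \<noteq> 0 \<and> (\<forall>j\<in>set ?js. v j = 0))"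
    unfolding hw_unit[OF J k a(1)]
    by (rule minor_eq_0_iff) (unfold len, rule W.row_basis_x)
  also have "\<dots> \<longleftrightarrow> (\<exists>v\<in>X. v \<noteq> 0 \<and> (\<forall>j\<in>?C. v j = 0))"
  proof -
    have "v \<in> W \<longleftrightarrow> v \<in> X" if "\<forall>j\<in>?C. v j = 0" for v
    proof -
      have "S \<subseteq> ?C" using SJ by blast
      then have "pr S v = v" using that by (intro pr_eq_self) blast
      then show ?thesis using X_coords by (auto simp: W_def)
    qed
    moreover have "set ?js = ?C" using J' by auto
    ultimately show ?thesis by auto
  qed
  also have "\<dots> \<longleftrightarrow> q ?C = 0"
    using minor_eq_0_iff[of "sorted_list_of_set ?C" R X, unfolded len, OF R(1)] C dsetsD(2)[OF C]
    by (simp add: R(2))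
  finally show ?thesis by simp
qed

text \<open>
  As a functional of \<open>lam\<close>, the coordinate at \<open>J\<close> depends only on \<open>lam k\<close> if \<open>J\<close> misses exactly
  the pivot \<open>cs ! k\<close> of \<open>S\<close>, it is zero if \<open>J\<close> misses two elements of \<open>S\<close>, and it depends only on
  the remaining entries of \<open>lam\<close> if \<open>J\<close> contains \<open>S\<close>.  These blocks of variables are disjoint, so a
  linear relation splits into one relation for each block.
\<close>

lemma indep_iff_components:
  assumes q: "plucker_coords (Suc d) n X q" and I: "I \<subseteq> dsets n d"
  shows "I \<in> indep (linear_matroid (dsets n d) W.hyperplane_space) \<longleftrightarrow>
    {J \<in> I. S \<subseteq> J} \<in> indep (linear_matroid (dsets n d) hyperplane_space) \<and>
    {J \<in> I. 2 \<le> card (S - J)} = {} \<and>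
    (\<forall>a\<in>S. {J \<in> I. S - J = {a}} = {} \<or>
      (\<exists>J. {J \<in> I. S - J = {a}} = {J} \<and> q (insert a J) \<noteq> 0))"
    (is "?ind I \<longleftrightarrow> ?X \<and> ?two \<and> ?one")
proof
  assume ind: "?ind I"
  have no_loop: "\<exists>lam. hw lam J \<noteq> 0" if J: "J \<in> I" for J
  proof (rule ccontr)
    assume "\<not> ?thesis"
    then have rel: "(\<Sum>J\<in>{J}. 1 * hw lam J) = 0" for lam by simp
    have "?ind {J}" using W.indep_hyperplanes_subset[OF ind] J by simp
    from W.no_relation[OF this, of "\<lambda>_. 1" J, OF rel] show False by simp
  qed
  have "?ind {J \<in> I. S \<subseteq> J}" using W.indep_hyperplanes_subset[OF ind] by simp
  moreover have "(\<Sum>J\<in>{J \<in> I. S \<subseteq> J}. c J * hw lam J) = (\<Sum>J\<in>{J \<in> I. S \<subseteq> J}. c J * hx lam J)" for c lam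
    using I hw_eq_hx by (intro sum.cong) auto
  ultimately have ?X unfolding W.indep_hyperplanes_iff indep_hyperplanes_iff by simp
  moreover have ?two
  proof (rule ccontr)
    assume "\<not> ?two"
    then obtain J where J: "J \<in> I" "2 \<le> card (S - J)" by blast
    then have "S - J \<noteq> {}" by (metis card.empty not_numeral_le_zero)
    then obtain a where a: "a \<in> S" "a \<notin> J" by blast
    obtain k where k: "k \<le> d" "cs ! k = a" using a(1) by (rule pivot_of)
    have "S - J \<noteq> {cs ! k}" using J(2) by auto
    then have "hw lam J = 0" for lam
      using hw_missing[of J k lam] hw_unit_eq_0[of J k] J(1) I a k by auto
    then show False using no_loop[OF J(1)] by blast
  qed
  moreover have ?one
  proof
    fix a assume a: "a \<in> S"
    then obtain k where k: "k \<le> d" "cs ! k = a" by (rule pivot_of)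
    have ne: "hw (unit k) J \<noteq> 0" if "J \<in> I" "S - J = {a}" for J
      using no_loop[OF that(1)] hw_missing[of J k] I k that by auto
    have unique: "J = J'" if J: "J \<in> I" "S - J = {a}" and J': "J' \<in> I" "S - J' = {a}" for J J'
    proof (rule ccontr)
      assume "J \<noteq> J'"
      \<comment> \<open>The coordinates at \<open>J\<close> and \<open>J'\<close> are multiples of the same variable \<open>lam k\<close>.\<close>
      define c where "c = (\<lambda>L. if L = J then hw (unit k) J' else - hw (unit k) J)"
      have JD: "J \<in> dsets n d" "J' \<in> dsets n d" using J(1) J'(1) I by blast+
      have rel: "(\<Sum>L\<in>{J, J'}. c L * hw lam L) = 0" for lam
      proof -
        have "hw lam J = lam k * hw (unit k) J" "hw lam J' = lam k * hw (unit k) J'"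
          using J(2) J'(2) k by (auto intro!: hw_missing JD)
        then show ?thesis using \<open>J \<noteq> J'\<close> by (simp add: c_def)
      qed
      have "?ind {J, J'}" using W.indep_hyperplanes_subset[OF ind] J J' by simp
      from W.no_relation[OF this, of c J, OF rel] show False using ne[OF J'] by (simp add: c_def)
    qed
    show "{J \<in> I. S - J = {a}} = {} \<or> (\<exists>J. {J \<in> I. S - J = {a}} = {J} \<and> q (insert a J) \<noteq> 0)"
    proof (cases "{J \<in> I. S - J = {a}} = {}")
      case False
      then obtain J where J: "J \<in> I" "S - J = {a}" by blast
      then have "{J \<in> I. S - J = {a}} = {J}" using unique by blast
      moreover have "q (insert a J) \<noteq> 0"
        using hw_unit_ne_0_iff[OF q, of J k] ne[OF J] J I k by auto
      ultimately show ?thesis by blast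
    qed simp
  qed
  ultimately show "?X \<and> ?two \<and> ?one" by blast
next
  have finI: "finite I" by (rule finite_subset[OF I finite_dsets])
  assume "?X \<and> ?two \<and> ?one"
  then have X: ?X and two: ?two and one: ?one by blast+
  show "?ind I"
    unfolding W.indep_hyperplanes_iff
  proof (intro conjI allI impI I)
    fix c assume rel: "\<forall>lam. (\<Sum>J\<in>I. c J * hw lam J) = 0"
    have c1: "c J = 0" if J: "J \<in> I" "S - J = {a}" for J a
    proof -
      have "a \<in> S" using J(2) by blast
      then obtain k where k: "k \<le> d" "cs ! k = a" by (rule pivot_of)
      have mem: "J \<in> {J \<in> I. S - J = {a}}" using J by simp
      then have "{J \<in> I. S - J = {a}} \<noteq> {}" by (metis empty_iff)
      with bspec[OF one \<open>a \<in> S\<close>]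
      have "\<exists>J. {J \<in> I. S - J = {a}} = {J} \<and> q (insert a J) \<noteq> 0" by argo
      then obtain J' where J': "{J \<in> I. S - J = {a}} = {J'}" "q (insert a J') \<noteq> 0"
        by (elim exE conjE)
      have "J = J'" using mem unfolding J'(1) by (rule singletonD)
      with J' have single: "{J \<in> I. S - J = {a}} = {J}" "q (insert a J) \<noteq> 0" by simp_all
      have "(\<Sum>L\<in>I. c L * hw (unit k) L) = (\<Sum>L\<in>{J}. c L * hw (unit k) L)"
      proof (rule sum.mono_neutral_right[OF finI])
        show "\<forall>L\<in>I - {J}. c L * hw (unit k) L = 0"
        proof
          fix L assume L: "L \<in> I - {J}"
          then have "S - L \<noteq> {cs ! k}" using single(1) k(2) by blast
          then show "c L * hw (unit k) L = 0"
            using hw_unit_eq_0[of L k] L I k \<open>a \<in> S\<close> by auto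
        qed
      qed (use J in simp)
      then have "c J * hw (unit k) J = 0" using rel by simp
      moreover have "hw (unit k) J \<noteq> 0"
        using hw_unit_ne_0_iff[OF q, of J k] J I k single(2) by auto
      ultimately show ?thesis by simp
    qed
    have c2: "c J = 0" if J: "J \<in> I" "\<not> S \<subseteq> J" for J
    proof -
      have "card (S - J) \<noteq> 0" using J(2) finite_S by auto
      moreover have "\<not> 2 \<le> card (S - J)" using two J(1) by blast
      ultimately have "card (S - J) = 1" by linarith
      then obtain a where "S - J = {a}" by (rule card_1_singletonE)
      then show ?thesis by (rule c1[OF J(1)])
    qed
    have "(\<Sum>J\<in>{J \<in> I. S \<subseteq> J}. c J * hx lam J) = 0" for lam
    proof -
      have "(\<Sum>J\<in>{J \<in> I. S \<subseteq> J}. c J * hx lam J) = (\<Sum>J\<in>{J \<in> I. S \<subseteq> J}. c J * hw lam J)"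
        using I hw_eq_hx by (intro sum.cong) auto
      also have "\<dots> = (\<Sum>J\<in>I. c J * hw lam J)"
        using c2 finI by (intro sum.mono_neutral_left) auto
      finally show ?thesis using rel by simp
    qed
    from no_relation[OF X, of c, OF this] have c3: "c J = 0" if "J \<in> I" "S \<subseteq> J" for J
      using that by simp
    show "\<forall>J\<in>I. c J = 0"
    proof
      fix J assume "J \<in> I"
      then show "c J = 0" using c2 c3 by (cases "S \<subseteq> J") auto
    qed
  qed
qed

theorem linear_matroid_decomposition:
  assumes q: "plucker_coords (Suc d) n X q"
  shows "linear_matroid (dsets n d) W.hyperplane_space =
    matroid_restrict (linear_matroid (dsets n d) hyperplane_space) {J \<in> dsets n d. S \<subseteq> J}
      \<oplus>\<^sub>M M_S0 d n S \<oplus>\<^sub>M direct_sum_family S (M_Sa d n S q)" (is "_ = ?N")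
proof (rule matroid_eqI)
  let ?D = "dsets n d" and ?MX = "linear_matroid (dsets n d) hyperplane_space"
  define A0 where "A0 = {J \<in> ?D. S \<subseteq> J}"
  define A2 where "A2 = {J \<in> ?D. 2 \<le> card (S - J)}"
  define A1 where "A1 = (\<lambda>a. {J \<in> ?D. S - J = {a}})"
  define I1 where "I1 = (\<lambda>a. insert {} {{J} |J. J \<in> ?D \<and> S - J = {a} \<and> q (insert a J) \<noteq> 0})"
  have cover: "?D = A0 \<union> A2 \<union> (\<Union>a\<in>S. A1 a)"
  proof (intro equalityI subsetI)
    fix J assume J: "J \<in> ?D"
    consider "card (S - J) = 0" | "card (S - J) = 1" | "2 \<le> card (S - J)" by linarith
    then show "J \<in> A0 \<union> A2 \<union> (\<Union>a\<in>S. A1 a)"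
    proof cases
      case 1
      then have "S \<subseteq> J" using finite_S by simp
      then show ?thesis using J by (simp add: A0_def)
    next
      case 2
      then obtain a where a: "S - J = {a}" by (rule card_1_singletonE)
      then have "a \<in> S" by blast
      then show ?thesis using J a by (auto simp: A1_def)
    next
      case 3
      then show ?thesis using J by (simp add: A2_def)
    qed
  qed (auto simp: A0_def A1_def A2_def)
  have "ground ?N = A0 \<union> A2 \<union> (\<Union>a\<in>S. A1 a)"
    by (simp add: direct_sum_def direct_sum_family_def matroid_restrict_def M_S0_def M_Sa_def
        A0_def A1_def A2_def)
  then show "ground (linear_matroid ?D W.hyperplane_space) = ground ?N"
    using cover by (simp add: linear_matroid_def)
  have N: "indep ?N = {I. I \<subseteq> A0 \<union> A2 \<union> (\<Union>a\<in>S. A1 a) \<and>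
      (I \<inter> (A0 \<union> A2) \<subseteq> A0 \<union> A2 \<and> I \<inter> (A0 \<union> A2) \<inter> A0 \<in> {I \<in> indep ?MX. I \<subseteq> A0} \<and>
        I \<inter> (A0 \<union> A2) \<inter> A2 \<in> {{}}) \<and>
      (I \<inter> (\<Union>a\<in>S. A1 a) \<subseteq> (\<Union>a\<in>S. A1 a) \<and> (\<forall>a\<in>S. I \<inter> (\<Union>a\<in>S. A1 a) \<inter> A1 a \<in> I1 a))}"
    by (simp add: direct_sum_def direct_sum_family_def matroid_restrict_def M_S0_def M_Sa_def
        A0_def A1_def A2_def I1_def)
  have iff: "I \<in> indep ?N \<longleftrightarrow> I \<in> indep (linear_matroid ?D W.hyperplane_space)" if I: "I \<subseteq> ?D" for I
  proof -
    have e0: "I \<inter> (A0 \<union> A2) \<inter> A0 = {J \<in> I. S \<subseteq> J}"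
      and e2: "I \<inter> (A0 \<union> A2) \<inter> A2 = {J \<in> I. 2 \<le> card (S - J)}"
      using I by (auto simp: A0_def A2_def)
    have e1: "I \<inter> (\<Union>a\<in>S. A1 a) \<inter> A1 a = {J \<in> I. S - J = {a}}" if "a \<in> S" for a
      using I that by (auto simp: A1_def)
    have sub: "I \<subseteq> A0 \<union> A2 \<union> (\<Union>a\<in>S. A1 a)" by (rule I[unfolded cover])
    have sub0: "{J \<in> I. S \<subseteq> J} \<subseteq> A0" using I by (auto simp: A0_def)
    have one: "{J \<in> I. S - J = {a}} \<in> I1 a \<longleftrightarrow> {J \<in> I. S - J = {a}} = {} \<or>
      (\<exists>J. {J \<in> I. S - J = {a}} = {J} \<and> q (insert a J) \<noteq> 0)" for a
    proof -
      have "J \<in> ?D \<and> S - J = {a}" if "{J \<in> I. S - J = {a}} = {J}" for J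
      proof -
        have "J \<in> {J \<in> I. S - J = {a}}" unfolding that by simp
        then show ?thesis using I by blast
      qed
      then show ?thesis unfolding I1_def by blast
    qed
    have "I \<in> indep ?N \<longleftrightarrow> {J \<in> I. S \<subseteq> J} \<in> indep ?MX \<and> {J \<in> I. 2 \<le> card (S - J)} = {} \<and>
        (\<forall>a\<in>S. I \<inter> (\<Union>a\<in>S. A1 a) \<inter> A1 a \<in> I1 a)"
      unfolding N mem_Collect_eq e0 e2 using sub sub0 by blast
    also have "\<dots> \<longleftrightarrow> {J \<in> I. S \<subseteq> J} \<in> indep ?MX \<and> {J \<in> I. 2 \<le> card (S - J)} = {} \<and>
        (\<forall>a\<in>S. {J \<in> I. S - J = {a}} \<in> I1 a)"
      using e1 by simp
    finally show ?thesis unfolding one indep_iff_components[OF q I] .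
  qed
  show "indep (linear_matroid ?D W.hyperplane_space) = indep ?N"
  proof (intro equalityI subsetI)
    fix I assume ind: "I \<in> indep (linear_matroid ?D W.hyperplane_space)"
    then have "I \<subseteq> ?D" by (simp add: W.indep_hyperplanes_iff)
    then show "I \<in> indep ?N" using iff ind by simp
  next
    fix I assume ind: "I \<in> indep ?N"
    then have "I \<subseteq> A0 \<union> A2 \<union> (\<Union>a\<in>S. A1 a)" unfolding N by simp
    then have "I \<subseteq> ?D" by (simp only: cover[symmetric])
    then show "I \<in> indep (linear_matroid ?D W.hyperplane_space)" using iff ind by simp
  qed
qed

end

section \<open>Constant coefficients\<close>

lemma is_subfieldD:
  assumes "is_subfield F"
  shows "0 \<in> F" "1 \<in> F" "x \<in> F \<Longrightarrow> y \<in> F \<Longrightarrow> x + y \<in> F" "x \<in> F \<Longrightarrow> y \<in> F \<Longrightarrow> x * y \<in> F"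
    "x \<in> F \<Longrightarrow> - x \<in> F" "x \<in> F \<Longrightarrow> y \<in> F \<Longrightarrow> x / y \<in> F"
  using assms unfolding is_subfield_def divide_inverse by blast+

text \<open>
  A determinant is a polynomial in the entries with integer coefficients.
\<close>

lemma minor_in_subfield:
  fixes R :: "nat \<Rightarrow> 'i \<Rightarrow> 'k::field"
  assumes F: "is_subfield F" and R: "\<And>i j. i < length js \<Longrightarrow> j \<in> set js \<Longrightarrow> R i j \<in> F"
  shows "minor R js \<in> F"
proof -
  let ?m = "length js"
  let ?A = "mat ?m ?m (\<lambda>(i, j). R i (js ! j))"
  have sum: "(\<Sum>p\<in>P. f p) \<in> F" if "\<And>p. p \<in> P \<Longrightarrow> f p \<in> F" for P and f :: "(nat \<Rightarrow> nat) \<Rightarrow> 'k"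
    using that by (induction P rule: infinite_finite_induct) (auto intro: is_subfieldD[OF F])
  have prod: "(\<Prod>i\<in>P. f i) \<in> F" if "\<And>i. i \<in> P \<Longrightarrow> f i \<in> F" for P and f :: "nat \<Rightarrow> 'k"
    using that by (induction P rule: infinite_finite_induct) (auto intro: is_subfieldD[OF F])
  have "det ?A = (\<Sum>p\<in>{p. p permutes {0..<?m}}. signof p * (\<Prod>i = 0..<?m. ?A $$ (i, p i)))"
    by (rule det_def') simp
  also have "\<dots> \<in> F"
  proof (rule sum)
    fix p assume p: "p \<in> {p. p permutes {0..<?m}}"
    have "(\<Prod>i = 0..<?m. ?A $$ (i, p i)) \<in> F"
    proof (rule prod)
      fix i assume i: "i \<in> {0..<?m}"
      then have "p i < ?m" using p permutes_in_image[of p "{0..<?m}" i] by auto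
      then show "?A $$ (i, p i) \<in> F" using i R[of i "js ! p i"] by simp
    qed
    moreover have "signof p \<in> F"
      using is_subfieldD(2)[OF F] is_subfieldD(5)[OF F is_subfieldD(2)[OF F]]
      by (auto simp: sign_def)
    ultimately show "signof p * (\<Prod>i = 0..<?m. ?A $$ (i, p i)) \<in> F"
      by (intro is_subfieldD(4)[OF F])
  qed
  finally show ?thesis by (simp add: minor_def)
qed

context coordinate_chart
begin

text \<open>
  The reduced row echelon form is computed within the field generated by the entries of any basis.
\<close>

lemma x_in_subfield:
  assumes F: "is_subfield F" and B: "\<And>v i. v \<in> B \<Longrightarrow> v i \<in> F" "X = fun_vs.span B" and k: "k \<le> d"
  shows "x k j \<in> F"
proof -
  have "0 < Suc d \<or> finite B" by simp
  then obtain R where R: "row_basis (Suc d) R X" "\<And>k. k < Suc d \<Longrightarrow> R k \<in> B"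
    by (rule row_basis_exists[OF dim_X _ B(2)]) (rule that; assumption)
  have RF: "R i j \<in> F" if "i < Suc d" for i j using B(1) R(2) that by blast
  have "\<not> (\<exists>v\<in>X. v \<noteq> 0 \<and> (\<forall>j\<in>set cs. v j = 0))"
    using vanishing_cs by (auto simp: vanishing_def)
  then have ne: "minor R cs \<noteq> 0"
    using minor_eq_0_iff[of cs R X, unfolded length_cs, OF R(1)] by simp
  have "minor R (cs[k := j]) = x k j * minor R cs"
  proof (rule minor_replace_column)
    show "x k \<in> fun_vs.span (R ` {..<length cs})"
      using R(1) x_in[OF k] by (simp add: row_basis_def length_cs)
    show "x k (cs ! l) = of_bool (l = k)" if "l < length cs" for l
      using x_dual[OF k, of l] that length_cs by auto
  qed (use k length_cs in simp)
  then have "x k j = minor R (cs[k := j]) / minor R cs" using ne by simp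
  moreover have "minor R (cs[k := j]) \<in> F" "minor R cs \<in> F"
    using RF length_cs by (auto intro!: minor_in_subfield[OF F])
  ultimately show ?thesis using is_subfieldD(6)[OF F] by simp
qed

lemma trivial_valuations_of_subfield:
  assumes F: "is_subfield F" and xF: "\<And>k j. k \<le> d \<Longrightarrow> x k j \<in> F"
    and val: "\<And>y. y \<in> F \<Longrightarrow> y \<noteq> 0 \<Longrightarrow> val y = 0" "val 0 = \<infinity>"
  shows "trivial_valuations val (dsets n d) hyperplane_space"
proof -
  let ?P = "(\<lambda>k. hyperplane_coords d n x (\<lambda>i. of_bool (i = k))) ` {..<Suc d}"
  have "hyperplane_space = fun_vs.span ?P" by (simp add: hyperplane_space_def)
  moreover have "finite ?P" by simp
  ultimately obtain R where R: "row_basis (fun_vs.dim hyperplane_space) R hyperplane_space"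
    "\<And>k. k < fun_vs.dim hyperplane_space \<Longrightarrow> R k \<in> ?P"
    using row_basis_exists[of hyperplane_space "fun_vs.dim hyperplane_space" ?P] by auto
  have "hyperplane_coords d n x (\<lambda>i. of_bool (i = k)) J \<in> F" for k J
  proof (cases "J \<in> dsets n d")
    case True
    have "minor (with_column_0 x (\<lambda>i. of_bool (i = k))) (sorted_list_of_set J @ [0]) \<in> F"
      using xF dsetsD(3)[OF True] is_subfieldD(1,2)[OF F]
      by (intro minor_in_subfield[OF F]) auto
    then show ?thesis using True by (simp add: hyperplane_coords_def)
  qed (simp add: hyperplane_coords_def is_subfieldD(1)[OF F])
  then have "R i J \<in> F" if "i < fun_vs.dim hyperplane_space" for i J using R(2)[OF that] by auto
  then have "minor R js \<in> F" if "length js = fun_vs.dim hyperplane_space" for js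
    using that by (intro minor_in_subfield[OF F]) auto
  then have "val (minor R js) + ereal 0 \<in> {0, \<infinity>}" if "length js = fun_vs.dim hyperplane_space" for js
    using val that by (cases "minor R js = 0") auto
  then show ?thesis
    unfolding trivial_valuations_def by (intro exI[of _ R] conjI R(1) exI[of _ 0]) blast
qed

end

section \<open>Tropicalization of the projected linear space\<close>

theorem corollary34:
  fixes val :: "'k::alg_closed_field \<Rightarrow> ereal"
    and d n :: nat
    and X :: "(nat \<Rightarrow> 'k) set"
    and q :: "nat set \<Rightarrow> 'k"
    and S :: "nat set"
  assumes "nonarch_valuation val"
    and "\<exists>x. x \<noteq> 0 \<and> val x \<noteq> 0"
    and "1 \<le> d" and "d + 1 \<le> n"
    and "X \<in> Gr (d + 1) n"
    and "plucker_coords (d + 1) n X q"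
    and "S \<subseteq> {1..n}"
    and "\<exists>C\<in>dsets n (d + 1). S \<subseteq> C \<and> q C \<noteq> 0"
    and "trivial_valuations val (dsets n d) (underlying_space (LS d n S X))
           \<or> constant_coefficients val X"
  shows "trop val (dsets n d) (LS d n S X)
           = \<Union> (extended_bergman_fan (linear_matroid (dsets n d) (underlying_space (LS d n S X))))
         \<and> linear_matroid (dsets n d) (underlying_space (LS d n S X))
           = M_S d n S X \<oplus>\<^sub>M M_S0 d n S \<oplus>\<^sub>M direct_sum_family S (M_Sa d n S q)"
proof -
  interpret nonarch_valuation val by (rule assms(1))
  obtain R where R: "row_basis (Suc d) R X"
    "q = (\<lambda>J. if J \<in> dsets n (Suc d) then minor R (sorted_list_of_set J) else 0)"
    using assms(6) unfolding plucker_coords_def by auto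
  obtain C where C: "C \<in> dsets n (Suc d)" "S \<subseteq> C" "q C \<noteq> 0" using assms(8) by auto
  define cs where "cs = sorted_list_of_set C"
  have cs: "length cs = Suc d" "set cs = C" "distinct cs"
    using dsetsD[OF C(1)] by (simp_all add: cs_def)
  have ne: "minor R cs \<noteq> 0" using C by (simp add: R(2) cs_def)
  have span: "fun_vs.span (R ` {..<length cs}) = X" using R(1) cs(1) by (simp add: row_basis_def)
  obtain x where x: "\<And>k. k < length cs \<Longrightarrow> x k \<in> X"
    "\<And>k l. k < length cs \<Longrightarrow> l < length cs \<Longrightarrow> x k (cs ! l) = of_bool (k = l)"
    by (rule dual_rows_exist[OF span ne]) (rule that; assumption)
  interpret projected_chart d n X cs x S
  proof
    show "fun_vs.subspace X" "X \<subseteq> coord_space {1..n}" using assms(5) by (simp_all add: Gr_def)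
    show "length cs = Suc d" "distinct cs" "set cs \<subseteq> {1..n}" "S \<subseteq> set cs"
      using cs C dsetsD(5)[OF C(1)] by simp_all
    show "x k \<in> X" if "k \<le> d" for k using that x(1) cs(1) by simp
    show "x k (cs ! l) = of_bool (k = l)" if "k \<le> d" "l \<le> d" for k l using that x(2) cs(1) by simp
    show "vanishing X (set cs) \<subseteq> {0}"
      using ne minor_eq_0_iff[of cs R X, unfolded cs(1), OF R(1)] by (auto simp: vanishing_def)
  qed
  have U: "underlying_space (LS d n S X) = W.hyperplane_space"
    unfolding LS_eq by (rule W.underlying_space_hyperplanes)
  have U0: "underlying_space (LS d n {} X) = hyperplane_space"
    unfolding LS_empty by (rule underlying_space_hyperplanes)
  have "trivial_valuations val (dsets n d) W.hyperplane_space"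
  proof (cases "constant_coefficients val X")
    case True
    then obtain F B where F: "is_subfield F" and F0: "\<forall>x\<in>F. x \<noteq> 0 \<longrightarrow> val x = 0"
      and BF: "\<forall>v\<in>B. \<forall>i. v i \<in> F" and B: "X = fun_vs.span B"
      unfolding constant_coefficients_def by (elim exE conjE)
    have "w k j \<in> F" if "k \<le> d" for k j
      using x_in_subfield[OF F _ B that, of j] BF is_subfieldD(1,2)[OF F] by (simp add: w_def)
    then show ?thesis using F0 by (intro W.trivial_valuations_of_subfield[OF F]) auto
  qed (use assms(9) U in simp)
  then interpret tropical_linear_space "dsets n d" W.hyperplane_space val "LS d n S X"
    using assms(2) U by unfold_locales
  have "linear_matroid (dsets n d) (underlying_space (LS d n S X))
      = M_S d n S X \<oplus>\<^sub>M M_S0 d n S \<oplus>\<^sub>M direct_sum_family S (M_Sa d n S q)"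
    unfolding M_S_def U U0 using assms(6) by (intro linear_matroid_decomposition) simp
  then show ?thesis
    using trop_eq_Union_extended_bergman_fan unfolding U by blast
qed

end
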